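(* For every $\varepsilon>0$ there exists $n_0$ such that for every integer $n\ge n_0$ the following holds. Every graph $G$ on $n$ vertices with minimum degree $\delta(G)\geq (1/2+\varepsilon)n$ contains at least $(1-\varepsilon)\,\mathrm{reg}_{even}(G)/2$ pairwise edge-disjoint Hamilton cycles.
   Context: All graphs are finite and simple. For a graph $G$ and an integer $r\ge 0$, an $r$-factor of $G$ is a spanning $r$-regular subgraph of $G$. $\mathrm{reg}_{even}(G)$ denotes the largest even integer $r$ such that $G$ contains an $r$-factor. *)

theory Defs
  imports Complex_Main
begin

type_synonym 'a graph = "'a set \<times> 'a set set"

abbreviation verts :: "'a graph \<Rightarrow> 'a set" where
  "verts G \<equiv> fst G"

abbreviation edges :: "'a graph \<Rightarrow> 'a set set" where
  "edges G \<equiv> snd G"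

definition simple_graph :: "'a graph \<Rightarrow> bool" where
  "simple_graph G \<longleftrightarrow> finite (verts G) \<and> (\<forall>e\<in>edges G. e \<subseteq> verts G \<and> card e = 2)"

definition degree :: "'a graph \<Rightarrow> 'a \<Rightarrow> nat" where
  "degree G v = card {e \<in> edges G. v \<in> e}"

text \<open>Meaningful only for finite nonempty vertex sets.\<close>

definition min_degree :: "'a graph \<Rightarrow> nat" where
  "min_degree G = Min (degree G ` verts G)"

definition regular :: "nat \<Rightarrow> 'a graph \<Rightarrow> bool" where
  "regular r G \<longleftrightarrow> (\<forall>v\<in>verts G. degree G v = r)"

definition spanning_subgraph :: "'a graph \<Rightarrow> 'a graph \<Rightarrow> bool" where
  "spanning_subgraph H G \<longleftrightarrow> simple_graph H \<and> verts H = verts G \<and> edges H \<subseteq> edges G"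

definition factor :: "nat \<Rightarrow> 'a graph \<Rightarrow> 'a graph \<Rightarrow> bool" where
  "factor r H G \<longleftrightarrow> spanning_subgraph H G \<and> regular r H"

text \<open>For a simple graph with at least one vertex the maximum is over a finite nonempty set;
  see the two lemmas below.\<close>

definition reg_even :: "'a graph \<Rightarrow> nat" where
  "reg_even G = Max {r. even r \<and> (\<exists>H. factor r H G)}"

lemma simple_graph_finite_edges:
  assumes "simple_graph G"
  shows "finite (edges G)"
proof (rule finite_subset)
  show "edges G \<subseteq> Pow (verts G)" using assms by (auto simp: simple_graph_def)
  show "finite (Pow (verts G))" using assms by (simp add: simple_graph_def)
qed

lemma even_factors_nonempty:
  assumes "simple_graph G"
  shows "0 \<in> {r. even r \<and> (\<exists>H. factor r H G)}"
proof -
  have "factor 0 (verts G, {}) G"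
    using assms
    by (simp add: factor_def spanning_subgraph_def simple_graph_def regular_def degree_def)
  then show ?thesis by auto
qed

lemma even_factors_finite:
  assumes "simple_graph G" "verts G \<noteq> {}"
  shows "finite {r. even r \<and> (\<exists>H. factor r H G)}"
proof (rule finite_subset)
  show "{r. even r \<and> (\<exists>H. factor r H G)} \<subseteq> {..card (edges G)}"
  proof
    fix r assume "r \<in> {r. even r \<and> (\<exists>H. factor r H G)}"
    then obtain H where H: "factor r H G" by blast
    obtain v where "v \<in> verts G" using assms(2) by auto
    then have "r = card {e \<in> edges H. v \<in> e}"
      using H by (auto simp: factor_def spanning_subgraph_def regular_def degree_def)
    also have "\<dots> \<le> card (edges G)"
      using H simple_graph_finite_edges[OF assms(1)]
      by (intro card_mono) (auto simp: factor_def spanning_subgraph_def)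
    finally show "r \<in> {..card (edges G)}" by simp
  qed
qed simp

definition cycle_graph :: "'a graph \<Rightarrow> bool" where
  "cycle_graph C \<longleftrightarrow> (\<exists>xs. distinct xs \<and> length xs \<ge> 3 \<and> verts C = set xs \<and>
     edges C = {{xs ! i, xs ! (Suc i mod length xs)} | i. i < length xs})"

definition hamilton_cycle :: "'a graph \<Rightarrow> 'a graph \<Rightarrow> bool" where
  "hamilton_cycle C G \<longleftrightarrow> cycle_graph C \<and> spanning_subgraph C G"

definition edge_disjoint :: "'a graph \<Rightarrow> 'a graph \<Rightarrow> bool" where
  "edge_disjoint G H \<longleftrightarrow> edges G \<inter> edges H = {}"

end

theory Submission
  imports Defs "HOL-Number_Theory.Cong" "HOL-Library.Disjoint_Sets" "HOL-Library.FuncSet"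
begin

text \<open>If the even regular factor \<open>H\<close> of \<open>G\<close> has degree \<open>r \<le> \<epsilon> n\<close>, Dirac's theorem gives \<open>r/2\<close> edge-disjoint
  Hamilton cycles greedily. Otherwise distribute the vertices at random over the points of an affine
  plane of large prime order \<open>s\<close>, and take a large constant number \<open>D\<close> of directions. The lines \<open>A\<close> in
  these directions pairwise share at most one cell, so the graphs of the edges of \<open>G\<close> between
  different cells of \<open>A\<close> are edge-disjoint; on its vertex set each has minimum degree above one half,
  with room for the removal of the Hamilton cycles assigned to \<open>A\<close>, since \<open>D\<close> is large, whereas all
  of them together are only a \<open>D/s\<close> fraction of \<open>G\<close>. The remaining edges are distributed at random
  over the lines, a small part of them being reserved for links into \<open>A\<close>; the edges of \<open>H\<close> assigned to
  \<open>A\<close> form a nearly regular graph on the complement of \<open>A\<close>.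

  Split this complement into \<open>q\<close> random clusters, \<open>q\<close> a large prime. For each shift \<open>c < q/2\<close> the edges from
  cluster \<open>i\<close> to cluster \<open>i + c\<close> decompose into matchings by Koenig's theorem, and cutting each matching
  behind one cluster leaves a system of few paths, because the shift by \<open>c\<close> is a single cycle on the
  clusters. Almost all edges of \<open>H\<close> are used in this way. The paths of a system are linked to one path by
  vertices of \<open>A\<close>; a Hamilton cycle of the rest of \<open>A\<close>, from Dirac's theorem, is then opened at
  a suitable edge to insert this path.\<close>

section \<open>Paths, cycles and Dirac's theorem\<close>

text \<open>Splitting almost all of \<open>H\<close> into spanning systems of few paths is the
  easier half. The obstacle is to close every system to a Hamilton cycle when the number of cycles
  is linear in the number of vertices. A sparse random part of \<open>G\<close> reserved for one
  class has minimum degree far below one half, so Dirac's theorem says nothing about it on the whole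
  vertex set. Hence the closing graph is thinned in its vertices instead of its edges: on a line it
  keeps the density of \<open>G\<close>. The price is that an edge whose two cells are collinear in
  a chosen direction is withheld from the random distribution, because it may be wanted inside a
  line. The \<open>D * s\<close> lines share \<open>H\<close> equally, so each has to provide about
  \<open>r / (2 * D * s)\<close> cycles. These spend at most about \<open>n / (D * s)\<close> of the
  degree of a vertex inside its line, against a surplus of about \<open>\<epsilon> * n / s\<close>
  over one half; this is why \<open>D\<close> is a multiple of
  \<open>1 / \<epsilon>\<close>.\<close>

fun path_edges :: "'a list \<Rightarrow> 'a set set" where
  "path_edges [] = {}"
| "path_edges [x] = {}"
| "path_edges (x # y # zs) = insert {x, y} (path_edges (y # zs))"

text \<open>The closing pair is inserted unconditionally, so the set is never empty. Disjoint edge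
  sets therefore always come from different cycles.\<close>

definition cycle_edges :: "'a list \<Rightarrow> 'a set set" where
  "cycle_edges xs = insert {last xs, hd xs} (path_edges xs)"

text \<open>The graphs below are mostly pieces of one graph seen from changing vertex sets, so
  degrees are counted for a bare edge set \<open>E\<close> into a chosen set \<open>A\<close>. The
  condition \<open>u \<noteq> v\<close> keeps a singleton in \<open>E\<close> from counting as a
  neighbour.\<close>

definition nbrs :: "'a set set \<Rightarrow> 'a set \<Rightarrow> 'a \<Rightarrow> 'a set" where
  "nbrs E A v = {u \<in> A. u \<noteq> v \<and> {v, u} \<in> E}"

lemma finite_nbrs [simp]: "finite A \<Longrightarrow> finite (nbrs E A v)"
  by (simp add: nbrs_def)

lemma nbrs_sub: "nbrs E A v \<subseteq> A"
  by (auto simp: nbrs_def)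

lemma path_edges_Cons: "xs \<noteq> [] \<Longrightarrow> path_edges (x # xs) = insert {x, hd xs} (path_edges xs)"
  by (cases xs) auto

lemma path_edges_append:
  "xs \<noteq> [] \<Longrightarrow> ys \<noteq> [] \<Longrightarrow> path_edges (xs @ ys) = path_edges xs \<union> path_edges ys \<union> {{last xs, hd ys}}"
proof (induction xs)
  case (Cons x xs)
  then show ?case by (cases "xs = []") (auto simp: path_edges_Cons)
qed simp

lemma path_edges_rev [simp]: "path_edges (rev xs) = path_edges xs"
proof (induction xs)
  case (Cons x xs)
  then show ?case
    by (cases "xs = []") (auto simp: path_edges_Cons path_edges_append last_rev insert_commute)
qed simp

lemma path_edges_vertices: "e \<in> path_edges xs \<Longrightarrow> e \<subseteq> set xs"
  by (induction xs rule: path_edges.induct) auto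

lemma path_edges_card: "distinct xs \<Longrightarrow> e \<in> path_edges xs \<Longrightarrow> card e = 2"
  by (induction xs rule: path_edges.induct) auto

lemma path_edges_nth: "path_edges xs = {{xs ! i, xs ! Suc i} | i. Suc i < length xs}"
proof (induction xs rule: path_edges.induct)
  case (3 x y zs)
  have "{{(x # y # zs) ! i, (x # y # zs) ! Suc i} |i. Suc i < length (x # y # zs)} =
     insert {x, y} {{(y # zs) ! i, (y # zs) ! Suc i} |i. Suc i < length (y # zs)}" (is "?L = ?R")
  proof
    show "?L \<subseteq> ?R"
    proof
      fix e assume "e \<in> ?L"
      then obtain i where i: "e = {(x # y # zs) ! i, (x # y # zs) ! Suc i}" "Suc i < length (x # y # zs)"
        by blast
      then show "e \<in> ?R" by (cases i) auto
    qed
    show "?R \<subseteq> ?L"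
    proof
      fix e assume "e \<in> ?R"
      then consider "e = {x,y}" | i where "e = {(y # zs) ! i, (y # zs) ! Suc i}" "Suc i < length (y # zs)"
        by blast
      then show "e \<in> ?L"
      proof cases
        case 1
        then have "e = {(x # y # zs) ! 0, (x # y # zs) ! Suc 0}" "Suc 0 < length (x # y # zs)" by auto
        then show ?thesis by blast
      next
        case 2
        then have "e = {(x # y # zs) ! Suc i, (x # y # zs) ! Suc (Suc i)}" "Suc (Suc i) < length (x # y # zs)" by auto
        then show ?thesis by blast
      qed
    qed
  qed
  with 3 show ?case by simp
qed auto

lemma cycle_edges_nth:
  assumes "xs \<noteq> []"
  shows "cycle_edges xs = {{xs ! i, xs ! (Suc i mod length xs)} | i. i < length xs}" (is "_ = ?R")
proof -
  let ?n = "length xs"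
  have "?R = (\<lambda>i. {xs ! i, xs ! (Suc i mod ?n)}) ` {..<?n}" by auto
  also have "{..<?n} = insert (?n - 1) {..<?n - 1}" using assms by auto
  also have "(\<lambda>i. {xs ! i, xs ! (Suc i mod ?n)}) ` \<dots> =
     insert {last xs, hd xs} ((\<lambda>i. {xs ! i, xs ! Suc i}) ` {..<?n - 1})"
    using assms by (auto simp: last_conv_nth hd_conv_nth)
  also have "((\<lambda>i. {xs ! i, xs ! Suc i}) ` {..<?n - 1}) = path_edges xs"
    unfolding path_edges_nth by (auto simp: less_diff_conv)
  finally show ?thesis unfolding cycle_edges_def ..
qed

lemma cycle_edges_vertices: "xs \<noteq> [] \<Longrightarrow> e \<in> cycle_edges xs \<Longrightarrow> e \<subseteq> set xs"
  using path_edges_vertices by (fastforce simp: cycle_edges_def)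

lemma cycle_edges_rotate1: "cycle_edges (rotate1 xs) = cycle_edges xs"
proof (cases xs)
  case (Cons x ys)
  then show ?thesis
    by (cases "ys = []") (auto simp: cycle_edges_def path_edges_append path_edges_Cons insert_commute)
qed simp

lemma cycle_edges_rotate: "cycle_edges (rotate k xs) = cycle_edges xs"
  by (induction k) (auto simp: cycle_edges_rotate1)

lemma card_nbrs_cycle_edges:
  assumes "distinct xs" "xs \<noteq> []"
  shows "card (nbrs (cycle_edges xs) A v) \<le> 2"
proof (cases "v \<in> set xs")
  case False
  then have "nbrs (cycle_edges xs) A v = {}"
    using assms by (auto simp: nbrs_def dest: cycle_edges_vertices)
  then show ?thesis by simp
next
  case True
  let ?n = "length xs"
  obtain j where j: "j < ?n" "v = xs ! j" using True by (auto simp: in_set_conv_nth)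
  note ne = assms(2)
  have "nbrs (cycle_edges xs) A v \<subseteq> {xs ! (Suc j mod ?n), xs ! ((j + ?n - 1) mod ?n)}"
  proof
    fix u assume "u \<in> nbrs (cycle_edges xs) A v"
    then obtain i where i: "i < ?n" "{v, u} = {xs ! i, xs ! (Suc i mod ?n)}" "u \<noteq> v"
      unfolding cycle_edges_nth[OF ne] nbrs_def by blast
    then consider "v = xs ! i" "u = xs ! (Suc i mod ?n)" | "u = xs ! i" "v = xs ! (Suc i mod ?n)"
      by (auto simp: doubleton_eq_iff)
    then show "u \<in> {xs ! (Suc j mod ?n), xs ! ((j + ?n - 1) mod ?n)}"
    proof cases
      case 1
      then have "i = j" using assms i j by (simp add: nth_eq_iff_index_eq)
      then show ?thesis using 1 by simp
    next
      case 2
      have "Suc i mod ?n < ?n" using ne by simp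
      then have "Suc i mod ?n = j" using assms 2 j by (metis nth_eq_iff_index_eq)
      then have "(j + ?n - 1) mod ?n = i" using i(1)
        by (cases "Suc i = ?n") auto
      then show ?thesis using 2 by simp
    qed
  qed
  then have "card (nbrs (cycle_edges xs) A v) \<le> card {xs ! (Suc j mod ?n), xs ! ((j + ?n - 1) mod ?n)}"
    by (intro card_mono) auto
  also have "\<dots> \<le> 2" by (simp add: card_insert_if)
  finally show ?thesis .
qed

text \<open>Pigeonhole on positions: those carrying an element of \<open>S\<close> and those
  followed cyclically by an element of \<open>T\<close> are too many to be disjoint. It yields the
  crossing edges in Dirac's theorem and later the edge at which a Hamilton cycle is opened.\<close>

lemma consecutive_pair_exists:
  assumes "finite V" "distinct xs" "set xs = V" "S \<subseteq> V" "T \<subseteq> V" "card S + card T > card V"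
  obtains i where "i < length xs" "xs ! i \<in> S" "xs ! (Suc i mod length xs) \<in> T"
proof -
  let ?n = "length xs"
  have n: "?n = card V" using assms distinct_card by metis
  have ne: "?n > 0"
  proof (rule ccontr)
    assume "\<not> ?n > 0"
    then have "V = {}" using assms(3) by simp
    then show False using assms(4-6) by simp
  qed
  define I where "I = {i. i < ?n \<and> xs ! i \<in> S}"
  define J where "J = {i. i < ?n \<and> xs ! (Suc i mod ?n) \<in> T}"
  have cI: "card I = card S"
  proof -
    have "bij_betw ((!) xs) I S"
      unfolding I_def bij_betw_def
    proof
      show "inj_on ((!) xs) {i. i < ?n \<and> xs ! i \<in> S}"
        using assms(2) by (auto simp: inj_on_def nth_eq_iff_index_eq)
      show "(!) xs ` {i. i < ?n \<and> xs ! i \<in> S} = S"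
        using assms(3,4) by (force simp: image_iff in_set_conv_nth)
    qed
    then show ?thesis by (rule bij_betw_same_card)
  qed
  have cJ: "card J = card T"
  proof -
    have "bij_betw (\<lambda>i. xs ! (Suc i mod ?n)) J T"
      unfolding bij_betw_def
    proof
      show "inj_on (\<lambda>i. xs ! (Suc i mod ?n)) J"
      proof (rule inj_onI)
        fix i j assume a: "i \<in> J" "j \<in> J" "xs ! (Suc i mod ?n) = xs ! (Suc j mod ?n)"
        then have "Suc i mod ?n = Suc j mod ?n" using ne assms(2)
          by (metis mod_less_divisor nth_eq_iff_index_eq)
        then show "i = j" using a unfolding J_def
          by (auto simp: mod_Suc split: if_splits)
      qed
      show "(\<lambda>i. xs ! (Suc i mod ?n)) ` J = T"
      proof
        show "(\<lambda>i. xs ! (Suc i mod ?n)) ` J \<subseteq> T" by (auto simp: J_def)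
        show "T \<subseteq> (\<lambda>i. xs ! (Suc i mod ?n)) ` J"
        proof
          fix t assume t: "t \<in> T"
          then obtain j where j: "j < ?n" "xs ! j = t" using assms by (metis in_set_conv_nth subsetD)
          define i where "i = (if j = 0 then ?n - 1 else j - 1)"
          have "i < ?n" "Suc i mod ?n = j" using j ne by (auto simp: i_def)
          then show "t \<in> (\<lambda>i. xs ! (Suc i mod ?n)) ` J" using j t by (auto simp: J_def image_iff)
        qed
      qed
    qed
    then show ?thesis by (rule bij_betw_same_card)
  qed
  have "I \<inter> J \<noteq> {}"
  proof
    assume "I \<inter> J = {}"
    then have "card I + card J = card (I \<union> J)" by (simp add: card_Un_disjoint I_def J_def)
    also have "\<dots> \<le> card {..<?n}" by (rule card_mono) (auto simp: I_def J_def)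
    finally show False using cI cJ assms(6) n by simp
  qed
  then show ?thesis using that by (auto simp: I_def J_def)
qed

text \<open>The index set \<open>J\<close> may depend on \<open>v\<close>: only the cycles that
  really use edges from \<open>v\<close> into \<open>A\<close> have to be charged, two edges
  each.\<close>

lemma card_nbrs_remove_cycles:
  assumes "finite A" "finite J" "\<And>j. j \<in> J \<Longrightarrow> distinct (xs j) \<and> xs j \<noteq> []"
    and "nbrs E A v \<subseteq> nbrs E' A v \<union> (\<Union>j\<in>J. nbrs (cycle_edges (xs j)) A v)"
  shows "card (nbrs E A v) \<le> card (nbrs E' A v) + 2 * card J"
proof -
  have "card (nbrs E A v) \<le> card (nbrs E' A v \<union> (\<Union>j\<in>J. nbrs (cycle_edges (xs j)) A v))"
    using assms by (intro card_mono) auto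
  also have "\<dots> \<le> card (nbrs E' A v) + card (\<Union>j\<in>J. nbrs (cycle_edges (xs j)) A v)" by (rule card_Un_le)
  also have "card (\<Union>j\<in>J. nbrs (cycle_edges (xs j)) A v) \<le> (\<Sum>j\<in>J. card (nbrs (cycle_edges (xs j)) A v))"
    using assms(2) by (rule card_UN_le)
  also have "\<dots> \<le> (\<Sum>j\<in>J. 2)" using assms(3) by (intro sum_mono card_nbrs_cycle_edges) auto
  finally show ?thesis by simp
qed

lemma disjoint_family_on_lessThan_Suc:
  assumes "disjoint_family_on F {..<k}" "\<And>j. j < k \<Longrightarrow> F k \<inter> F j = {}"
  shows "disjoint_family_on F {..<Suc k}"
  unfolding disjoint_family_on_def
proof (intro ballI impI)
  fix i j assume ij: "i \<in> {..<Suc k}" "j \<in> {..<Suc k}" "i \<noteq> j"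
  show "F i \<inter> F j = {}"
  proof (cases "i = k \<or> j = k")
    case True
    then show ?thesis using assms(2)[of i] assms(2)[of j] ij by (cases "i = k") (simp_all add: Int_commute)
  next
    case False
    then show ?thesis using assms(1) ij by (simp add: disjoint_family_on_def)
  qed
qed

lemma hd_last_rotate:
  assumes "i < length xs"
  shows "hd (rotate (Suc i) xs) = xs ! (Suc i mod length xs)" "last (rotate (Suc i) xs) = xs ! i"
proof -
  let ?n = "length xs"
  have ne: "xs \<noteq> []" using assms by auto
  then show "hd (rotate (Suc i) xs) = xs ! (Suc i mod ?n)"
    using hd_rotate_conv_nth[of xs "Suc i"] by simp
  have "last (rotate (Suc i) xs) = rotate (Suc i) xs ! (?n - 1)"
    using ne by (subst last_conv_nth) auto
  also have "\<dots> = xs ! ((Suc i + (?n - 1)) mod ?n)" using ne by (subst nth_rotate) auto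
  also have "(Suc i + (?n - 1)) mod ?n = i" using assms ne by simp
  finally show "last (rotate (Suc i) xs) = xs ! i" .
qed

text \<open>Take a longest path. All neighbours of its two ends lie on it, and two crossing edges
  turn it into a cycle on the same vertices. A vertex left over would have a neighbour on this
  cycle, and opening the cycle there would give a longer path.\<close>

lemma dirac:
  assumes "finite V" "3 \<le> card V" and deg: "\<And>v. v \<in> V \<Longrightarrow> card V \<le> 2 * card (nbrs E V v)"
  obtains xs where "distinct xs" "set xs = V" "cycle_edges xs \<subseteq> E"
proof -
  define P where "P xs \<longleftrightarrow> distinct xs \<and> set xs \<subseteq> V \<and> xs \<noteq> [] \<and> path_edges xs \<subseteq> E" for xs
  obtain v0 where "v0 \<in> V" using assms(2) by fastforce
  then have "P [v0]" by (simp add: P_def)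
  moreover have bnd: "length xs \<le> card V" if "P xs" for xs
    using that assms(1) unfolding P_def by (metis card_mono distinct_card)
  then have "\<forall>xs. P xs \<longrightarrow> length xs < Suc (card V)" by (auto simp: less_Suc_eq_le)
  ultimately obtain xs where xs: "P xs" and mx: "\<And>ys. P ys \<Longrightarrow> length ys \<le> length xs"
    using ex_has_greatest_nat[of P "[v0]" length "Suc (card V)"] by blast
  let ?x = "hd xs" and ?y = "last xs" and ?n = "length xs"
  have d: "distinct xs" "set xs \<subseteq> V" "xs \<noteq> []" "path_edges xs \<subseteq> E" using xs by (auto simp: P_def)
  have xV: "?x \<in> V" "?y \<in> V" using d by auto
  have Nx: "nbrs E V ?x \<subseteq> set xs"
  proof (rule ccontr)
    assume "\<not> ?thesis"
    then obtain u where u: "u \<in> V" "u \<notin> set xs" "{?x, u} \<in> E" by (auto simp: nbrs_def)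
    then have "P (u # xs)" using d by (auto simp: P_def path_edges_Cons insert_commute)
    then show False using mx[of "u # xs"] by simp
  qed
  have Ny: "nbrs E V ?y \<subseteq> set xs"
  proof (rule ccontr)
    assume "\<not> ?thesis"
    then obtain u where u: "u \<in> V" "u \<notin> set xs" "{?y, u} \<in> E" by (auto simp: nbrs_def)
    then have "P (xs @ [u])" using d by (auto simp: P_def path_edges_append)
    then show False using mx[of "xs @ [u]"] by simp
  qed
  have xn: "?x \<notin> nbrs E V ?x" "?y \<notin> nbrs E V ?y" by (auto simp: nbrs_def)
  have fN: "finite (nbrs E V ?x)" using assms(1) by simp
  have cins: "card (insert ?x (nbrs E V ?x)) = Suc (card (nbrs E V ?x))" using xn fN by simp
  have len: "card V + 2 \<le> 2 * ?n"
  proof -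
    have "card (insert ?x (nbrs E V ?x)) \<le> card (set xs)" using Nx d by (intro card_mono) auto
    then show ?thesis using cins deg[OF xV(1)] d distinct_card[of xs] by simp
  qed
  \<comment> \<open>The two degrees together are only known to reach \<open>card V\<close>, so the
    first vertex itself is added to get a strict inequality. It is never the vertex found:
    cyclically it follows the last vertex, which is not its own neighbour.\<close>
  have "card (nbrs E V ?y) + card (insert ?x (nbrs E V ?x)) > card (set xs)"
    using cins deg[OF xV(1)] deg[OF xV(2)] bnd[OF xs] d distinct_card[of xs] by simp
  then obtain i where i: "i < ?n" "xs ! i \<in> nbrs E V ?y" "xs ! (Suc i mod ?n) \<in> insert ?x (nbrs E V ?x)"
    using consecutive_pair_exists[of "set xs" xs "nbrs E V ?y" "insert ?x (nbrs E V ?x)"] d Nx Ny by auto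
  have il: "Suc i < ?n"
  proof (rule ccontr)
    assume "\<not> ?thesis"
    then have "i = ?n - 1" using i by simp
    then have "xs ! i = ?y" using d by (simp add: last_conv_nth)
    then show False using i xn by simp
  qed
  have hx: "?x = xs ! 0" using d by (simp add: hd_conv_nth)
  have "xs ! Suc i \<noteq> ?x" using il d hx nth_eq_iff_index_eq[of xs "Suc i" 0] by simp
  then have i3: "xs ! Suc i \<in> nbrs E V ?x" using i il by simp
  \<comment> \<open>The last vertex is adjacent to \<open>xs ! i\<close> and the first one to
    \<open>xs ! Suc i\<close>, so reversing the part behind position \<open>i\<close> closes the
    path.\<close>
  let ?as = "take (Suc i) xs" and ?bs = "drop (Suc i) xs"
  define ys where "ys = ?as @ rev ?bs"
  have ab: "?as \<noteq> []" "?bs \<noteq> []" using il by auto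
  have ends: "last ?as = xs ! i" "hd ?bs = xs ! Suc i" "hd ?as = ?x" "last ?bs = ?y"
    using il ab by (auto simp: hd_drop_conv_nth take_Suc_conv_app_nth hd_append hx)
  have "path_edges (?as @ ?bs) \<subseteq> E" using d by simp
  then have "path_edges ?as \<subseteq> E" "path_edges ?bs \<subseteq> E" unfolding path_edges_append[OF ab] by auto
  moreover have "{xs ! i, ?y} \<in> E" "{xs ! Suc i, ?x} \<in> E" using i i3 by (auto simp: nbrs_def insert_commute)
  ultimately have yE: "cycle_edges ys \<subseteq> E"
    using ab ends by (simp add: cycle_edges_def ys_def path_edges_append last_rev hd_rev)
  have "set ys = set (?as @ ?bs)" by (simp only: ys_def set_append set_rev)
  then have ysd: "distinct ys" "set ys = set xs"
    using d(1) distinct_append[of ?as ?bs] by (simp_all add: ys_def)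
  have "set xs = V"
  proof (rule ccontr)
    assume "set xs \<noteq> V"
    then obtain v where v: "v \<in> V" "v \<notin> set xs" using d by auto
    \<comment> \<open>By \<open>len\<close> the path covers more than half of \<open>V\<close>,
      which leaves too little room outside it for all neighbours of \<open>v\<close>.\<close>
    have "nbrs E V v \<inter> set xs \<noteq> {}"
    proof
      assume "nbrs E V v \<inter> set xs = {}"
      then have "nbrs E V v \<subseteq> V - insert v (set xs)" by (auto simp: nbrs_def)
      then have "card (nbrs E V v) \<le> card (V - insert v (set xs))" using assms(1) by (intro card_mono) auto
      also have "\<dots> = card V - Suc ?n" using v d assms(1) distinct_card[of xs]
        by (subst card_Diff_subset) auto
      finally show False using deg[OF v(1)] len assms(2) by simp
    qed
    then obtain w where w: "w \<in> set ys" "{v, w} \<in> E" using ysd by (auto simp: nbrs_def)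
    then obtain k where k: "k < length ys" "ys ! k = w" by (auto simp: in_set_conv_nth)
    let ?zs = "rotate k ys"
    have "hd ?zs = w" using k by (subst hd_rotate_conv_nth) auto
    moreover have "path_edges ?zs \<subseteq> E" using yE cycle_edges_rotate[of k ys] unfolding cycle_edges_def by blast
    moreover have "?zs \<noteq> []" using k by auto
    ultimately have "P (v # ?zs)" using ysd d v w by (simp add: P_def path_edges_Cons)
    then have "Suc (length ys) \<le> ?n" using mx[of "v # ?zs"] by simp
    then show False using ysd d by (metis Suc_n_not_le_n distinct_card)
  qed
  then show ?thesis using that[of ys] ysd yE by simp
qed

section \<open>Closing a path system to a Hamilton cycle\<close>

definition joins :: "'a set set \<Rightarrow> 'a set \<Rightarrow> 'a set \<Rightarrow> 'a set set" where
  "joins E X A = {{v, a} | v a. v \<in> X \<and> a \<in> A \<and> v \<noteq> a \<and> {v, a} \<in> E}"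

definition ends :: "'a list list \<Rightarrow> 'a set" where
  "ends ps = hd ` set ps \<union> last ` set ps"

definition system_edges :: "'a list list \<Rightarrow> 'a set set" where
  "system_edges ps = (\<Union>p\<in>set ps. path_edges p)"

lemma joins_mono: "X \<subseteq> X' \<Longrightarrow> A \<subseteq> A' \<Longrightarrow> joins E X A \<subseteq> joins E X' A'"
  by (auto simp: joins_def)

lemma joinsI: "a \<in> nbrs E A v \<Longrightarrow> v \<in> X \<Longrightarrow> {v, a} \<in> joins E X A"
  by (auto simp: joins_def nbrs_def)

lemma ends_sub: "[] \<notin> set ps \<Longrightarrow> ends ps \<subseteq> set (concat ps)"
  by (auto simp: ends_def) (metis hd_in_set, metis last_in_set)

text \<open>An infinite \<open>U\<close> has cardinality 0, which accounts for the second
  alternative.\<close>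

lemma exists_outside:
  assumes "card U < card N"
  obtains a where "a \<in> N" "a \<notin> U" | "infinite U"
  using assms by (metis card_mono linorder_not_less subsetI)

text \<open>Two consecutive paths are joined through three fresh vertices \<open>a\<close>,
  \<open>b\<close>, \<open>a'\<close> of \<open>A\<close>: the outer ones are neighbours of the path
  ends in \<open>E1\<close>, and \<open>b\<close> is a common neighbour of them in
  \<open>E2\<close>. It exists because degrees in \<open>E2\<close> exceed half of \<open>A\<close>.
  The graph \<open>E1\<close> may be sparse, as it only needs to avoid the at most
  \<open>3 * length ps\<close> vertices in use, and it is touched at path ends only.\<close>

lemma link_paths:
  assumes "finite A" "ps \<noteq> []" "distinct (concat ps)" "[] \<notin> set ps" "set (concat ps) \<inter> A = {}"
    and "\<And>v. v \<in> ends ps \<Longrightarrow> 3 * length ps + 2 \<le> card (nbrs E1 A v)"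
    and "\<And>a. a \<in> A \<Longrightarrow> card A + 3 * length ps + 1 \<le> 2 * card (nbrs E2 A a)"
  shows "\<exists>Q U. distinct Q \<and> Q \<noteq> [] \<and> hd Q = hd (hd ps) \<and> last Q = last (last ps) \<and>
    set Q = set (concat ps) \<union> U \<and> U \<subseteq> A \<and> card U \<le> 3 * length ps \<and>
    path_edges Q \<subseteq> system_edges ps \<union> joins E1 (ends ps) A \<union> joins E2 A A"
  using assms(2-)
proof (induction ps)
  case (Cons p ps)
  show ?case
  proof (cases "ps = []")
    case True
    then show ?thesis using Cons.prems by (intro exI[of _ p] exI[of _ "{}"]) (auto simp: system_edges_def)
  next
    case False
    have ps: "distinct (concat ps)" "[] \<notin> set ps" "set (concat ps) \<inter> A = {}"
      using Cons.prems by auto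
    have N1: "3 * length ps + 2 \<le> card (nbrs E1 A v)" if "v \<in> ends ps" for v
      using Cons.prems(5)[of v] that by (auto simp: ends_def)
    have N2: "card A + 3 * length ps + 1 \<le> 2 * card (nbrs E2 A a)" if "a \<in> A" for a
      using Cons.prems(6)[OF that] by simp
    obtain Q U where Q: "distinct Q" "Q \<noteq> []" "hd Q = hd (hd ps)" "last Q = last (last ps)"
      "set Q = set (concat ps) \<union> U" "U \<subseteq> A" "card U \<le> 3 * length ps"
      "path_edges Q \<subseteq> system_edges ps \<union> joins E1 (ends ps) A \<union> joins E2 A A"
      using Cons.IH[OF False ps N1 N2] by blast
    have fU: "finite U" using Q(6) assms(1) finite_subset by blast
    have e1: "last p \<in> ends (p # ps)" and e2: "hd Q \<in> ends (p # ps)"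
      using False Q(3) by (auto simp: ends_def)
    have "card U < card (nbrs E1 A (last p))" using Cons.prems(5)[OF e1] Q(7) by simp
    then obtain a where a: "a \<in> nbrs E1 A (last p)" "a \<notin> U" using exists_outside fU by metis
    have "card (insert a U) < card (nbrs E1 A (hd Q))"
      using Cons.prems(5)[OF e2] Q(7) fU by (simp add: card_insert_if)
    then obtain a' where a': "a' \<in> nbrs E1 A (hd Q)" "a' \<notin> insert a U"
      using exists_outside[of "insert a U" "nbrs E1 A (hd Q)"] fU by blast
    have aA: "a \<in> A" "a' \<in> A" using a a' by (auto simp: nbrs_def)
    have "card U < card (nbrs E2 A a \<inter> nbrs E2 A a')"
    proof -
      have "card (nbrs E2 A a) + card (nbrs E2 A a') =
        card (nbrs E2 A a \<union> nbrs E2 A a') + card (nbrs E2 A a \<inter> nbrs E2 A a')"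
        using assms(1) by (intro card_Un_Int) auto
      moreover have "card (nbrs E2 A a \<union> nbrs E2 A a') \<le> card A"
        using assms(1) by (intro card_mono) (auto simp: nbrs_def)
      ultimately show ?thesis using Cons.prems(6)[OF aA(1)] Cons.prems(6)[OF aA(2)] Q(7) by simp
    qed
    then obtain b where b: "b \<in> nbrs E2 A a \<inter> nbrs E2 A a'" "b \<notin> U" using exists_outside fU by metis
    define R where "R = p @ [a, b, a'] @ Q"
    have bA: "b \<in> A" "b \<noteq> a" "b \<noteq> a'" using b by (auto simp: nbrs_def)
    have pne: "p \<noteq> []" using Cons.prems by auto
    have 1: "distinct R" unfolding R_def using Cons.prems(2,4) Q aA bA a a' b
      by (auto)
    have 2: "R \<noteq> []" "hd R = hd (hd (p # ps))" "last R = last (last (p # ps))"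
      using pne Q False by (auto simp: R_def)
    have 3: "set R = set (concat (p # ps)) \<union> (insert a (insert b (insert a' U)))"
      using Q by (auto simp: R_def)
    have 4: "insert a (insert b (insert a' U)) \<subseteq> A" using Q aA bA by auto
    have 5: "card (insert a (insert b (insert a' U))) \<le> 3 * length (p # ps)"
      using Q fU by (auto simp: card_insert_if)
    have 6: "path_edges R = path_edges p \<union> {{last p, a}, {a, b}, {b, a'}, {a', hd Q}} \<union> path_edges Q"
      using pne Q(2) by (auto simp: R_def path_edges_append path_edges_Cons)
    have "{last p, a} \<in> joins E1 (ends (p # ps)) A" using a e1 by (intro joinsI)
    moreover have "{hd Q, a'} \<in> joins E1 (ends (p # ps)) A" using a' e2 by (intro joinsI)
    moreover have "{a, b} \<in> joins E2 A A" "{a', b} \<in> joins E2 A A" using b aA by (auto intro: joinsI)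
    moreover have "joins E1 (ends ps) A \<subseteq> joins E1 (ends (p # ps)) A"
      by (rule joins_mono) (auto simp: ends_def)
    ultimately have 7: "path_edges R \<subseteq> system_edges (p # ps) \<union> joins E1 (ends (p # ps)) A \<union> joins E2 A A"
      unfolding 6 using Q(8) by (auto simp: insert_commute system_edges_def)
    show ?thesis using 1 2 3 4 5 7 by blast
  qed
qed simp

text \<open>After linking, one path \<open>Q\<close> remains. Its ends are tied to vertices
  \<open>a\<close> and \<open>a'\<close> of \<open>A\<close>; the vertices of \<open>A\<close> not
  yet used still satisfy Dirac's condition and form a cycle, which is opened between a neighbour of
  \<open>a\<close> and a neighbour of \<open>a'\<close>.\<close>

lemma close_paths:
  assumes "finite A" "ps \<noteq> []" "distinct (concat ps)" "[] \<notin> set ps" "set (concat ps) \<inter> A = {}"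
    and N1: "\<And>v. v \<in> ends ps \<Longrightarrow> 3 * length ps + 2 \<le> card (nbrs E1 A v)"
    and N2: "\<And>a. a \<in> A \<Longrightarrow> card A + 6 * length ps + 10 \<le> 2 * card (nbrs E2 A a)"
  shows "\<exists>xs. distinct xs \<and> set xs = set (concat ps) \<union> A \<and> xs \<noteq> [] \<and>
    cycle_edges xs \<subseteq> system_edges ps \<union> joins E1 (ends ps) A \<union> joins E2 A A"
proof -
  have N2': "card A + 3 * length ps + 1 \<le> 2 * card (nbrs E2 A a)" if "a \<in> A" for a
    using N2[OF that] by simp
  obtain Q U where Q: "distinct Q" "Q \<noteq> []" "hd Q = hd (hd ps)" "last Q = last (last ps)"
      "set Q = set (concat ps) \<union> U" "U \<subseteq> A" "card U \<le> 3 * length ps"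
      "path_edges Q \<subseteq> system_edges ps \<union> joins E1 (ends ps) A \<union> joins E2 A A"
    using link_paths[OF assms(1-5) N1 N2'] by blast
  have fU: "finite U" using Q(6) assms(1) finite_subset by blast
  have e: "hd Q \<in> ends ps" "last Q \<in> ends ps" using Q assms(2) by (auto simp: ends_def)
  have "card U < card (nbrs E1 A (hd Q))" using N1[OF e(1)] Q(7) by simp
  then obtain a where a: "a \<in> nbrs E1 A (hd Q)" "a \<notin> U" using exists_outside fU by metis
  have "card (insert a U) < card (nbrs E1 A (last Q))"
    using N1[OF e(2)] Q(7) fU by (simp add: card_insert_if)
  then obtain a' where a': "a' \<in> nbrs E1 A (last Q)" "a' \<notin> insert a U"
    using exists_outside[of "insert a U" "nbrs E1 A (last Q)"] fU by blast
  have aA: "a \<in> A" "a' \<in> A" using a a' by (auto simp: nbrs_def)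
  define A' where "A' = A - (insert a (insert a' U))"
  have fA': "finite A'" using assms(1) by (simp add: A'_def)
  have rem: "card (insert a (insert a' U)) = card U + 2"
    using a a' fU by (auto simp: card_insert_if)
  have cA': "card A' + (card U + 2) = card A"
  proof -
    have "card A' = card A - card (insert a (insert a' U))"
      unfolding A'_def using fU aA Q(6) by (intro card_Diff_subset) auto
    moreover have "card (insert a (insert a' U)) \<le> card A"
      using aA Q(6) assms(1) by (intro card_mono) auto
    ultimately show ?thesis using rem by simp
  qed
  have dA': "card A + 6 \<le> 2 * card (nbrs E2 A' v)" if "v \<in> A" for v
  proof -
    have "nbrs E2 A v \<subseteq> nbrs E2 A' v \<union> insert a (insert a' U)" by (auto simp: nbrs_def A'_def)
    then have "card (nbrs E2 A v) \<le> card (nbrs E2 A' v \<union> insert a (insert a' U))"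
      using fA' fU by (intro card_mono) auto
    also have "\<dots> \<le> card (nbrs E2 A' v) + (card U + 2)"
      using card_Un_le[of "nbrs E2 A' v" "insert a (insert a' U)"] rem by simp
    finally show ?thesis using N2[OF that] Q(7) by simp
  qed
  have "card (nbrs E2 A a) \<le> card A" using assms(1) nbrs_sub by (intro card_mono)
  then have "3 \<le> card A'" using N2[OF aA(1)] Q(7) cA' by linarith
  moreover have "card A' \<le> 2 * card (nbrs E2 A' v)" if "v \<in> A'" for v
    using dA'[of v] that cA' by (auto simp: A'_def)
  ultimately obtain zs where zs: "distinct zs" "set zs = A'" "cycle_edges zs \<subseteq> E2"
    using dirac[OF fA', of E2] by metis
  \<comment> \<open>Both \<open>a\<close> and \<open>a'\<close> have more than half of
    \<open>A'\<close> as neighbours, so some edge of the cycle \<open>zs\<close> leads from a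
    neighbour of \<open>a\<close> to a neighbour of \<open>a'\<close>.\<close>
  have "card (nbrs E2 A' a) + card (nbrs E2 A' a') > card A'"
    using dA'[OF aA(1)] dA'[OF aA(2)] cA' by linarith
  then obtain i where i: "i < length zs" "zs ! i \<in> nbrs E2 A' a" "zs ! (Suc i mod length zs) \<in> nbrs E2 A' a'"
    using consecutive_pair_exists[OF fA' zs(1,2) nbrs_sub nbrs_sub] by metis
  define ys where "ys = rotate (Suc i) zs"
  have ys: "distinct ys" "set ys = A'" "cycle_edges ys \<subseteq> E2" "last ys \<in> nbrs E2 A' a" "hd ys \<in> nbrs E2 A' a'"
    using zs i hd_last_rotate[OF i(1)] cycle_edges_rotate[of "Suc i" zs] by (auto simp: ys_def simp del: rotate_Suc)
  have yne: "ys \<noteq> []" using i by (auto simp: ys_def)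
  have pj: "path_edges ys \<subseteq> joins E2 A A"
  proof
    fix e assume e: "e \<in> path_edges ys"
    then have "e \<subseteq> A" "card e = 2" "e \<in> E2"
      using path_edges_vertices[OF e] path_edges_card[OF ys(1) e] ys by (auto simp: A'_def cycle_edges_def)
    then show "e \<in> joins E2 A A" by (auto simp: card_2_iff joins_def)
  qed
  define R where "R = [a] @ Q @ [a'] @ ys"
  have A'A: "A' \<subseteq> A" by (auto simp: A'_def)
  have "distinct R" unfolding R_def using Q ys a a' aA assms(5) by (auto simp: A'_def)
  moreover have "set R = set (concat ps) \<union> A" unfolding R_def using Q ys aA by (auto simp: A'_def)
  moreover have "cycle_edges R \<subseteq> system_edges ps \<union> joins E1 (ends ps) A \<union> joins E2 A A"
  proof -
    have "cycle_edges R = {{last ys, a}, {a, hd Q}, {last Q, a'}, {a', hd ys}} \<union> path_edges Q \<union> path_edges ys"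
      using yne Q(2) by (auto simp: R_def cycle_edges_def path_edges_append path_edges_Cons)
    moreover have "{hd Q, a} \<in> joins E1 (ends ps) A" "{last Q, a'} \<in> joins E1 (ends ps) A"
      using a a' e by (auto intro: joinsI)
    moreover have "{a, last ys} \<in> joins E2 A A" "{a', hd ys} \<in> joins E2 A A"
      using joinsI[OF ys(4) aA(1)] joinsI[OF ys(5) aA(2)] joins_mono[OF subset_refl A'A] by blast+
    ultimately show ?thesis using Q(8) pj by (auto simp: insert_commute)
  qed
  moreover have "R \<noteq> []" by (simp add: R_def)
  ultimately show ?thesis by blast
qed

section \<open>Edge colouring of bipartite graphs\<close>

text \<open>In an edge-minimal relation satisfying the Ore condition every edge lies in a tight
  rectangle, and by submodularity tight rectangles are closed under
  \<open>(S\<^sub>1 \<inter> S\<^sub>2) \<times> (T\<^sub>1 \<union> T\<^sub>2)\<close>.\<close>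

lemma ore_matching:
  assumes fI: "finite I" and EI: "E \<subseteq> I \<times> I"
    and ore: "\<And>S T. S \<subseteq> I \<Longrightarrow> T \<subseteq> I \<Longrightarrow> card S + card T \<le> card (E \<inter> S \<times> T) + card I"
  obtains f where "bij_betw f I I" "\<And>x. x \<in> I \<Longrightarrow> (x, f x) \<in> E"
proof -
  define Ok where "Ok F \<longleftrightarrow> (\<forall>S T. S \<subseteq> I \<longrightarrow> T \<subseteq> I \<longrightarrow> card S + card T \<le> card (F \<inter> S \<times> T) + card I)" for F
  have fE: "finite E" using fI EI finite_subset by blast
  have "finite {F. F \<subseteq> E \<and> Ok F}" using fE by simp
  moreover have "E \<in> {F. F \<subseteq> E \<and> Ok F}" using ore by (simp add: Ok_def)
  ultimately obtain F where F: "F \<subseteq> E" "Ok F" and mn: "\<And>F'. F' \<subseteq> E \<Longrightarrow> Ok F' \<Longrightarrow> F' \<subseteq> F \<Longrightarrow> F' = F"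
    using finite_has_minimal[of "{F. F \<subseteq> E \<and> Ok F}"] by (smt (verit) empty_iff mem_Collect_eq)
  have fF: "finite F" using F fE finite_subset by blast
  have oF: "card S + card T \<le> card (F \<inter> S \<times> T) + card I" if "S \<subseteq> I" "T \<subseteq> I" for S T
    using F(2) that by (simp add: Ok_def)
  define tight where "tight S T \<longleftrightarrow> S \<subseteq> I \<and> T \<subseteq> I \<and> card S + card T = card (F \<inter> S \<times> T) + card I" for S T
  have tight_edge: "\<exists>S T. tight S T \<and> x \<in> S \<and> y \<in> T" if xy: "(x, y) \<in> F" for x y
  proof -
    have "\<not> Ok (F - {(x, y)})" using mn[of "F - {(x,y)}"] F xy by blast
    then obtain S T where ST: "S \<subseteq> I" "T \<subseteq> I"
      "card S + card T > card ((F - {(x,y)}) \<inter> S \<times> T) + card I" by (auto simp: Ok_def not_le)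
    have *: "(x, y) \<in> S \<times> T"
    proof (rule ccontr)
      assume "\<not> ?thesis"
      then have "(F - {(x,y)}) \<inter> S \<times> T = F \<inter> S \<times> T" by auto
      then show False using ST oF[OF ST(1,2)] by simp
    qed
    then have "(F - {(x,y)}) \<inter> S \<times> T = (F \<inter> S \<times> T) - {(x,y)}" by auto
    moreover have "(x, y) \<in> F \<inter> S \<times> T" using * xy by simp
    ultimately have "card (F \<inter> S \<times> T) = Suc (card ((F - {(x,y)}) \<inter> S \<times> T))"
      using fF by (metis card_Suc_Diff1 finite_Int)
    then have "card S + card T = card (F \<inter> S \<times> T) + card I" using ST oF[OF ST(1,2)] by simp
    then show ?thesis using ST * by (auto simp: tight_def)
  qed
  have tight_Int: "tight (S1 \<inter> S2) (T1 \<union> T2)" if t: "tight S1 T1" "tight S2 T2" for S1 S2 T1 T2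
  proof -
    let ?A1 = "F \<inter> S1 \<times> T1" and ?A2 = "F \<inter> S2 \<times> T2"
    let ?B1 = "F \<inter> (S1 \<inter> S2) \<times> (T1 \<union> T2)" and ?B2 = "F \<inter> (S1 \<union> S2) \<times> (T1 \<inter> T2)"
    have "card ?B1 + card ?B2 = card (?B1 \<union> ?B2) + card (?B1 \<inter> ?B2)" using fF by (intro card_Un_Int) auto
    also have "\<dots> \<le> card (?A1 \<union> ?A2) + card (?A1 \<inter> ?A2)"
      using fF by (intro add_mono card_mono) auto
    also have "\<dots> = card ?A1 + card ?A2" using fF by (intro card_Un_Int[symmetric]) auto
    finally have 1: "card ?B1 + card ?B2 \<le> card ?A1 + card ?A2" .
    have sub: "S1 \<subseteq> I" "S2 \<subseteq> I" "T1 \<subseteq> I" "T2 \<subseteq> I" using t by (auto simp: tight_def)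
    then have fin: "finite S1" "finite S2" "finite T1" "finite T2" using fI finite_subset by blast+
    have 2: "card (S1 \<inter> S2) + card (S1 \<union> S2) = card S1 + card S2"
      "card (T1 \<inter> T2) + card (T1 \<union> T2) = card T1 + card T2"
      using card_Un_Int[of S1 S2] card_Un_Int[of T1 T2] fin by auto
    have "card (S1 \<inter> S2) + card (T1 \<union> T2) \<le> card ?B1 + card I"
      "card (S1 \<union> S2) + card (T1 \<inter> T2) \<le> card ?B2 + card I"
      using sub by (auto intro!: oF)
    then have "card (S1 \<inter> S2) + card (T1 \<union> T2) = card ?B1 + card I"
      using 1 2 t unfolding tight_def by linarith
    then show ?thesis using sub by (auto simp: tight_def)
  qed
  have uniq: "\<exists>!y. (x, y) \<in> F" if x: "x \<in> I" for x
  proof -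
    define N where "N = {y. (x, y) \<in> F}"
    have NI: "N \<subseteq> I" using F EI by (auto simp: N_def)
    then have fN: "finite N" using fI finite_subset by blast
    have row: "F \<inter> {x} \<times> T = Pair x ` N" if "N \<subseteq> T" for T using that by (auto simp: N_def)
    have "card {x} + card I \<le> card (F \<inter> {x} \<times> I) + card I" using x by (intro oF) auto
    then have N1: "card N \<ge> 1" unfolding row[OF NI] by (simp add: card_image inj_on_def)
    then have Nne: "N \<noteq> {}" by auto
    have "\<exists>S T. tight S T \<and> x \<in> S \<and> N' \<subseteq> T" if "finite N'" "N' \<noteq> {}" "N' \<subseteq> N" for N'
      using that
    proof (induction N' rule: finite_ne_induct)
      case (singleton y)
      then show ?case using tight_edge[of x y] by (auto simp: N_def)
    next
      case (insert y N')
      then obtain S T where 1: "tight S T" "x \<in> S" "N' \<subseteq> T" by auto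
      obtain S' T' where 2: "tight S' T'" "x \<in> S'" "y \<in> T'" using tight_edge[of x y] insert by (auto simp: N_def)
      have "tight (S \<inter> S') (T \<union> T') \<and> x \<in> S \<inter> S' \<and> insert y N' \<subseteq> T \<union> T'"
        using tight_Int[OF 1(1) 2(1)] 1 2 by auto
      then show ?case by blast
    qed
    from this[OF fN Nne] obtain S T where ST: "tight S T" "x \<in> S" "N \<subseteq> T" by auto
    have sub: "S \<subseteq> I" "T \<subseteq> I" using ST by (auto simp: tight_def)
    have fS: "finite S" using sub fI finite_subset by blast
    \<comment> \<open>This tight rectangle contains all edges at \<open>x\<close>. Deleting
      \<open>x\<close> from \<open>S\<close> lowers \<open>card S\<close> by one and the number of
      edges by \<open>card N\<close>, so tightness together with the Ore condition forces
      \<open>card N \<le> 1\<close>.\<close>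
    have "F \<inter> S \<times> T = (F \<inter> (S - {x}) \<times> T) \<union> Pair x ` N" using row[OF ST(3)] ST(2) by auto
    also have "card \<dots> = card (F \<inter> (S - {x}) \<times> T) + card (Pair x ` N)"
      using fF fN by (intro card_Un_disjoint) auto
    also have "card (Pair x ` N) = card N" by (simp add: card_image inj_on_def)
    finally have 1: "card (F \<inter> S \<times> T) = card (F \<inter> (S - {x}) \<times> T) + card N" .
    have "card (S - {x}) + card T \<le> card (F \<inter> (S - {x}) \<times> T) + card I" using sub by (intro oF) auto
    moreover have "card S = Suc (card (S - {x}))" using ST(2) fS by (metis card_Suc_Diff1)
    ultimately have "card N \<le> 1" using 1 ST(1) unfolding tight_def by linarith
    then have "card N = 1" using N1 by simp
    then obtain y where "N = {y}" by (auto simp: card_1_singleton_iff)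
    then have "(x, z) \<in> F \<longleftrightarrow> z = y" for z unfolding N_def by blast
    then show ?thesis by auto
  qed
  define f where "f x = (THE y. (x, y) \<in> F)" for x
  have f: "(x, f x) \<in> F" if "x \<in> I" for x unfolding f_def using theI'[OF uniq[OF that]] .
  have surj: "I \<subseteq> f ` I"
  proof
    fix y assume y: "y \<in> I"
    have "card I + card {y} \<le> card (F \<inter> I \<times> {y}) + card I" using y by (intro oF) auto
    then have "card (F \<inter> I \<times> {y}) \<noteq> 0" by simp
    then have "F \<inter> I \<times> {y} \<noteq> {}" by (metis card.empty)
    then obtain x where "x \<in> I" "(x, y) \<in> F" by auto
    then have "f x = y" using uniq f by metis
    then show "y \<in> f ` I" using \<open>x \<in> I\<close> by auto
  qed
  have "f ` I \<subseteq> I" using f F EI by auto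
  then have "f ` I = I" using surj by auto
  then have "bij_betw f I I" using fI by (simp add: bij_betw_def eq_card_imp_inj_on)
  then show ?thesis using that[of f] f F by auto
qed

text \<open>The Ore condition by double counting: the rows in \<open>S\<close> carry weight
  \<open>d * card S\<close>, of which at most \<open>d * (card I - card T)\<close> lies in columns
  outside \<open>T\<close>; the rest sits on pairs of \<open>S \<times> T\<close>, each of weight at
  most \<open>d\<close>.\<close>

lemma regular_matching:
  fixes w :: "'b \<Rightarrow> 'b \<Rightarrow> nat"
  assumes fI: "finite I" and "0 < d" and row: "\<And>x. x \<in> I \<Longrightarrow> (\<Sum>y\<in>I. w x y) = d"
    and col: "\<And>y. y \<in> I \<Longrightarrow> (\<Sum>x\<in>I. w x y) = d"
  obtains f where "bij_betw f I I" "\<And>x. x \<in> I \<Longrightarrow> 0 < w x (f x)"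
proof -
  let ?E = "{(x, y). x \<in> I \<and> y \<in> I \<and> 0 < w x y}"
  have "card S + card T \<le> card (?E \<inter> S \<times> T) + card I" if ST: "S \<subseteq> I" "T \<subseteq> I" for S T
  proof -
    have fin: "finite S" "finite T" using ST fI finite_subset by blast+
    have wd: "w x y \<le> d" if "x \<in> I" "y \<in> I" for x y
      using row[OF that(1)] member_le_sum[of y I "w x"] that fI by auto
    have "d * card S = (\<Sum>x\<in>S. \<Sum>y\<in>I. w x y)" using row ST by (simp add: subset_iff)
    also have "\<dots> = (\<Sum>x\<in>S. (\<Sum>y\<in>T. w x y) + (\<Sum>y\<in>I - T. w x y))"
      using fI ST by (intro sum.cong refl) (metis add.commute sum.subset_diff)
    also have "\<dots> = (\<Sum>x\<in>S. \<Sum>y\<in>T. w x y) + (\<Sum>x\<in>S. \<Sum>y\<in>I - T. w x y)" by (simp add: sum.distrib)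
    also have "(\<Sum>x\<in>S. \<Sum>y\<in>I - T. w x y) = (\<Sum>y\<in>I - T. \<Sum>x\<in>S. w x y)" by (rule sum.swap)
    also have "\<dots> \<le> (\<Sum>y\<in>I - T. \<Sum>x\<in>I. w x y)" using fI ST by (intro sum_mono sum_mono2) auto
    also have "\<dots> = d * (card I - card T)" using col fin ST by (simp add: card_Diff_subset)
    also have "(\<Sum>x\<in>S. \<Sum>y\<in>T. w x y) = (\<Sum>(x,y)\<in>S \<times> T. w x y)" by (simp add: sum.cartesian_product)
    also have "\<dots> = (\<Sum>(x,y)\<in>?E \<inter> S \<times> T. w x y)"
      using fin ST by (intro sum.mono_neutral_right) auto
    also have "\<dots> \<le> (\<Sum>(x,y)\<in>?E \<inter> S \<times> T. d)" by (intro sum_mono) (auto intro: wd)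
    also have "\<dots> = d * card (?E \<inter> S \<times> T)" by simp
    finally have "d * card S \<le> d * (card (?E \<inter> S \<times> T) + (card I - card T))" by (simp add: algebra_simps)
    then have "card S \<le> card (?E \<inter> S \<times> T) + (card I - card T)" using \<open>0 < d\<close> by simp
    moreover have "card T \<le> card I" using ST fI by (simp add: card_mono)
    ultimately show ?thesis by simp
  qed
  then obtain f where "bij_betw f I I" "\<And>x. x \<in> I \<Longrightarrow> (x, f x) \<in> ?E"
    using ore_matching[OF fI, of ?E] by blast
  then show ?thesis using that by auto
qed

text \<open>Two copies of the bipartite graph \<open>W\<close>, one of them transposed, with the deficiency of each
  vertex as multiplicity of the edge to its twin, form a regular bipartite multigraph.\<close>

lemma matching_covering_max_degree:
  assumes fB: "finite B" and WB: "W \<subseteq> B \<times> B"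
    and row: "\<And>x. x \<in> B \<Longrightarrow> card {y. (x, y) \<in> W} \<le> Suc d"
    and col: "\<And>y. y \<in> B \<Longrightarrow> card {x. (x, y) \<in> W} \<le> Suc d"
  obtains M where "M \<subseteq> W" "single_valued M" "single_valued (M\<inverse>)"
    "\<And>x. x \<in> B \<Longrightarrow> card {y. (x, y) \<in> W - M} \<le> d" "\<And>y. y \<in> B \<Longrightarrow> card {x. (x, y) \<in> W - M} \<le> d"
proof -
  define I where "I = B \<times> (UNIV :: bool set)"
  define w where "w = (\<lambda>(x, p) (y, q).
     if \<not> p \<and> \<not> q then of_bool ((x, y) \<in> W)
     else if p \<and> q then of_bool ((y, x) \<in> W)
     else if \<not> p then (if x = y then Suc d - card {y. (x, y) \<in> W} else 0)
     else (if x = y then Suc d - card {x. (x, y) \<in> W} else (0::nat)))"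
  have R: "(\<Sum>y\<in>B. of_bool ((x, y) \<in> W)) = card {y. (x, y) \<in> W}" for x
  proof -
    have "{y. (x, y) \<in> W} = {y\<in>B. (x, y) \<in> W}" using WB by auto
    then show ?thesis using fB by (simp add: of_bool_def sum.If_cases Int_def)
  qed
  have C: "(\<Sum>x\<in>B. of_bool ((x, y) \<in> W)) = card {x. (x, y) \<in> W}" for y
  proof -
    have "{x. (x, y) \<in> W} = {x\<in>B. (x, y) \<in> W}" using WB by auto
    then show ?thesis using fB by (simp add: of_bool_def sum.If_cases Int_def)
  qed
  have split: "(\<Sum>z\<in>I. h z) = (\<Sum>y\<in>B. h (y, True)) + (\<Sum>y\<in>B. h (y, False))" for h :: "_ \<Rightarrow> nat"
  proof -
    have "(\<Sum>z\<in>I. h z) = (\<Sum>y\<in>B. \<Sum>p\<in>UNIV. h (y, p))" unfolding I_def by (simp add: sum.cartesian_product)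
    then show ?thesis by (simp add: UNIV_bool sum.distrib add.commute)
  qed
  have w: "w (x, False) (y, False) = of_bool ((x, y) \<in> W)" "w (x, True) (y, True) = of_bool ((y, x) \<in> W)"
    "w (x, False) (y, True) = (if x = y then Suc d - card {y. (x, y) \<in> W} else 0)"
    "w (x, True) (y, False) = (if x = y then Suc d - card {z. (z, x) \<in> W} else 0)" for x y
    by (simp_all add: w_def)
  have delta: "(\<Sum>y\<in>B. if x = y then h y else 0) = h x" "(\<Sum>y\<in>B. if y = x then h y else 0) = h x"
    if "x \<in> B" for x and h :: "_ \<Rightarrow> nat"
    using that fB by (simp_all add: sum.delta sum.delta')
  obtain f where f: "bij_betw f I I" "\<And>x. x \<in> I \<Longrightarrow> 0 < w x (f x)"
  proof (rule regular_matching[of I "Suc d" w])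
    show "finite I" using fB by (simp add: I_def)
    fix z assume z: "z \<in> I"
    then obtain x p where x: "z = (x, p)" "x \<in> B" by (auto simp: I_def)
    show "(\<Sum>y\<in>I. w z y) = Suc d"
      using x(2) row[OF x(2)] col[OF x(2)] by (cases p) (simp_all add: x(1) split w R C delta)
    show "(\<Sum>y\<in>I. w y z) = Suc d"
      using x(2) row[OF x(2)] col[OF x(2)] by (cases p) (simp_all add: x(1) split w R C delta)
  qed auto
  define M where "M = {(x, y). x \<in> B \<and> f (x, False) = (y, False)}"
  have MW: "M \<subseteq> W"
  proof
    fix e assume "e \<in> M"
    then obtain x y where e: "e = (x, y)" "x \<in> B" "f (x, False) = (y, False)" by (auto simp: M_def)
    then have "0 < w (x, False) (y, False)" using f(2)[of "(x, False)"] by (auto simp: I_def)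
    then show "e \<in> W" using e by (simp add: w_def split: if_splits)
  qed
  have inj: "inj_on f I" using f(1) by (simp add: bij_betw_def)
  have "single_valued M" by (auto simp: M_def single_valued_def)
  moreover have "single_valued (M\<inverse>)"
    using inj by (auto simp: M_def single_valued_def inj_on_def I_def) (metis prod.inject)
  moreover have "card {y. (x, y) \<in> W - M} \<le> d" if x: "x \<in> B" for x
  proof (cases "card {y. (x, y) \<in> W} = Suc d")
    case True
    \<comment> \<open>A vertex of degree \<open>Suc d\<close> has deficiency 0, so the edge to its
      twin has multiplicity 0 and the perfect matching must use an edge of \<open>W\<close> there.
      Vertices of smaller degree need not be matched within \<open>W\<close>.\<close>
    obtain y p where y: "f (x, False) = (y, p)" by fastforce
    have "0 < w (x, False) (y, p)" using f(2)[of "(x, False)"] x y by (auto simp: I_def)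
    then have "\<not> p" using True by (auto simp: w_def split: if_splits)
    then have yM: "(x, y) \<in> M" using x y by (simp add: M_def)
    have "{y. (x, y) \<in> W - M} \<subseteq> {y. (x, y) \<in> W} - {y}" using yM by auto
    moreover have fin: "finite {y. (x, y) \<in> W}" using True card_ge_0_finite by force
    ultimately have "card {y. (x, y) \<in> W - M} \<le> card ({y. (x, y) \<in> W} - {y})"
      by (intro card_mono) auto
    also have "\<dots> = d" using True yM MW fin by (subst card_Diff_singleton) auto
    finally show ?thesis .
  next
    case False
    have "finite {y. (x, y) \<in> W}" using fB WB by (rule_tac finite_subset[of _ B]) auto
    then have "card {y. (x, y) \<in> W - M} \<le> card {y. (x, y) \<in> W}" by (intro card_mono) auto
    then show ?thesis using row[OF x] False by simp
  qed
  moreover have "card {x. (x, y) \<in> W - M} \<le> d" if y: "y \<in> B" for y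
  proof (cases "card {x. (x, y) \<in> W} = Suc d")
    case True
    have "(y, False) \<in> f ` I" using f(1) y by (auto simp: bij_betw_def I_def)
    then obtain x p where x: "x \<in> B" "f (x, p) = (y, False)" by (auto simp: I_def)
    have "0 < w (x, p) (y, False)" using f(2)[of "(x, p)"] x by (auto simp: I_def)
    then have "\<not> p" using True by (auto simp: w_def split: if_splits)
    then have yM: "(x, y) \<in> M" using x by (simp add: M_def)
    have "{x. (x, y) \<in> W - M} \<subseteq> {x. (x, y) \<in> W} - {x}" using yM by auto
    moreover have fin: "finite {x. (x, y) \<in> W}" using True card_ge_0_finite by force
    ultimately have "card {x. (x, y) \<in> W - M} \<le> card ({x. (x, y) \<in> W} - {x})"
      by (intro card_mono) auto
    also have "\<dots> = d" using True yM MW fin by (subst card_Diff_singleton) auto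
    finally show ?thesis .
  next
    case False
    have "finite {x. (x, y) \<in> W}" using fB WB by (rule_tac finite_subset[of _ B]) auto
    then have "card {x. (x, y) \<in> W - M} \<le> card {x. (x, y) \<in> W}" by (intro card_mono) auto
    then show ?thesis using col[OF y] False by simp
  qed
  ultimately show ?thesis using that[of M] MW by blast
qed

text \<open>Koenig's theorem by induction on the maximum degree: removing a matching that meets
  every vertex of maximum degree, on both sides, lowers it by one.\<close>

lemma koenig_edge_colouring:
  assumes "finite B" "W \<subseteq> B \<times> B"
    and "\<And>x. x \<in> B \<Longrightarrow> card {y. (x, y) \<in> W} \<le> d"
    and "\<And>y. y \<in> B \<Longrightarrow> card {x. (x, y) \<in> W} \<le> d"
  shows "\<exists>M :: nat \<Rightarrow> ('b \<times> 'b) set. W = (\<Union>t<d. M t) \<and> disjoint_family_on M {..<d} \<and>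
    (\<forall>t<d. single_valued (M t) \<and> single_valued ((M t)\<inverse>))"
  using assms(2-)
proof (induction d arbitrary: W)
  case 0
  have "W = {}"
  proof (rule ccontr)
    assume "W \<noteq> {}"
    then obtain x y where xy: "(x, y) \<in> W" by auto
    have "finite {y. (x, y) \<in> W}" using \<open>finite B\<close> 0 by (rule_tac finite_subset[of _ B]) auto
    then show False using 0(2)[of x] xy 0(1) by auto
  qed
  then show ?case by (auto simp: disjoint_family_on_def)
next
  case (Suc d)
  obtain N where N: "N \<subseteq> W" "single_valued N" "single_valued (N\<inverse>)"
    "\<And>x. x \<in> B \<Longrightarrow> card {y. (x, y) \<in> W - N} \<le> d" "\<And>y. y \<in> B \<Longrightarrow> card {x. (x, y) \<in> W - N} \<le> d"
    using matching_covering_max_degree[OF assms(1) Suc.prems] by blast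
  have "W - N \<subseteq> B \<times> B" using Suc.prems(1) by auto
  then have "\<exists>M :: nat \<Rightarrow> ('b \<times> 'b) set. W - N = (\<Union>t<d. M t) \<and> disjoint_family_on M {..<d} \<and>
    (\<forall>t<d. single_valued (M t) \<and> single_valued ((M t)\<inverse>))"
    using N(4,5) by (rule Suc.IH)
  then obtain M where M: "W - N = (\<Union>t<d. M t)" "disjoint_family_on M {..<d}"
    "\<forall>t<d. single_valued (M t) \<and> single_valued ((M t)\<inverse>)"
    by (elim exE conjE)
  let ?M = "M(d := N)"
  have "W = (\<Union>t<Suc d. ?M t)"
  proof -
    have "(\<Union>t<Suc d. ?M t) = N \<union> (\<Union>t<d. M t)" by (auto simp: lessThan_Suc)
    also have "\<dots> = W" using M(1) N(1) by auto
    finally show ?thesis by simp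
  qed
  moreover have "disjoint_family_on ?M {..<Suc d}"
  proof (rule disjoint_family_on_lessThan_Suc)
    show "disjoint_family_on ?M {..<d}" using M(2) by (simp add: disjoint_family_on_def)
    show "?M d \<inter> ?M t = {}" if "t < d" for t using M(1) that by auto
  qed
  moreover have "\<forall>t<Suc d. single_valued (?M t) \<and> single_valued ((?M t)\<inverse>)"
    using M(3) N by (auto simp: less_Suc_eq)
  ultimately show ?case by blast
qed

section \<open>Path systems from near-regular graphs\<close>

lemma distinct_concat_mset:
  assumes "mset ps = mset qs"
  shows "distinct (concat ps) \<longleftrightarrow> distinct (concat qs)" "set ps = set qs" "length ps = length qs"
proof -
  have "mset (concat ps) = mset (concat qs)"
    using assms by (simp add: mset_concat) (metis mset_map sum_mset_sum_list)
  then show "distinct (concat ps) \<longleftrightarrow> distinct (concat qs)" by (rule mset_eq_imp_distinct_iff)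
qed (use assms mset_eq_setD mset_eq_length in auto)

lemma hd_le_last:
  assumes "sorted_wrt (\<lambda>a b. (rk a :: nat) < rk b) p" "p \<noteq> []"
  shows "rk (hd p) \<le> rk (last p)"
  using assms by (cases p) (auto simp: less_imp_le)

text \<open>A linear forest on \<open>B\<close> given by its oriented edges \<open>F\<close>, with
  isolated vertices as paths of one vertex. Every edge merges two paths, which explains the count;
  the heads and lasts are the vertices without incoming and without outgoing edge, so the ends can
  be read off from \<open>F\<close>.\<close>

definition path_cover :: "'a set \<Rightarrow> ('a \<times> 'a) set \<Rightarrow> 'a list list \<Rightarrow> bool" where
  "path_cover B F ps \<longleftrightarrow> distinct (concat ps) \<and> set (concat ps) = B \<and> [] \<notin> set ps \<and>
    length ps + card F = card B \<and> system_edges ps = (\<lambda>(x, y). {x, y}) ` F \<and>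
    hd ` set ps = B - Range F \<and> last ` set ps = B - Domain F"

text \<open>Edges are added one at a time. A new edge leads from the last vertex of one path to the
  head of another; these paths differ since \<open>rk\<close> increases along every path, so no
  cycle can arise.\<close>

lemma exists_path_cover:
  fixes rk :: "'a \<Rightarrow> nat"
  assumes fB: "finite B" and "F \<subseteq> B \<times> B" "single_valued F" "single_valued (F\<inverse>)"
    and "\<And>x y. (x, y) \<in> F \<Longrightarrow> rk x < rk y"
  shows "\<exists>ps. path_cover B F ps \<and> (\<forall>p\<in>set ps. sorted_wrt (\<lambda>a b. rk a < rk b) p)"
proof -
  have "finite F" using assms(2) fB finite_subset by blast
  then show ?thesis using assms(2-)
  proof (induction F rule: finite_induct)
    case empty
    obtain bs where bs: "set bs = B" "distinct bs" using finite_distinct_list[OF fB] by blast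
    have "concat (map (\<lambda>b. [b]) bs) = bs" by (induction bs) auto
    then show ?case using bs distinct_card[of bs]
      by (intro exI[of _ "map (\<lambda>b. [b]) bs"]) (auto simp: path_cover_def system_edges_def image_iff)
  next
    case (insert e F)
    obtain x y where e: "e = (x, y)" by fastforce
    have "\<exists>ps. path_cover B F ps \<and> (\<forall>p\<in>set ps. sorted_wrt (\<lambda>a b. rk a < rk b) p)"
    proof (rule insert.IH)
      show "single_valued F" "single_valued (F\<inverse>)" using insert.prems(2,3)
        by (auto simp: single_valued_def)
    qed (use insert.prems in auto)
    then obtain ps where ps: "distinct (concat ps)" "set (concat ps) = B" "[] \<notin> set ps"
      "length ps + card F = card B" "system_edges ps = (\<lambda>(x, y). {x, y}) ` F"
      "hd ` set ps = B - Range F" "last ` set ps = B - Domain F"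
      "\<forall>p\<in>set ps. sorted_wrt (\<lambda>a b. rk a < rk b) p" unfolding path_cover_def by (elim exE conjE)
    have xy: "x \<in> B" "y \<in> B" "rk x < rk y" using insert.prems e by auto
    have "x \<notin> Domain F" using insert.prems(2) insert.hyps(2) e by (auto simp: single_valued_def)
    then obtain p where p: "p \<in> set ps" "last p = x" using ps(7) xy by (metis DiffI imageE)
    have "y \<notin> Range F" using insert.prems(3) insert.hyps(2) e by (auto simp: single_valued_def)
    then obtain p' where p': "p' \<in> set ps" "hd p' = y" using ps(6) xy by (metis DiffI imageE)
    have "p \<noteq> p'"
    proof
      assume "p = p'"
      then have "rk y \<le> rk x" using hd_le_last[of rk p] ps p p' by auto
      then show False using xy by simp
    qed
    define qs where "qs = remove1 p' (remove1 p ps)"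
    have "p' \<in> set (remove1 p ps)" using p' \<open>p \<noteq> p'\<close> by simp
    then have "mset (remove1 p ps) = add_mset p' (mset qs)" unfolding qs_def by (metis insert_DiffM mset_remove1 set_mset_mset)
    moreover have "mset ps = add_mset p (mset (remove1 p ps))" using p by (metis insert_DiffM mset_remove1 set_mset_mset)
    ultimately have m: "mset ps = mset (p # p' # qs)" by (metis mset.simps(2))
    have d: "distinct (concat (p # p' # qs))" and st: "set ps = set (p # p' # qs)"
      and ln: "length ps = length (p # p' # qs)"
      using distinct_concat_mset[OF m] ps(1) by auto
    have ne: "p \<noteq> []" "p' \<noteq> []" "[] \<notin> set qs" using ps(3) unfolding st by auto
    let ?rs = "(p @ p') # qs"
    have 1: "distinct (concat ?rs)" using d by auto
    have 2: "set (concat ?rs) = B" using ps(2) st by auto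
    have 3: "[] \<notin> set ?rs" using ne by auto
    have 4: "length ?rs + card (insert e F) = card B" using ps(4) ln insert.hyps by simp
    have 5: "system_edges ?rs = (\<lambda>(x, y). {x, y}) ` insert e F"
      using ps(5) ne p p' unfolding st e system_edges_def by (auto simp: path_edges_append)
    have hq: "hd ` set qs \<inter> (set p \<union> set p') = {}" "last ` set qs \<inter> (set p \<union> set p') = {}"
    proof -
      have "\<And>r. r \<in> set qs \<Longrightarrow> set r \<inter> (set p \<union> set p') = {}" using d by auto
      then show "hd ` set qs \<inter> (set p \<union> set p') = {}" "last ` set qs \<inter> (set p \<union> set p') = {}"
        using ne(3) by (auto, (metis hd_in_set last_in_set disjoint_iff UnI1 UnI2)+)
    qed
    have pp: "set p \<inter> set p' = {}" using d by auto
    have mem: "hd p \<in> set p" "x \<in> set p" "y \<in> set p'" "last p' \<in> set p'" using ne p p' by auto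
    then have neq: "hd p \<noteq> y" "last p' \<noteq> x" using pp by blast+
    have yx: "\<forall>r\<in>set qs. hd r \<noteq> y \<and> last r \<noteq> x" using hq mem by blast
    have "hd ` set ?rs = hd ` set ps - {y}" unfolding st using ne p' neq yx by auto
    then have 6: "hd ` set ?rs = B - Range (insert e F)" using ps(6) e by auto
    have "last ` set ?rs = last ` set ps - {x}" unfolding st using ne p neq yx by auto
    then have 7: "last ` set ?rs = B - Domain (insert e F)" using ps(7) e by auto
    have s: "sorted_wrt (\<lambda>a b. rk a < rk b) p" "sorted_wrt (\<lambda>a b. rk a < rk b) p'" using ps(8) p p' by auto
    have "rk a < rk b" if "a \<in> set p" "b \<in> set p'" for a b
    proof -
      have "rk a \<le> rk x" using s(1) that(1) p ne
        by (metis (no_types, lifting) append_butlast_last_id in_set_butlastD le_less list.set_intros(1)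
          sorted_wrt_append append_Nil2 in_set_conv_decomp snoc_eq_iff_butlast UnE set_append set_ConsD empty_iff list.set(1))
      moreover have "rk y \<le> rk b" using s(2) that(2) p' ne by (cases p') (auto simp: less_imp_le)
      ultimately show ?thesis using xy by simp
    qed
    then have 8: "\<forall>p\<in>set ?rs. sorted_wrt (\<lambda>a b. rk a < rk b) p"
      using ps(8) s unfolding st by (auto simp: sorted_wrt_append)
    show ?case unfolding path_cover_def by (intro exI[of _ ?rs] conjI 1 2 3 4 5 6 7 8)
  qed
qed

section \<open>Cyclic shifts of the clusters\<close>

lemma card_residue_class_le:
  fixes q :: nat
  assumes "0 < q"
  shows "card {t. t < d \<and> t mod q = j} \<le> d div q + 1"
proof -
  have "inj_on (\<lambda>t. t div q) {t. t < d \<and> t mod q = j}"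
    by (rule inj_onI) (metis (mono_tags, lifting) div_mult_mod_eq mem_Collect_eq)
  moreover have "(\<lambda>t. t div q) ` {t. t < d \<and> t mod q = j} \<subseteq> {..d div q}"
    by (auto intro: div_le_mono)
  ultimately have "card {t. t < d \<and> t mod q = j} \<le> card {..d div q}" by (intro card_inj_on_le) auto
  then show ?thesis by simp
qed

text \<open>Along the cyclic shift by \<open>c\<close> the clusters are visited in the order
  \<open>0, c, 2c, \<dots>\<close> modulo the prime \<open>q\<close>; cutting behind one cluster leaves no cycle.\<close>

lemma shift_rank:
  fixes c q t :: nat
  assumes "prime q" "0 < c" "c < q"
  obtains rk :: "nat \<Rightarrow> nat" where "\<And>a. a < q \<Longrightarrow> a \<noteq> t mod q \<Longrightarrow> rk a < rk ((a + c) mod q)"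
proof -
  have "\<not> q dvd c" using assms(2,3) by (auto dest: dvd_imp_le)
  then have cop: "coprime c q" using prime_imp_coprime[OF assms(1)] by (simp add: coprime_commute)
  then obtain c' where c': "[c * c' = 1] (mod q)" using cong_solve_coprime_nat[OF cop] by auto
  have q: "1 < q" using assms(1) prime_gt_1_nat by blast
  \<comment> \<open>Modulo \<open>q\<close>, \<open>L\<close> is the negative of
    \<open>t + c\<close>, written without subtraction. With \<open>c'\<close> the inverse of
    \<open>c\<close>, \<open>rk a\<close> counts the shifts by \<open>c\<close> that lead from
    \<open>t + c\<close> to \<open>a\<close>. The only drop from \<open>q - 1\<close> to 0 is then
    at \<open>t\<close>, the cluster behind which the cut is made.\<close>
  define L where "L = (q - 1) * (t + c)"
  define rk where "rk a = (c' * (a + L)) mod q" for a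
  have "rk a < rk ((a + c) mod q)" if a: "a < q" "a \<noteq> t mod q" for a
  proof -
    have "[c' * ((a + c) mod q + L) = c' * (a + c + L)] (mod q)"
      by (intro cong_mult cong_add cong_refl) (simp add: cong_def)
    also have "c' * (a + c + L) = c' * (a + L) + c * c'" by (simp add: algebra_simps)
    also have "[c' * (a + L) + c * c' = rk a + 1] (mod q)"
      by (intro cong_add c') (simp add: rk_def cong_def)
    finally have e: "rk ((a + c) mod q) = (rk a + 1) mod q" by (simp add: rk_def cong_def)
    have "rk a + 1 \<noteq> q"
    proof
      assume r: "rk a + 1 = q"
      have "[c * (c' * (a + L)) + c = c * rk a + c] (mod q)"
        by (intro cong_add cong_mult cong_refl) (simp add: rk_def cong_def)
      also have "c * rk a + c = c * q" unfolding r[symmetric] by simp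
      also have "[c * q = 0] (mod q)" by (simp add: cong_def)
      finally have "[c * (c' * (a + L)) + c = 0] (mod q)" .
      moreover have "[c * (c' * (a + L)) + c = (a + L) + c] (mod q)"
      proof -
        have "[(c * c') * (a + L) = 1 * (a + L)] (mod q)" using c' by (intro cong_mult cong_refl)
        then show ?thesis by (intro cong_add cong_refl) (simp add: mult.assoc)
      qed
      ultimately have "[(a + L) + c = 0] (mod q)" by (meson cong_sym cong_trans)
      then have "[(a + L) + c + t = 0 + t] (mod q)" by (intro cong_add cong_refl)
      moreover have "(a + L) + c + t = a + q * (t + c)"
        using q by (cases q) (simp_all add: L_def algebra_simps)
      moreover have "[a + q * (t + c) = a] (mod q)" by (simp add: cong_def)
      ultimately have "[a = t] (mod q)" by (metis add_0 cong_sym cong_trans)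
      then show False using a by (simp add: cong_def)
    qed
    moreover have "rk a < q" using q by (simp add: rk_def)
    ultimately have "(rk a + 1) mod q = rk a + 1" by simp
    then show ?thesis using e by simp
  qed
  then show ?thesis using that by blast
qed

lemma mod_shift_unique:
  fixes q :: nat
  assumes "a < q" "b < q" "c \<le> q"
  shows "b = (a + c) mod q \<longleftrightarrow> a = (b + (q - c)) mod q"
proof -
  have "(a + c) mod q = (if a + c < q then a + c else a + c - q)"
    using assms by (simp add: le_mod_geq)
  moreover have "(b + (q - c)) mod q = (if b < c then b + (q - c) else b - c)"
    using assms le_mod_geq[of q "b + (q - c)"] by auto
  ultimately show ?thesis using assms by auto
qed

text \<open>Each of the \<open>d\<close> matchings of the shift by \<open>c\<close> is cut behind a cluster depending on its
  index, so that no vertex becomes an end too often.\<close>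

lemma shift_path_systems:
  fixes q d c :: nat and x y :: real and g :: "'a \<Rightarrow> nat"
  assumes fB: "finite B" and q: "prime q" and c: "0 < c" "c < q" and g: "\<And>v. v \<in> B \<Longrightarrow> g v < q"
    and deg: "\<And>v i. v \<in> B \<Longrightarrow> i < q \<Longrightarrow> card {u \<in> nbrs E B v. g u = i} \<le> d"
    and deg': "\<And>v i. v \<in> B \<Longrightarrow> i < q \<Longrightarrow> real d \<le> card {u \<in> nbrs E B v. g u = i} + x"
    and cl: "\<And>i. i < q \<Longrightarrow> card {u \<in> B. g u = i} \<le> y"
  shows "\<exists>(ps :: nat \<Rightarrow> 'a list list) F.
    (\<forall>t<d. path_cover B (F t) (ps t)) \<and>
    (\<forall>t<d. \<forall>(x, y)\<in>F t. {x, y} \<in> E \<and> x \<in> B \<and> y \<in> B \<and> g y = (g x + c) mod q) \<and>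
    disjoint_family_on F {..<d} \<and>
    (\<Sum>t<d. real (length (ps t))) \<le> card B * x + d * y \<and>
    (\<forall>v\<in>B. card {t. t < d \<and> v \<in> ends (ps t)} \<le> 2 * (x + d / q + 1))"
proof -
  have q0: "0 < q" using q prime_gt_0_nat by blast
  \<comment> \<open>Orienting every edge from cluster \<open>i\<close> to cluster
    \<open>i + c\<close> makes a bipartite graph between two copies of \<open>B\<close>, to which
    Koenig's theorem applies.\<close>
  define W where "W = {(x, y). x \<in> B \<and> y \<in> nbrs E B x \<and> g y = (g x + c) mod q}"
  have WB: "W \<subseteq> B \<times> B" by (auto simp: W_def nbrs_def)
  have row: "{y. (v, y) \<in> W} = {u \<in> nbrs E B v. g u = (g v + c) mod q}" if "v \<in> B" for v
    using that by (auto simp: W_def)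
  have col: "{u. (u, v) \<in> W} = {u \<in> nbrs E B v. g u = (g v + (q - c)) mod q}" if "v \<in> B" for v
    using that g c mod_shift_unique[of _ q "g v" c] by (auto simp: W_def nbrs_def insert_commute)
  have "\<exists>M :: nat \<Rightarrow> ('a \<times> 'a) set. W = (\<Union>t<d. M t) \<and> disjoint_family_on M {..<d} \<and>
    (\<forall>t<d. single_valued (M t) \<and> single_valued ((M t)\<inverse>))"
  proof (rule koenig_edge_colouring[OF fB WB])
    fix v assume v: "v \<in> B"
    show "card {y. (v, y) \<in> W} \<le> d" using row[OF v] deg[OF v] q0 by simp
    show "card {u. (u, v) \<in> W} \<le> d" using col[OF v] deg[OF v] q0 by simp
  qed
  then obtain M where M: "W = (\<Union>t<d. M t)" "disjoint_family_on M {..<d}"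
    "\<And>t. t < d \<Longrightarrow> single_valued (M t)" "\<And>t. t < d \<Longrightarrow> single_valued ((M t)\<inverse>)" by blast
  have fW: "finite W" using WB fB finite_subset by blast
  have MW: "M t \<subseteq> W" if "t < d" for t using M(1) that by auto
  have fM: "finite (M t)" if "t < d" for t using MW[OF that] fW finite_subset by blast
  define F where "F t = {(x, y) \<in> M t. g x \<noteq> t mod q}" for t
  have FM: "F t \<subseteq> M t" for t by (auto simp: F_def)
  have Fprop: "{x, y} \<in> E \<and> x \<in> B \<and> y \<in> B \<and> g y = (g x + c) mod q" if "t < d" "(x, y) \<in> F t" for t x y
    using that FM MW[OF that(1)] by (force simp: W_def nbrs_def)
  have "\<exists>ps. path_cover B (F t) ps" if t: "t < d" for t
  proof -
    obtain rk :: "nat \<Rightarrow> nat" where rk: "\<And>a. a < q \<Longrightarrow> a \<noteq> t mod q \<Longrightarrow> rk a < rk ((a + c) mod q)"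
      using shift_rank[OF q c] by blast
    have "F t \<subseteq> B \<times> B" using FM MW[OF t] WB by blast
    moreover have "single_valued (F t)" using M(3)[OF t] FM single_valued_subset by blast
    moreover have "single_valued ((F t)\<inverse>)" using M(4)[OF t] FM by (meson converse_mono single_valued_subset)
    moreover have "(rk \<circ> g) x < (rk \<circ> g) y" if "(x, y) \<in> F t" for x y
      using Fprop[OF t that] rk[of "g x"] g that by (auto simp: F_def)
    ultimately show ?thesis using exists_path_cover[OF fB, of "F t" "rk \<circ> g"] by blast
  qed
  then obtain ps where cov: "\<And>t. t < d \<Longrightarrow> path_cover B (F t) (ps t)" by metis
  note ps = cov[unfolded path_cover_def]
  have dF: "disjoint_family_on F {..<d}" using M(2) FM unfolding disjoint_family_on_def by blast

  \<comment> \<open>The number of paths is \<open>card B\<close> minus the number of edges, summed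
    over \<open>t\<close>. Edges are missing for two reasons: at most \<open>x\<close> per vertex
    because the graph is only nearly regular, and at most \<open>y\<close> per matching because of
    the cut, whose edges all start in one cluster.\<close>
  have "(\<Sum>t<d. real (length (ps t))) \<le> card B * x + d * y"
  proof -
    have "card (M t) \<le> real (card (F t)) + y" if t: "t < d" for t
    proof -
      have "card (M t - F t) \<le> card {u \<in> B. g u = t mod q}"
      proof (rule card_inj_on_le[of fst])
        show "inj_on fst (M t - F t)" using M(3)[OF t] by (auto simp: inj_on_def single_valued_def)
        show "fst ` (M t - F t) \<subseteq> {u \<in> B. g u = t mod q}" using MW[OF t] WB by (auto simp: F_def)
      qed (use fB in auto)
      also have "real (card {u \<in> B. g u = t mod q}) \<le> y" using cl q0 by simp
      finally have "real (card (M t - F t)) \<le> y" by simp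
      moreover have "card (M t) = card (F t) + card (M t - F t)"
        using fM[OF t] FM[of t] by (metis card_Un_disjoint Diff_disjoint Diff_partition finite_Diff finite_subset)
      ultimately show ?thesis by simp
    qed
    then have "(\<Sum>t<d. real (card (M t))) \<le> (\<Sum>t<d. real (card (F t)) + y)" by (intro sum_mono) auto
    then have 1: "(\<Sum>t<d. real (card (M t))) \<le> (\<Sum>t<d. real (card (F t))) + d * y" by (simp add: sum.distrib)
    have "card W = (\<Sum>t<d. card (M t))"
      unfolding M(1) using fM M(2) by (intro card_UN_disjoint) (auto simp: disjoint_family_on_def)
    moreover have "card W = (\<Sum>v\<in>B. card {y. (v, y) \<in> W})"
    proof -
      have "W = (SIGMA v:B. {y. (v, y) \<in> W})" using WB by auto
      also have "card \<dots> = (\<Sum>v\<in>B. card {y. (v, y) \<in> W})"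
      proof (rule card_SigmaI[OF fB], rule ballI)
        fix v
        show "finite {y. (v, y) \<in> W}" using fB WB by (rule_tac finite_subset[of _ B]) auto
      qed
      finally show ?thesis .
    qed
    ultimately have "(\<Sum>t<d. real (card (M t))) = (\<Sum>v\<in>B. real (card {y. (v, y) \<in> W}))"
      by (metis of_nat_sum)
    moreover have "(\<Sum>v\<in>B. real (card {y. (v, y) \<in> W})) \<ge> (\<Sum>v\<in>B. d - x)"
      using deg' q0 row by (intro sum_mono) (simp add: algebra_simps)
    ultimately have 2: "(\<Sum>t<d. real (card (M t))) \<ge> card B * (d - x)" by simp
    have "(\<Sum>t<d. real (length (ps t)) + card (F t)) = (\<Sum>t<d. real (card B))"
      using ps by (intro sum.cong refl) (metis lessThan_iff of_nat_add)
    then have "(\<Sum>t<d. real (length (ps t))) + (\<Sum>t<d. real (card (F t))) = d * real (card B)"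
      by (simp add: sum.distrib)
    then show ?thesis using 1 2 by (simp add: algebra_simps)
  qed
  moreover have "card {t. t < d \<and> v \<in> ends (ps t)} \<le> 2 * (x + d / q + 1)" if v: "v \<in> B" for v
  proof -
    let ?D = "{t. t < d \<and> v \<in> Domain (M t)}" and ?R = "{t. t < d \<and> v \<in> Range (M t)}"
    let ?i = "(g v + (q - c)) mod q"
    let ?A = "{t. t < d \<and> t mod q = g v}" and ?C = "{t. t < d \<and> t mod q = ?i}"
    \<comment> \<open>A vertex is an end in system \<open>t\<close> if matching \<open>t\<close>
      misses it on one side, or if the cut removed its edge. The latter happens only for
      \<open>t\<close> congruent to its own cluster or to the preceding one, hence for about a
      fraction \<open>2 / q\<close> of all \<open>t\<close>.\<close>
    have sub: "{t. t < d \<and> v \<in> ends (ps t)} \<subseteq> ({..<d} - ?D) \<union> ({..<d} - ?R) \<union> (?A \<union> ?C)"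
    proof
      fix t assume "t \<in> {t. t < d \<and> v \<in> ends (ps t)}"
      then have t: "t < d" "v \<in> ends (ps t)" by auto
      then have "v \<notin> Range (F t) \<or> v \<notin> Domain (F t)" using ps[OF t(1)] by (auto simp: ends_def)
      then show "t \<in> ({..<d} - ?D) \<union> ({..<d} - ?R) \<union> (?A \<union> ?C)"
      proof
        assume nR: "v \<notin> Range (F t)"
        show ?thesis
        proof (cases "v \<in> Range (M t)")
          case True
          then obtain u where u: "(u, v) \<in> M t" by auto
          then have "g u = t mod q" using nR by (auto simp: F_def)
          moreover have "g u = ?i" using col[OF v] u MW[OF t(1)] by blast
          ultimately show ?thesis using t by auto
        qed (use t in auto)
      next
        assume nD: "v \<notin> Domain (F t)"
        show ?thesis
        proof (cases "v \<in> Domain (M t)")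
          case True
          then obtain u where u: "(v, u) \<in> M t" by auto
          then have "g v = t mod q" using nD by (auto simp: F_def)
          then show ?thesis using t by auto
        qed (use t in auto)
      qed
    qed
    have dd: "real (d div q) \<le> real d / q" by (rule of_nat_div_le_of_nat)
    have D: "card {y. (v, y) \<in> W} \<le> card ?D"
    proof (rule surj_card_le[where f = "\<lambda>t. THE y. (v, y) \<in> M t"])
      show "{y. (v, y) \<in> W} \<subseteq> (\<lambda>t. THE y. (v, y) \<in> M t) ` ?D"
      proof
        fix y assume "y \<in> {y. (v, y) \<in> W}"
        then obtain t where t: "t < d" "(v, y) \<in> M t" using M(1) by auto
        then have "(THE y. (v, y) \<in> M t) = y" using M(3)[OF t(1)] by (auto simp: single_valued_def)
        then show "y \<in> (\<lambda>t. THE y. (v, y) \<in> M t) ` ?D" using t by (auto simp: image_iff)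
      qed
    qed simp
    have R: "card {u. (u, v) \<in> W} \<le> card ?R"
    proof (rule surj_card_le[where f = "\<lambda>t. THE u. (u, v) \<in> M t"])
      show "{u. (u, v) \<in> W} \<subseteq> (\<lambda>t. THE u. (u, v) \<in> M t) ` ?R"
      proof
        fix y assume "y \<in> {u. (u, v) \<in> W}"
        then obtain t where t: "t < d" "(y, v) \<in> M t" using M(1) by auto
        then have "(THE u. (u, v) \<in> M t) = y" using M(4)[OF t(1)] by (auto simp: single_valued_def)
        then show "y \<in> (\<lambda>t. THE u. (u, v) \<in> M t) ` ?R" using t by (auto simp: image_iff)
      qed
    qed simp
    have "real d \<le> card ?D + x" using deg'[OF v, of "(g v + c) mod q"] D q0 row[OF v] by simp
    moreover have "card ({..<d} - ?D) = d - card ?D" by (subst card_Diff_subset) auto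
    moreover have "card ?D \<le> card {..<d}" by (intro card_mono) auto
    ultimately have 1: "real (card ({..<d} - ?D)) \<le> x" by simp
    have "real d \<le> card ?R + x" using deg'[OF v, of ?i] R q0 col[OF v] by simp
    moreover have "card ({..<d} - ?R) = d - card ?R" by (subst card_Diff_subset) auto
    moreover have "card ?R \<le> card {..<d}" by (intro card_mono) auto
    ultimately have 2: "real (card ({..<d} - ?R)) \<le> x" by simp
    have "card {t. t < d \<and> v \<in> ends (ps t)} \<le> card (({..<d} - ?D) \<union> ({..<d} - ?R) \<union> (?A \<union> ?C))"
      by (rule card_mono[OF _ sub]) auto
    also have "\<dots> \<le> card ({..<d} - ?D) + card ({..<d} - ?R) + (card ?A + card ?C)"
      by (intro order.trans[OF card_Un_le] add_mono card_Un_le)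
    also have "\<dots> \<le> card ({..<d} - ?D) + card ({..<d} - ?R) + ((d div q + 1) + (d div q + 1))"
      using card_residue_class_le[OF q0] by (intro add_mono order.refl)
    finally have "real (card {t. t < d \<and> v \<in> ends (ps t)}) \<le>
      real (card ({..<d} - ?D) + card ({..<d} - ?R) + ((d div q + 1) + (d div q + 1)))"
      by (simp only: of_nat_le_iff)
    then show ?thesis using 1 2 dd by simp
  qed
  ultimately show ?thesis
  proof (intro exI[of _ ps] exI[of _ F] conjI)
    show "\<forall>t<d. path_cover B (F t) (ps t)" using cov by simp
    show "\<forall>t<d. \<forall>(x, y)\<in>F t. {x, y} \<in> E \<and> x \<in> B \<and> y \<in> B \<and> g y = (g x + c) mod q"
      using Fprop by blast
  qed (use dF in auto)
qed

text \<open>The shifts by \<open>c\<close> and by \<open>q - c\<close> give the same unordered pairs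
  of clusters, so \<open>c\<close> stops at \<open>(q - 1) div 2\<close>. An edge found under two
  shifts with opposite orientations would give \<open>c + c' = 0\<close> modulo \<open>q\<close>,
  impossible as \<open>c + c' < q\<close>. Thus an edge determines its shift and orientation, and
  the systems are edge-disjoint.\<close>

lemma path_systems:
  fixes q d :: nat and x y :: real and g :: "'a \<Rightarrow> nat"
  assumes fB: "finite B" and q: "prime q" and g: "\<And>v. v \<in> B \<Longrightarrow> g v < q"
    and deg: "\<And>v i. v \<in> B \<Longrightarrow> i < q \<Longrightarrow> card {u \<in> nbrs E B v. g u = i} \<le> d"
    and deg': "\<And>v i. v \<in> B \<Longrightarrow> i < q \<Longrightarrow> real d \<le> card {u \<in> nbrs E B v. g u = i} + x"
    and cl: "\<And>i. i < q \<Longrightarrow> card {u \<in> B. g u = i} \<le> y"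
  defines "h \<equiv> (q - 1) div 2"
  obtains ps :: "nat \<times> nat \<Rightarrow> 'a list list" where
    "\<And>i. i \<in> {1..h} \<times> {..<d} \<Longrightarrow> distinct (concat (ps i)) \<and> set (concat (ps i)) = B \<and>
       [] \<notin> set (ps i) \<and> system_edges (ps i) \<subseteq> E"
    "disjoint_family_on (\<lambda>i. system_edges (ps i)) ({1..h} \<times> {..<d})"
    "(\<Sum>i\<in>{1..h} \<times> {..<d}. real (length (ps i))) \<le> h * (card B * x + d * y)"
    "\<And>v. v \<in> B \<Longrightarrow> card {i \<in> {1..h} \<times> {..<d}. v \<in> ends (ps i)} \<le> h * (2 * (x + d / q + 1))"
proof -
  define P where "P c ps F \<longleftrightarrow>
    (\<forall>t<d. path_cover B (F t) (ps t)) \<and>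
    (\<forall>t<d. \<forall>(x, y)\<in>F t. {x, y} \<in> E \<and> x \<in> B \<and> y \<in> B \<and> g y = (g x + c) mod q) \<and>
    disjoint_family_on F {..<d} \<and>
    (\<Sum>t<d. real (length (ps t))) \<le> card B * x + d * y \<and>
    (\<forall>v\<in>B. card {t. t < d \<and> v \<in> ends (ps t)} \<le> 2 * (x + d / q + 1))"
    for c and ps :: "nat \<Rightarrow> 'a list list" and F
  have cq: "0 < c \<and> c < q" if "c \<in> {1..h}" for c
    using that prime_gt_1_nat[OF q] by (auto simp: h_def)
  have "\<forall>c\<in>{1..h}. \<exists>ps F. P c ps F"
    unfolding P_def using cq by (intro ballI shift_path_systems fB q g deg deg' cl) auto
  then obtain ps F where P: "\<And>c. c \<in> {1..h} \<Longrightarrow> P c (ps c) (F c)" by metis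
  have P1: "distinct (concat (ps c t))" "set (concat (ps c t)) = B" "[] \<notin> set (ps c t)"
    "system_edges (ps c t) = (\<lambda>(x, y). {x, y}) ` F c t" if "c \<in> {1..h}" "t < d" for c t
    using P[OF that(1)] that(2) by (simp_all add: P_def path_cover_def)
  have P2: "{x, y} \<in> E" "g x < q" "g y < q" "g y = (g x + c) mod q"
    if "c \<in> {1..h}" "t < d" "(x, y) \<in> F c t" for c t x y
  proof -
    have *: "{x, y} \<in> E \<and> x \<in> B \<and> y \<in> B \<and> g y = (g x + c) mod q"
      using P[OF that(1)] that(2,3) unfolding P_def by blast
    then show "{x, y} \<in> E" "g x < q" "g y < q" "g y = (g x + c) mod q" using g[of x] g[of y] by blast+
  qed
  define qs where "qs = (\<lambda>(c, t). ps c t)"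
  have "distinct (concat (qs i)) \<and> set (concat (qs i)) = B \<and>
       [] \<notin> set (qs i) \<and> system_edges (qs i) \<subseteq> E" if "i \<in> {1..h} \<times> {..<d}" for i
  proof -
    obtain c t where "i = (c, t)" by (cases i)
    with that have i: "i = (c, t)" "c \<in> {1..h}" "t < d" by auto
    have "system_edges (ps c t) \<subseteq> E" using P1(4)[OF i(2,3)] P2(1)[OF i(2,3)] by auto
    then show ?thesis using P1[OF i(2,3)] i(1) by (simp add: qs_def)
  qed
  moreover have "disjoint_family_on (\<lambda>i. system_edges (qs i)) ({1..h} \<times> {..<d})"
    unfolding disjoint_family_on_def
  proof (intro ballI impI, rule ccontr)
    fix i j assume ij: "i \<in> {1..h} \<times> {..<d}" "j \<in> {1..h} \<times> {..<d}" "i \<noteq> j"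
      and ne: "system_edges (qs i) \<inter> system_edges (qs j) \<noteq> {}"
    obtain c t c' t' where "i = (c, t)" "j = (c', t')" by (metis surj_pair)
    with ij(1,2) have i: "i = (c, t)" "c \<in> {1..h}" "t < d" and j: "j = (c', t')" "c' \<in> {1..h}" "t' < d"
      by auto
    obtain x y x' y' where e: "(x, y) \<in> F c t" "(x', y') \<in> F c' t'" "{x, y} = {x', y'}"
      using ne i j by (auto simp: qs_def P1(4))
    note c = P2[OF i(2,3) e(1)] and c' = P2[OF j(2,3) e(2)]
    show False
    proof (cases "x = x'")
      case True
      then have "y = y'" using e(3) by (auto simp: doubleton_eq_iff)
      then have "[g x + c = g x + c'] (mod q)" using c c' True by (simp add: cong_def)
      then have "[c = c'] (mod q)" by (simp add: cong_add_lcancel_nat)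
      then have "c = c'" using cq[OF i(2)] cq[OF j(2)] by (simp add: cong_def)
      moreover have "disjoint_family_on (F c) {..<d}" using P[OF i(2)] by (simp add: P_def)
      ultimately have "t = t'" using e i j True \<open>y = y'\<close> unfolding disjoint_family_on_def by blast
      then show False using \<open>c = c'\<close> i j ij by simp
    next
      case False
      then have xy: "x = y'" "y = x'" using e(3) by (auto simp: doubleton_eq_iff)
      then have "g x = ((g x + c) mod q + c') mod q" using c c' by simp
      then have "[g x + (c + c') = g x + 0] (mod q)" using c(2)
        by (simp add: cong_def mod_add_left_eq add.assoc)
      then have "[c + c' = 0] (mod q)" by (rule cong_add_lcancel_nat[THEN iffD1])
      moreover have "c + c' < q" using i(2) j(2) prime_gt_1_nat[OF q] by (auto simp: h_def)
      ultimately show False using cq[OF i(2)] by (simp add: cong_def)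
    qed
  qed
  moreover have "(\<Sum>i\<in>{1..h} \<times> {..<d}. real (length (qs i))) \<le> h * (card B * x + d * y)"
  proof -
    have "(\<Sum>i\<in>{1..h} \<times> {..<d}. real (length (qs i))) = (\<Sum>c\<in>{1..h}. \<Sum>t<d. real (length (ps c t)))"
      by (simp add: sum.cartesian_product qs_def case_prod_unfold)
    also have "\<dots> \<le> (\<Sum>c\<in>{1..h}. card B * x + d * y)"
      using P by (intro sum_mono) (simp add: P_def)
    finally show ?thesis by simp
  qed
  moreover have "card {i \<in> {1..h} \<times> {..<d}. v \<in> ends (qs i)} \<le> h * (2 * (x + d / q + 1))" if "v \<in> B" for v
  proof -
    have "{i \<in> {1..h} \<times> {..<d}. v \<in> ends (qs i)} = (SIGMA c:{1..h}. {t. t < d \<and> v \<in> ends (ps c t)})"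
      by (auto simp: qs_def)
    then have "real (card {i \<in> {1..h} \<times> {..<d}. v \<in> ends (qs i)}) =
      (\<Sum>c\<in>{1..h}. real (card {t. t < d \<and> v \<in> ends (ps c t)}))" by simp
    also have "\<dots> \<le> (\<Sum>c\<in>{1..h}. 2 * (x + d / q + 1))"
      using P that by (intro sum_mono) (simp add: P_def)
    finally show ?thesis by simp
  qed
  ultimately show ?thesis using that[of qs] by blast
qed

section \<open>Closing many path systems with the same set A\<close>

lemma joins_sub: "e \<in> joins E X A \<Longrightarrow> e \<inter> A \<noteq> {}"
  by (auto simp: joins_def)

lemma system_edges_sub: "e \<in> system_edges ps \<Longrightarrow> e \<subseteq> set (concat ps)"
  by (auto simp: system_edges_def dest: path_edges_vertices)

text \<open>The systems are closed one after another, avoiding the edges already used. A vertex of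
  \<open>B\<close> loses link edges, two at a time, only to systems in which it is an end; a vertex
  of \<open>A\<close> loses two edges to every cycle, which becomes \<open>4 * N\<close> in the
  doubled degree condition.\<close>

lemma close_path_family:
  fixes ps :: "nat \<Rightarrow> 'a list list"
  assumes fA: "finite A" and AB: "A \<inter> B = {}" and Bne: "B \<noteq> {}"
    and ps: "\<And>i. i < N \<Longrightarrow> distinct (concat (ps i)) \<and> set (concat (ps i)) = B \<and> [] \<notin> set (ps i) \<and> length (ps i) \<le> t"
    and dj: "disjoint_family_on (\<lambda>i. system_edges (ps i)) {..<N}"
    and N1: "\<And>v. v \<in> B \<Longrightarrow> 3 * t + 2 + 2 * card {i. i < N \<and> v \<in> ends (ps i)} \<le> card (nbrs E1 A v)"
    and N2: "\<And>a. a \<in> A \<Longrightarrow> card A + 6 * t + 10 + 4 * N \<le> 2 * card (nbrs E2 A a)"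
  shows "\<exists>xs. (\<forall>i<N. distinct (xs i) \<and> set (xs i) = A \<union> B \<and>
      cycle_edges (xs i) \<subseteq> system_edges (ps i) \<union> joins E1 (ends (ps i)) A \<union> joins E2 A A) \<and>
    disjoint_family_on (\<lambda>i. cycle_edges (xs i)) {..<N}"
  using ps dj N1 N2
proof (induction N)
  case 0
  then show ?case by (simp add: disjoint_family_on_def)
next
  case (Suc N)
  have ps': "distinct (concat (ps i)) \<and> set (concat (ps i)) = B \<and> [] \<notin> set (ps i) \<and> length (ps i) \<le> t"
    if "i < N" for i using Suc.prems(1)[of i] that by simp
  have dj': "disjoint_family_on (\<lambda>i. system_edges (ps i)) {..<N}"
    using Suc.prems(2) by (rule disjoint_family_on_mono[rotated]) auto
  have N1': "3 * t + 2 + 2 * card {i. i < N \<and> v \<in> ends (ps i)} \<le> card (nbrs E1 A v)" if "v \<in> B" for v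
  proof -
    have "card {i. i < N \<and> v \<in> ends (ps i)} \<le> card {i. i < Suc N \<and> v \<in> ends (ps i)}"
      by (intro card_mono) auto
    then show ?thesis using Suc.prems(3)[OF that] by linarith
  qed
  have N2': "card A + 6 * t + 10 + 4 * N \<le> 2 * card (nbrs E2 A a)" if "a \<in> A" for a
    using Suc.prems(4)[OF that] by simp
  obtain xs where xs: "\<And>i. i < N \<Longrightarrow> distinct (xs i)" "\<And>i. i < N \<Longrightarrow> set (xs i) = A \<union> B"
      "\<And>i. i < N \<Longrightarrow> cycle_edges (xs i) \<subseteq> system_edges (ps i) \<union> joins E1 (ends (ps i)) A \<union> joins E2 A A"
      and dxs: "disjoint_family_on (\<lambda>i. cycle_edges (xs i)) {..<N}"
    using Suc.IH[OF ps' dj' N1' N2'] by blast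
  have xne: "xs i \<noteq> []" if "i < N" for i using xs(2)[OF that] Bne by auto
  define U where "U = (\<Union>j<N. cycle_edges (xs j))"
  note psN = Suc.prems(1)[of N, simplified]
  then have lN: "length (ps N) \<le> t" by blast
  have endsB: "ends (ps i) \<subseteq> B" if "i < Suc N" for i using ends_sub[of "ps i"] Suc.prems(1)[OF that] by auto
  have pB: "e \<subseteq> B" if "e \<in> system_edges (ps i)" "i < Suc N" for e i
    using system_edges_sub[OF that(1)] Suc.prems(1)[OF that(2)] by auto
  have "\<exists>zs. distinct zs \<and> set zs = set (concat (ps N)) \<union> A \<and> zs \<noteq> [] \<and>
    cycle_edges zs \<subseteq> system_edges (ps N) \<union> joins (E1 - U) (ends (ps N)) A \<union> joins (E2 - U) A A"
  proof (rule close_paths[OF fA])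
    show "ps N \<noteq> []" using psN Bne by auto
    show "distinct (concat (ps N))" "[] \<notin> set (ps N)" "set (concat (ps N)) \<inter> A = {}"
      using psN AB by auto
    fix v assume v: "v \<in> ends (ps N)"
    then have vB: "v \<in> B" using endsB by auto
    let ?J = "{j. j < N \<and> v \<in> ends (ps j)}"
    have "nbrs E1 A v \<subseteq> nbrs (E1 - U) A v \<union> (\<Union>j\<in>?J. nbrs (cycle_edges (xs j)) A v)"
    proof
      fix a assume a: "a \<in> nbrs E1 A v"
      show "a \<in> nbrs (E1 - U) A v \<union> (\<Union>j\<in>?J. nbrs (cycle_edges (xs j)) A v)"
      proof (cases "{v, a} \<in> U")
        case True
        then obtain j where j: "j < N" "{v, a} \<in> cycle_edges (xs j)" by (auto simp: U_def)
        have "a \<in> A" "a \<noteq> v" using a by (auto simp: nbrs_def)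
        then have "{v, a} \<notin> system_edges (ps j)" using pB[of "{v, a}" j] j AB by auto
        \<comment> \<open>A used edge between \<open>v\<close> and \<open>A\<close> can only be a
          link edge of an earlier cycle, and those start at ends of the corresponding
          system.\<close>
        moreover have "{v, a} \<notin> joins E2 A A" using vB AB by (auto simp: joins_def doubleton_eq_iff)
        ultimately have "{v, a} \<in> joins E1 (ends (ps j)) A" using xs(3)[OF j(1)] j(2) by blast
        then have "v \<in> ends (ps j)" using endsB[of j] j vB AB by (auto simp: joins_def doubleton_eq_iff)
        then show ?thesis using j a by (auto simp: nbrs_def)
      qed (use a in \<open>auto simp: nbrs_def\<close>)
    qed
    then have "card (nbrs E1 A v) \<le> card (nbrs (E1 - U) A v) + 2 * card ?J"
      using fA xs(1) xne by (intro card_nbrs_remove_cycles) auto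
    moreover have "card ?J \<le> card {i. i < Suc N \<and> v \<in> ends (ps i)}" by (intro card_mono) auto
    ultimately show "3 * length (ps N) + 2 \<le> card (nbrs (E1 - U) A v)"
      using Suc.prems(3)[OF vB] lN by linarith
  next
    fix a assume a: "a \<in> A"
    have "nbrs E2 A a \<subseteq> nbrs (E2 - U) A a \<union> (\<Union>j<N. nbrs (cycle_edges (xs j)) A a)"
      by (auto simp: nbrs_def U_def)
    then have "card (nbrs E2 A a) \<le> card (nbrs (E2 - U) A a) + 2 * card {..<N}"
      using fA xs(1) xne by (intro card_nbrs_remove_cycles) auto
    moreover have "card A + 6 * t + 10 + 4 * N + 4 \<le> 2 * card (nbrs E2 A a)"
      using Suc.prems(4)[OF a] by simp
    ultimately show "card A + 6 * length (ps N) + 10 \<le> 2 * card (nbrs (E2 - U) A a)"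
      using lN by simp
  qed
  then obtain zs where zs: "distinct zs" "set zs = A \<union> B"
    "cycle_edges zs \<subseteq> system_edges (ps N) \<union> joins (E1 - U) (ends (ps N)) A \<union> joins (E2 - U) A A"
    using psN by auto
  have jU: "joins (E - U) X A \<inter> U = {}" for E X by (auto simp: joins_def)
  have jm: "joins (E - U) X A \<subseteq> joins E X A" for E X by (auto simp: joins_def)
  have new: "cycle_edges zs \<inter> cycle_edges (xs j) = {}" if j: "j < N" for j
  proof -
    have "system_edges (ps N) \<inter> system_edges (ps j) = {}"
      using Suc.prems(2) j by (auto simp: disjoint_family_on_def)
    moreover have "e \<notin> joins E X A" if "e \<in> system_edges (ps N)" for e E X
      using pB[OF that] joins_sub[of e E X A] AB by blast
    ultimately have "system_edges (ps N) \<inter> cycle_edges (xs j) = {}" using xs(3)[OF j] by blast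
    moreover have "cycle_edges (xs j) \<subseteq> U" using j by (auto simp: U_def)
    ultimately show ?thesis using zs(3) jU by blast
  qed
  let ?xs = "xs(N := zs)"
  show ?case
  proof (intro exI[of _ ?xs] conjI allI impI)
    fix i assume "i < Suc N"
    then consider "i = N" | "i < N" by linarith
    then show "distinct (?xs i)" "set (?xs i) = A \<union> B"
      "cycle_edges (?xs i) \<subseteq> system_edges (ps i) \<union> joins E1 (ends (ps i)) A \<union> joins E2 A A"
    proof (atomize (full), cases)
      case 1
      then show "distinct (?xs i) \<and> set (?xs i) = A \<union> B \<and>
        cycle_edges (?xs i) \<subseteq> system_edges (ps i) \<union> joins E1 (ends (ps i)) A \<union> joins E2 A A"
        using zs jm[of E1 "ends (ps N)"] jm[of E2 A] by (simp, blast)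
    next
      case 2
      then show "distinct (?xs i) \<and> set (?xs i) = A \<union> B \<and>
        cycle_edges (?xs i) \<subseteq> system_edges (ps i) \<union> joins E1 (ends (ps i)) A \<union> joins E2 A A"
        using xs by simp
    qed
  next
    show "disjoint_family_on (\<lambda>i. cycle_edges (?xs i)) {..<Suc N}"
      using new dxs by (intro disjoint_family_on_lessThan_Suc) (auto simp: disjoint_family_on_def)
  qed
qed

lemma system_edges_joins:
  assumes "distinct (concat ps)" "system_edges ps \<subseteq> E"
  shows "system_edges ps \<subseteq> joins E (set (concat ps)) (set (concat ps))"
proof
  fix e assume e: "e \<in> system_edges ps"
  then obtain p where p: "p \<in> set ps" "e \<in> path_edges p" by (auto simp: system_edges_def)
  have "distinct p" using assms(1) p(1) by (auto simp: distinct_concat_iff)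
  then have "card e = 2" using path_edges_card p by blast
  then obtain x y where "e = {x, y}" "x \<noteq> y" by (meson card_2_iff)
  then show "e \<in> joins E (set (concat ps)) (set (concat ps))"
    using system_edges_sub[OF e] e assms(2) unfolding joins_def by blast
qed

text \<open>Markov's inequality; it bounds how many path systems are discarded for having more than
  \<open>t\<close> paths.\<close>

lemma few_exceed_average:
  fixes f :: "'b \<Rightarrow> real"
  assumes "finite T" "\<And>i. i \<in> T \<Longrightarrow> 0 \<le> f i" "(\<Sum>i\<in>T. f i) \<le> s" "0 < t"
  shows "card T - s / t \<le> card {i \<in> T. f i \<le> t}"
proof -
  let ?G = "{i \<in> T. f i \<le> t}" and ?B = "{i \<in> T. \<not> f i \<le> t}"
  have "card ?B * t = (\<Sum>i\<in>?B. t)" by simp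
  also have "\<dots> \<le> (\<Sum>i\<in>?B. f i)" by (intro sum_mono) auto
  also have "\<dots> \<le> (\<Sum>i\<in>T. f i)" using assms by (intro sum_mono2) auto
  finally have "card ?B \<le> s / t" using assms(3,4) by (simp add: field_simps)
  moreover have "card T = card ?G + card ?B"
  proof -
    have "T = ?G \<union> ?B" by auto
    then show ?thesis using assms(1) card_Un_disjoint[of ?G ?B] by auto
  qed
  ultimately show ?thesis by simp
qed

text \<open>The systems have few paths only on average. Those with more than \<open>t\<close> paths
  are discarded and \<open>N\<close> of the others are closed; the bound on how often a vertex is an
  end is inherited by the subfamily.\<close>

lemma hamilton_family_in_class:
  fixes q d N t :: nat and x y :: real and g :: "'a \<Rightarrow> nat"
  defines "h \<equiv> (q - 1) div 2"
  assumes fA: "finite A" and fB: "finite B" and AB: "A \<inter> B = {}" and Bne: "B \<noteq> {}"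
    and q: "prime q" and g: "\<And>v. v \<in> B \<Longrightarrow> g v < q"
    and deg: "\<And>v i. v \<in> B \<Longrightarrow> i < q \<Longrightarrow> card {u \<in> nbrs E B v. g u = i} \<le> d"
    and deg': "\<And>v i. v \<in> B \<Longrightarrow> i < q \<Longrightarrow> real d \<le> card {u \<in> nbrs E B v. g u = i} + x"
    and cl: "\<And>i. i < q \<Longrightarrow> card {u \<in> B. g u = i} \<le> y"
    and t: "0 < t" and N: "N \<le> h * d - h * (card B * x + d * y) / t"
    and N1: "\<And>v. v \<in> B \<Longrightarrow> 3 * t + 2 + 2 * (h * (2 * (x + d / q + 1))) \<le> card (nbrs E1 A v)"
    and N2: "\<And>a. a \<in> A \<Longrightarrow> card A + 6 * t + 10 + 4 * N \<le> 2 * card (nbrs E2 A a)"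
  shows "\<exists>xs. (\<forall>i<N. distinct (xs i) \<and> set (xs i) = A \<union> B \<and>
      cycle_edges (xs i) \<subseteq> joins E B B \<union> joins E1 B A \<union> joins E2 A A) \<and>
    disjoint_family_on (\<lambda>i. cycle_edges (xs i)) {..<N}"
proof -
  let ?T = "{1..h} \<times> {..<d}"
  obtain ps :: "nat \<times> nat \<Rightarrow> 'a list list" where
    ps: "\<And>i. i \<in> ?T \<Longrightarrow> distinct (concat (ps i)) \<and> set (concat (ps i)) = B \<and>
       [] \<notin> set (ps i) \<and> system_edges (ps i) \<subseteq> E"
    and dj: "disjoint_family_on (\<lambda>i. system_edges (ps i)) ?T"
    and sum: "(\<Sum>i\<in>?T. real (length (ps i))) \<le> h * (card B * x + d * y)"
    and en: "\<And>v. v \<in> B \<Longrightarrow> card {i \<in> ?T. v \<in> ends (ps i)} \<le> h * (2 * (x + d / q + 1))"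
    using path_systems[OF fB q g deg deg' cl, folded h_def] by blast
  define T' where "T' = {i \<in> ?T. real (length (ps i)) \<le> real t}"
  have "card ?T - h * (card B * x + d * y) / t \<le> card T'"
    unfolding T'_def using t sum by (intro few_exceed_average) auto
  then have "real N \<le> card T'" using N by simp
  then have "N \<le> card T'" by simp
  then obtain T'' where T'': "T'' \<subseteq> T'" "card T'' = N" "finite T''" using obtain_subset_with_card_n by metis
  then obtain f where f: "bij_betw f {0..<N} T''" using ex_bij_betw_nat_finite by metis
  have fT: "f i \<in> ?T" "length (ps (f i)) \<le> t" if "i < N" for i
  proof -
    have "f i \<in> T'" using f that T''(1) by (auto simp: bij_betw_def)
    then show "f i \<in> ?T" "length (ps (f i)) \<le> t" by (auto simp: T'_def)
  qed
  have inj: "inj_on f {..<N}" using f by (simp add: bij_betw_def lessThan_atLeast0)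
  have "\<exists>xs. (\<forall>i<N. distinct (xs i) \<and> set (xs i) = A \<union> B \<and>
      cycle_edges (xs i) \<subseteq> system_edges (ps (f i)) \<union> joins E1 (ends (ps (f i))) A \<union> joins E2 A A) \<and>
    disjoint_family_on (\<lambda>i. cycle_edges (xs i)) {..<N}"
  proof (rule close_path_family[OF fA AB Bne])
    show "distinct (concat (ps (f i))) \<and> set (concat (ps (f i))) = B \<and> [] \<notin> set (ps (f i)) \<and> length (ps (f i)) \<le> t"
      if "i < N" for i using ps[OF fT(1)[OF that]] fT(2)[OF that] by blast
    show "disjoint_family_on (\<lambda>i. system_edges (ps (f i))) {..<N}"
      unfolding disjoint_family_on_def
    proof (intro ballI impI)
      fix i j assume ij: "i \<in> {..<N}" "j \<in> {..<N}" "i \<noteq> j"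
      then have "f i \<noteq> f j" using inj by (simp add: inj_on_eq_iff)
      then show "system_edges (ps (f i)) \<inter> system_edges (ps (f j)) = {}"
        using dj fT(1)[of i] fT(1)[of j] ij by (meson disjoint_family_onD lessThan_iff)
    qed
    fix v assume v: "v \<in> B"
    have "card {i. i < N \<and> v \<in> ends (ps (f i))} \<le> card {i \<in> ?T. v \<in> ends (ps i)}"
    proof (rule card_inj_on_le[of f])
      show "inj_on f {i. i < N \<and> v \<in> ends (ps (f i))}" using inj by (rule inj_on_subset) auto
      show "f ` {i. i < N \<and> v \<in> ends (ps (f i))} \<subseteq> {i \<in> ?T. v \<in> ends (ps i)}"
        using fT(1) by blast
    qed simp
    then have "real (card {i. i < N \<and> v \<in> ends (ps (f i))}) \<le> h * (2 * (x + d / q + 1))"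
      using en[OF v] by linarith
    then show "3 * t + 2 + 2 * card {i. i < N \<and> v \<in> ends (ps (f i))} \<le> card (nbrs E1 A v)"
      using N1[OF v] by linarith
  qed (use N2 in auto)
  then obtain xs where xs: "\<And>i. i < N \<Longrightarrow> distinct (xs i)" "\<And>i. i < N \<Longrightarrow> set (xs i) = A \<union> B"
      "\<And>i. i < N \<Longrightarrow> cycle_edges (xs i) \<subseteq> system_edges (ps (f i)) \<union> joins E1 (ends (ps (f i))) A \<union> joins E2 A A"
      and dxs: "disjoint_family_on (\<lambda>i. cycle_edges (xs i)) {..<N}" by blast
  have "cycle_edges (xs i) \<subseteq> joins E B B \<union> joins E1 B A \<union> joins E2 A A" if i: "i < N" for i
  proof -
    note p = ps[OF fT(1)[OF i]]
    then have "system_edges (ps (f i)) \<subseteq> joins E B B" using system_edges_joins[of "ps (f i)" E] by simp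
    moreover have "joins E1 (ends (ps (f i))) A \<subseteq> joins E1 B A"
      using p ends_sub[of "ps (f i)"] by (intro joins_mono) auto
    ultimately show ?thesis using xs(3)[OF i] by blast
  qed
  then show ?thesis using xs(1,2) dxs by blast
qed

section \<open>Balanced colourings\<close>

lemma exp_le_quadratic:
  fixes x :: real
  assumes "\<bar>x\<bar> \<le> 1"
  shows "exp x \<le> 1 + x + x\<^sup>2"
proof (cases "0 \<le> x")
  case False
  have "exp x * (1 - x) \<le> exp x * exp (- x)"
    using exp_ge_add_one_self[of "- x"] by (intro mult_left_mono) auto
  also have "\<dots> = 1" by (simp add: exp_minus)
  also have "1 \<le> (1 + x + x\<^sup>2) * (1 - x)"
  proof -
    have "x * (x * x) \<le> 0" using False by (intro mult_nonpos_nonneg) auto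
    then show ?thesis by (simp add: algebra_simps power2_eq_square)
  qed
  finally show ?thesis using False by (simp add: mult_le_cancel_right)
qed (use exp_bound[of x] assms in simp)

text \<open>The moment generating function of a binomial variable, scaled by the number of
  colourings: the sum over all colourings factorises over \<open>X\<close>, and every factor is
  bounded with \<open>exp_le_quadratic\<close>.\<close>

lemma exp_moment_colouring:
  fixes l :: real
  assumes "finite X" "finite C" "S \<subseteq> X" "c \<in> C" "\<bar>l\<bar> \<le> 1"
  shows "(\<Sum>f\<in>X \<rightarrow>\<^sub>E C. exp (l * card {x \<in> S. f x = c})) \<le>
    card C ^ card X * exp (card S / card C * (l + l\<^sup>2))"
proof -
  have C0: "0 < card C" using assms card_gt_0_iff by blast
  have e: "exp (l * card {x \<in> S. f x = c}) = (\<Prod>x\<in>X. if x \<in> S \<and> f x = c then exp l else 1)" for f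
  proof -
    have "(\<Prod>x\<in>X. if x \<in> S \<and> f x = c then exp l else 1) = (\<Prod>x\<in>{x \<in> X. x \<in> S \<and> f x = c}. exp l)"
      by (rule prod.inter_filter[OF assms(1), symmetric])
    also have "{x \<in> X. x \<in> S \<and> f x = c} = {x \<in> S. f x = c}" using assms(3) by auto
    finally show ?thesis using exp_of_nat_mult[of "card {x \<in> S. f x = c}" l] by (simp add: mult.commute)
  qed
  have "(\<Sum>f\<in>X \<rightarrow>\<^sub>E C. exp (l * card {x \<in> S. f x = c})) =
    (\<Prod>x\<in>X. \<Sum>y\<in>C. if x \<in> S \<and> y = c then exp l else 1)"
    unfolding e using assms by (subst prod_sum_PiE) auto
  also have "\<dots> \<le> (\<Prod>x\<in>X. card C * (if x \<in> S then exp ((l + l\<^sup>2) / card C) else 1))"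
  proof (rule prod_mono, rule conjI)
    fix x
    show "0 \<le> (\<Sum>y\<in>C. if x \<in> S \<and> y = c then exp l else 1)" by (intro sum_nonneg) auto
    show "(\<Sum>y\<in>C. if x \<in> S \<and> y = c then exp l else 1) \<le>
      card C * (if x \<in> S then exp ((l + l\<^sup>2) / card C) else 1)"
    proof (cases "x \<in> S")
      case True
      have "(\<Sum>y\<in>C. if x \<in> S \<and> y = c then exp l else 1) = (\<Sum>y\<in>C. 1 + (if y = c then exp l - 1 else 0))"
        using True by (intro sum.cong) auto
      also have "\<dots> = card C + (exp l - 1)"
        using assms(2,4) by (simp add: sum.distrib)
      also have "\<dots> \<le> card C * (1 + (l + l\<^sup>2) / card C)"
      proof -
        have "card C * (1 + (l + l\<^sup>2) / card C) = card C + (l + l\<^sup>2)"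
          using C0 by (simp add: field_simps)
        then show ?thesis using exp_le_quadratic[OF assms(5)] by linarith
      qed
      also have "\<dots> \<le> card C * exp ((l + l\<^sup>2) / card C)"
        by (intro mult_left_mono exp_ge_add_one_self) simp
      finally show ?thesis using True by simp
    qed simp
  qed
  also have "\<dots> = card C ^ card X * (\<Prod>x\<in>X. if x \<in> S then exp ((l + l\<^sup>2) / card C) else 1)"
    by (simp add: prod.distrib)
  also have "(\<Prod>x\<in>X. if x \<in> S then exp ((l + l\<^sup>2) / card C) else 1) = (\<Prod>x\<in>X \<inter> S. exp ((l + l\<^sup>2) / card C))"
    by (rule prod.inter_restrict[OF assms(1), symmetric])
  also have "X \<inter> S = S" using assms(3) by auto
  also have "(\<Prod>x\<in>S. exp ((l + l\<^sup>2) / card C)) = exp ((l + l\<^sup>2) / card C) ^ card S" by simp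
  also have "\<dots> = exp (card S / card C * (l + l\<^sup>2))" by (simp add: exp_of_nat_mult[symmetric] mult.commute)
  finally show ?thesis .
qed

text \<open>A uniformly random colouring, with the union bound over Chernoff tails.\<close>

lemma balanced_colouring:
  fixes \<eta> :: real and n :: nat
  assumes "finite X" "finite C" "C \<noteq> {}" "finite \<F>" "\<And>S. S \<in> \<F> \<Longrightarrow> S \<subseteq> X" "\<And>S. S \<in> \<F> \<Longrightarrow> card S \<le> n"
    and \<eta>: "0 < \<eta>" "\<eta> \<le> 1"
    and small: "2 * card \<F> * card C * exp (- (n * \<eta>\<^sup>2 / 4)) < 1"
  shows "\<exists>f. (\<forall>x\<in>X. f x \<in> C) \<and>
    (\<forall>S\<in>\<F>. \<forall>c\<in>C. \<bar>card {x \<in> S. f x = c} - card S / card C\<bar> \<le> \<eta> * n)"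
proof -
  let ?\<Omega> = "X \<rightarrow>\<^sub>E C"
  define dev where "dev S c f = real (card {x \<in> S. f x = c}) - card S / card C" for S c and f :: "'a \<Rightarrow> 'b"
  define bad where "bad = (\<lambda>(S, c, \<sigma>). {f \<in> ?\<Omega>. \<eta> * n < \<sigma> * dev S c f})"
  define I where "I = \<F> \<times> C \<times> {1, -1 :: real}"
  define W :: real where "W = card C ^ card X"
  have W: "0 < W" unfolding W_def using assms by (simp add: card_gt_0_iff)
  have fO: "finite ?\<Omega>" using assms by (intro finite_PiE) auto
  have cO: "real (card ?\<Omega>) = W" unfolding W_def using assms by (simp add: card_PiE)
  have one: "card (bad i) \<le> W * exp (- (n * \<eta>\<^sup>2 / 4))" if "i \<in> I" for i
  proof -
    obtain S c \<sigma> where "i = (S, c, \<sigma>)" by (metis surj_pair)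
    with that have i: "i = (S, c, \<sigma>)" "S \<in> \<F>" "c \<in> C" "\<sigma> = 1 \<or> \<sigma> = -1"
      by (auto simp: I_def)
    \<comment> \<open>The sign \<sigma> selects the upper or the lower tail. The modulus \<eta> / 2
      maximises \<open>l * \<eta> - l\<^sup>2\<close>, the exponent gained per element, and is at
      most 1 as the moment bound requires.\<close>
    define l where "l = \<sigma> * \<eta> / 2"
    have l: "\<bar>l\<bar> \<le> 1" "l\<^sup>2 = \<eta>\<^sup>2 / 4" using i(4) \<eta> by (auto simp: l_def power2_eq_square)
    let ?t = "\<eta>\<^sup>2 / 2 * n + l * (card S / card C)"
    have "card (bad i) * exp ?t = (\<Sum>f\<in>bad i. exp ?t)" by simp
    also have "\<dots> \<le> (\<Sum>f\<in>bad i. exp (l * card {x \<in> S. f x = c}))"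
    proof (rule sum_mono)
      fix f assume "f \<in> bad i"
      then have "\<eta> * n < \<sigma> * dev S c f" by (simp add: bad_def i)
      then have "\<eta> / 2 * (\<eta> * n) \<le> \<eta> / 2 * (\<sigma> * dev S c f)" using \<eta> by (intro mult_left_mono) auto
      then have "?t \<le> l * card {x \<in> S. f x = c}"
        by (simp add: l_def dev_def power2_eq_square algebra_simps)
      then show "exp ?t \<le> exp (l * card {x \<in> S. f x = c})" by simp
    qed
    also have "\<dots> \<le> (\<Sum>f\<in>?\<Omega>. exp (l * card {x \<in> S. f x = c}))"
      using fO by (intro sum_mono2) (auto simp: bad_def i)
    also have "\<dots> \<le> W * exp (card S / card C * (l + l\<^sup>2))"
      unfolding W_def by (intro exp_moment_colouring assms(1,2,5) i l)
    finally have "card (bad i) \<le> W * exp (card S / card C * (l + l\<^sup>2)) / exp ?t"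
      by (simp only: pos_le_divide_eq[OF exp_gt_zero])
    also have "\<dots> = W * exp (card S / card C * l\<^sup>2 - \<eta>\<^sup>2 / 2 * n)"
    proof -
      have "card S / card C * l\<^sup>2 - \<eta>\<^sup>2 / 2 * n = card S / card C * (l + l\<^sup>2) - ?t"
        by (simp add: algebra_simps add_divide_distrib)
      then show ?thesis by (simp only: exp_diff times_divide_eq_right)
    qed
    also have "\<dots> \<le> W * exp (- (n * \<eta>\<^sup>2 / 4))"
    proof -
      have "1 \<le> card C" using assms(2,3) by (simp add: Suc_le_eq card_gt_0_iff)
      then have "real (card S) / card C \<le> card S" by (simp add: divide_le_eq mult_le_cancel_left1)
      also have "\<dots> \<le> n" using assms(6) i by simp
      finally have "real (card S) / card C * l\<^sup>2 \<le> n * (\<eta>\<^sup>2 / 4)" unfolding l(2) by (intro mult_right_mono) auto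
      then show ?thesis using W by (simp add: algebra_simps)
    qed
    finally show ?thesis .
  qed
  have fI: "finite I" using assms by (simp add: I_def)
  have fbad: "finite (bad i)" for i using fO by (cases i) (simp add: bad_def)
  have cI: "card I = 2 * card \<F> * card C" by (simp add: I_def card_cartesian_product)
  have "real (card (\<Union>i\<in>I. bad i)) \<le> (\<Sum>i\<in>I. real (card (bad i)))"
    using card_UN_le[OF fI, of bad] by (metis of_nat_le_iff of_nat_sum)
  also have "\<dots> \<le> (\<Sum>i\<in>I. W * exp (- (n * \<eta>\<^sup>2 / 4)))" by (intro sum_mono one)
  also have "\<dots> = W * (2 * card \<F> * card C * exp (- (n * \<eta>\<^sup>2 / 4)))" by (simp add: cI)
  also have "\<dots> < W * 1" using W small by (intro mult_strict_left_mono)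
  finally have "card (\<Union>i\<in>I. bad i) < card ?\<Omega>" using cO by simp
  then have "\<not> ?\<Omega> \<subseteq> (\<Union>i\<in>I. bad i)" using fI fbad by (meson card_mono finite_UN_I linorder_not_less)
  then obtain f where f: "f \<in> ?\<Omega>" "\<And>i. i \<in> I \<Longrightarrow> f \<notin> bad i" by blast
  have "\<bar>dev S c f\<bar> \<le> \<eta> * n" if "S \<in> \<F>" "c \<in> C" for S c
    using f(2)[of "(S, c, 1)"] f(2)[of "(S, c, -1)"] f(1) that by (simp add: I_def bad_def abs_if not_less)
  then show ?thesis using f(1) by (intro exI[of _ f]) (auto simp: dev_def PiE_def)
qed

section \<open>Lines in an affine plane\<close>

abbreviation plane :: "nat \<Rightarrow> (nat \<times> nat) set" where
  "plane s \<equiv> {..<s} \<times> {..<s}"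

text \<open>The line of slope \<open>d\<close> and intercept \<open>b\<close> over the integers
  modulo \<open>s\<close>. Vertical lines do not occur.\<close>

definition line :: "nat \<Rightarrow> nat \<Rightarrow> nat \<Rightarrow> (nat \<times> nat) set" where
  "line s d b = (\<lambda>x. (x, (d * x + b) mod s)) ` {..<s}"

text \<open>Only the first \<open>D\<close> slopes count, so for \<open>s\<close> much larger than
  \<open>D\<close> most pairs of points are not collinear in this sense. For \<open>D > 0\<close> a
  point of the plane is collinear with itself.\<close>

definition collinear :: "nat \<Rightarrow> nat \<Rightarrow> nat \<times> nat \<Rightarrow> nat \<times> nat \<Rightarrow> bool" where
  "collinear s D z z' \<longleftrightarrow> (\<exists>d<D. \<exists>b<s. z \<in> line s d b \<and> z' \<in> line s d b)"

lemma mem_line: "(x, y) \<in> line s d b \<longleftrightarrow> x < s \<and> y = (d * x + b) mod s"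
  by (auto simp: line_def)

lemma line_sub: "line s d b \<subseteq> plane s"
  by (auto simp: line_def)

lemma finite_line [simp]: "finite (line s d b)"
  by (simp add: line_def)

lemma card_line [simp]: "card (line s d b) = s"
  by (simp add: line_def card_image inj_on_def)

lemma line_through:
  assumes "x < s" "y < s"
  shows "\<exists>b<s. (x, y) \<in> line s d b"
\<comment> \<open>The factor \<open>s - 1\<close> stands for -1 modulo \<open>s\<close>, so the
  intercept is \<open>y - d * x\<close>.\<close>
proof (intro exI[of _ "(y + (s - 1) * (d * x)) mod s"] conjI)
  have s: "0 < s" using assms by simp
  then show "(y + (s - 1) * (d * x)) mod s < s" by simp
  have "d * x + (y + (s - 1) * (d * x)) = y + s * (d * x)" using s by (cases s) (simp_all add: algebra_simps)
  then have "(d * x + (y + (s - 1) * (d * x)) mod s) mod s = (y + s * (d * x)) mod s"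
    by (simp only: mod_add_right_eq)
  also have "\<dots> = y" using assms by simp
  finally have "(d * x + (y + (s - 1) * (d * x)) mod s) mod s = y" .
  then show "(x, y) \<in> line s d ((y + (s - 1) * (d * x)) mod s)"
    using assms by (simp add: mem_line)
qed

lemma parallel_lines:
  assumes "z \<in> line s d b" "z \<in> line s d b'" "b < s" "b' < s"
  shows "b = b'"
proof -
  obtain x y where z: "z = (x, y)" by fastforce
  then have "[d * x + b = d * x + b'] (mod s)" using assms by (simp add: mem_line cong_def)
  then have "[b = b'] (mod s)" by (simp add: cong_add_lcancel_nat)
  then show ?thesis using assms by (simp add: cong_def)
qed

lemma lines_meet_once:
  assumes s: "prime s" and d: "d < s" "d' < s" "d \<noteq> d'"
    and z: "z \<in> line s d b" "z \<in> line s d' b'" and w: "w \<in> line s d b" "w \<in> line s d' b'"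
  shows "z = w"
proof -
  obtain x y x' y' where zw: "z = (x, y)" "w = (x', y')" by fastforce
  have x: "x < s" "y = (d * x + b) mod s" "y = (d' * x + b') mod s"
    "x' < s" "y' = (d * x' + b) mod s" "y' = (d' * x' + b') mod s"
    using z w by (auto simp: zw mem_line)
  have "[int (d * x + b) = int (d' * x + b')] (mod int s)"
    using x by (simp only: cong_int_iff) (simp add: cong_def)
  moreover have "[int (d * x' + b) = int (d' * x' + b')] (mod int s)"
    using x by (simp only: cong_int_iff) (simp add: cong_def)
  ultimately have "[int (d * x + b) - int (d * x' + b) = int (d' * x + b') - int (d' * x' + b')] (mod int s)"
    by (rule cong_diff)
  then have "int s dvd (int d - int d') * (int x - int x')"
    by (simp add: cong_iff_dvd_diff algebra_simps)
  moreover have "prime (int s)" using s by simp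
  ultimately have "int s dvd int d - int d' \<or> int s dvd int x - int x'"
    by (rule prime_dvd_multD[rotated])
  moreover have "\<not> int s dvd int d - int d'"
    using d zdvd_not_zless[of "\<bar>int d - int d'\<bar>" "int s"] by auto
  moreover have "x = x'" if "int s dvd int x - int x'"
  proof -
    have "[int x = int x'] (mod int s)" using that by (simp add: cong_iff_dvd_diff)
    then have "[x = x'] (mod s)" by (simp only: cong_int_iff)
    then show ?thesis using x by (simp add: cong_def)
  qed
  ultimately have "x = x'" by blast
  then show ?thesis using x zw by simp
qed

text \<open>The first coordinate of the common point solves \<open>(d - d') * x = b' - b\<close>,
  and the difference of two slopes is invertible modulo the prime \<open>s\<close>.\<close>

lemma lines_meet:
  assumes s: "prime s" and d: "d < s" "d' < s" "d \<noteq> d'"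
  shows "\<exists>z. z \<in> line s d b \<and> z \<in> line s d' b'"
proof -
  have s0: "0 < s" using s prime_gt_0_nat by blast
  have nd: "\<not> int s dvd int d - int d'"
    using d zdvd_not_zless[of "\<bar>int d - int d'\<bar>" "int s"] by auto
  have "prime (int s)" using s by simp
  then have "coprime (int d - int d') (int s)"
    using prime_imp_coprime[OF _ nd] by (simp add: coprime_commute)
  then obtain e where e: "[(int d - int d') * e = 1] (mod int s)" using cong_solve_coprime_int by blast
  define x where "x = nat ((e * (int b' - int b)) mod int s)"
  have x: "int x = (e * (int b' - int b)) mod int s" "x < s" using s0 by (auto simp: x_def nat_less_iff)
  have "[int x = e * (int b' - int b)] (mod int s)" by (simp add: x(1) cong_def)
  then have "[(int d - int d') * int x = (int d - int d') * (e * (int b' - int b))] (mod int s)"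
    by (intro cong_mult cong_refl)
  also have "(int d - int d') * (e * (int b' - int b)) = ((int d - int d') * e) * (int b' - int b)"
    by (simp add: mult.assoc)
  also have "[\<dots> = 1 * (int b' - int b)] (mod int s)" by (intro cong_mult e cong_refl)
  finally have "[int (d * x + b) = int (d' * x + b')] (mod int s)"
    by (simp add: cong_iff_dvd_diff algebra_simps)
  then have "[d * x + b = d' * x + b'] (mod s)" by (simp only: cong_int_iff)
  then have "(x, (d * x + b) mod s) \<in> line s d b \<and> (x, (d * x + b) mod s) \<in> line s d' b'"
    using x by (auto simp: mem_line cong_def)
  then show ?thesis by blast
qed

text \<open>That these numbers do not depend on \<open>z\<close> makes the edges of \<open>H\<close> assigned to a line nearly regular
  on its complement.\<close>

lemma card_not_collinear:
  assumes s: "prime s" and D: "D \<le> s" and A: "A = line s d0 b0" "d0 < D" "b0 < s"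
    and z: "z \<in> plane s" "z \<notin> A"
  shows "card {z' \<in> plane s. z' \<notin> A \<and> \<not> collinear s D z z'} + s + D * s + 2 = s * s + 2 * D"
    and "card {z' \<in> A. \<not> collinear s D z z'} + D = s + 1"
proof -
  obtain x y where xy: "z = (x, y)" "x < s" "y < s" using z(1) by auto
  obtain \<beta> where \<beta>: "\<And>d. \<beta> d < s" "\<And>d. z \<in> line s d (\<beta> d)" using line_through[OF xy(2,3)] xy(1) by metis
  define L where "L d = line s d (\<beta> d)" for d
  have coll: "collinear s D z z' \<longleftrightarrow> (\<exists>d<D. z' \<in> L d)" for z'
    using \<beta> parallel_lines unfolding collinear_def L_def by metis
  have s0: "0 < s" using xy by simp
  have zL: "z \<in> L d" for d using \<beta> by (simp add: L_def)
  have LL: "L d \<inter> L d' \<subseteq> {z}" if "d < D" "d' < D" "d \<noteq> d'" for d d'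
  proof
    fix w assume "w \<in> L d \<inter> L d'"
    then have "z = w"
      using lines_meet_once[OF s _ _ that(3) \<beta>(2) \<beta>(2), of w] that D by (simp add: L_def)
    then show "w \<in> {z}" by simp
  qed
  have AL: "A \<inter> L d0 = {}"
  proof (rule ccontr)
    assume "A \<inter> L d0 \<noteq> {}"
    then obtain w where "w \<in> line s d0 b0" "w \<in> line s d0 (\<beta> d0)" using A by (auto simp: L_def)
    then have "b0 = \<beta> d0" using parallel_lines A(3) \<beta>(1) by blast
    then show False using z(2) \<beta>(2)[of d0] A(1) by simp
  qed
  have AL1: "card (A \<inter> L d) = 1" if d: "d < D" "d \<noteq> d0" for d
  proof -
    have ds: "d0 < s" "d < s" "d0 \<noteq> d" using d D A(2) by auto
    obtain w where w: "w \<in> A" "w \<in> L d" using lines_meet[OF s ds, of b0 "\<beta> d"] A(1) by (auto simp: L_def)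
    have "w' = w" if "w' \<in> A" "w' \<in> L d" for w'
      using lines_meet_once[OF s ds, of w' b0 "\<beta> d" w] that w A(1) by (simp add: L_def)
    then have "A \<inter> L d = {w}" using w by blast
    then show ?thesis by simp
  qed
  have fA: "finite A" using A by simp
  have fL: "finite (L d)" "card (L d) = s" for d by (simp_all add: L_def)
  \<comment> \<open>The points other than \<open>z\<close> that are collinear with \<open>z\<close>:
    \<open>D\<close> punctured lines, pairwise disjoint. The line \<open>A\<close> is parallel to
    one of these lines and meets each of the others once, hence meets \<open>U\<close> in
    \<open>D - 1\<close> points. The claims follow by inclusion and exclusion.\<close>
  define U where "U = (\<Union>d<D. L d - {z})"
  have "card U = (\<Sum>d<D. card (L d - {z}))"
    unfolding U_def
  proof (rule card_UN_disjoint)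
    show "\<forall>i\<in>{..<D}. \<forall>j\<in>{..<D}. i \<noteq> j \<longrightarrow> (L i - {z}) \<inter> (L j - {z}) = {}"
      using LL by blast
  qed (use fL in auto)
  also have "\<dots> = (\<Sum>d<D. s - 1)" using zL fL by (intro sum.cong) (simp_all add: card_Diff_singleton)
  finally have cU: "card U = D * (s - 1)" by simp
  have "card (A \<inter> U) = card (\<Union>d\<in>{..<D} - {d0}. A \<inter> L d)"
    using AL z(2) by (intro arg_cong[of _ _ card]) (auto simp: U_def)
  also have "\<dots> = (\<Sum>d\<in>{..<D} - {d0}. card (A \<inter> L d))"
  proof (rule card_UN_disjoint)
    show "\<forall>i\<in>{..<D} - {d0}. \<forall>j\<in>{..<D} - {d0}. i \<noteq> j \<longrightarrow> A \<inter> L i \<inter> (A \<inter> L j) = {}"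
      using LL z(2) by blast
  qed (use fA in auto)
  also have "\<dots> = (\<Sum>d\<in>{..<D} - {d0}. 1)" using AL1 by (intro sum.cong) auto
  finally have cAU: "card (A \<inter> U) = D - 1" using A by simp
  have zU: "{z'. collinear s D z z'} = insert z U" using coll zL A(2) by (auto simp: U_def)
  have fU: "finite U" unfolding U_def using fL by auto
  have cA: "card A = s" using A by simp
  show "card {z' \<in> A. \<not> collinear s D z z'} + D = s + 1"
  proof -
    have "{z' \<in> A. \<not> collinear s D z z'} = A - (A \<inter> U)" using zU z(2) by auto
    then have "card {z' \<in> A. \<not> collinear s D z z'} = s - (D - 1)"
      using fA cAU cA by (simp add: card_Diff_subset)
    then show ?thesis using A D by simp
  qed
  have sub: "A \<union> insert z U \<subseteq> plane s"
    using A line_sub z unfolding U_def L_def by blast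
  have "{z' \<in> plane s. z' \<notin> A \<and> \<not> collinear s D z z'} = plane s - (A \<union> insert z U)"
    using zU by auto
  then have "card {z' \<in> plane s. z' \<notin> A \<and> \<not> collinear s D z z'} = s * s - card (A \<union> insert z U)"
    using sub fA fU by (simp add: card_Diff_subset card_cartesian_product)
  moreover have "card (A \<union> insert z U) \<le> s * s"
    using card_mono[OF _ sub] by (simp add: card_cartesian_product)
  moreover have "card (A \<union> insert z U) + (D - 1) = s + (D * (s - 1) + 1)"
  proof -
    have "z \<notin> U" by (simp add: U_def)
    then have "card (insert z U) = D * (s - 1) + 1" using fU cU by simp
    moreover have "A \<inter> insert z U = A \<inter> U" using z(2) by auto
    ultimately show ?thesis using card_Un_Int[of A "insert z U"] fA fU cA cAU by simp
  qed
  moreover have "D * (s - 1) + D = D * s" using s0 by (cases s) simp_all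
  ultimately show "card {z' \<in> plane s. z' \<notin> A \<and> \<not> collinear s D z z'} + s + D * s + 2 = s * s + 2 * D"
    using A by linarith
qed

section \<open>Edge-disjoint Hamilton cycles for all lines\<close>

lemma card_degree_nbrs:
  assumes "simple_graph G" "v \<in> verts G"
  shows "degree G v = card (nbrs (edges G) (verts G) v)"
proof -
  have "{e \<in> edges G. v \<in> e} = (\<lambda>u. {v, u}) ` nbrs (edges G) (verts G) v"
  proof
    show "{e \<in> edges G. v \<in> e} \<subseteq> (\<lambda>u. {v, u}) ` nbrs (edges G) (verts G) v"
    proof
      fix e assume "e \<in> {e \<in> edges G. v \<in> e}"
      then have e: "e \<in> edges G" "v \<in> e" by auto
      then have "card e = 2" "e \<subseteq> verts G" using assms(1) by (auto simp: simple_graph_def)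
      then obtain a b where ab: "e = {a, b}" "a \<noteq> b" "a \<in> verts G" "b \<in> verts G"
        by (metis card_2_iff insert_subset)
      have "v = a \<or> v = b" using e(2) ab(1) by simp
      then obtain u where "e = {v, u}" "u \<noteq> v" "u \<in> verts G" using ab by (metis insert_commute)
      then show "e \<in> (\<lambda>u. {v, u}) ` nbrs (edges G) (verts G) v" using e by (auto simp: nbrs_def)
    qed
  qed (auto simp: nbrs_def)
  moreover have "inj_on (\<lambda>u. {v, u}) (nbrs (edges G) (verts G) v)"
    by (auto simp: inj_on_def nbrs_def doubleton_eq_iff)
  ultimately show ?thesis unfolding degree_def by (simp add: card_image)
qed

text \<open>The result is a set of graphs, so its cardinality needs the lists to give different
  graphs. This follows from disjointness, as edge sets of cycles are nonempty.\<close>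

lemma hamilton_cycles_of_lists:
  assumes G: "simple_graph G" and "finite I" "3 \<le> card (verts G)"
    and xs: "\<And>i. i \<in> I \<Longrightarrow> distinct (xs i) \<and> set (xs i) = verts G \<and> cycle_edges (xs i) \<subseteq> edges G"
    and dj: "disjoint_family_on (\<lambda>i. cycle_edges (xs i)) I"
  shows "\<exists>\<C>. finite \<C> \<and> (\<forall>C\<in>\<C>. hamilton_cycle C G) \<and> pairwise edge_disjoint \<C> \<and> card \<C> = card I"
proof -
  define C where "C i = (set (xs i), cycle_edges (xs i))" for i
  have len: "3 \<le> length (xs i)" if "i \<in> I" for i using xs[OF that] assms(3) distinct_card by metis
  have ham: "hamilton_cycle (C i) G" if i: "i \<in> I" for i
  proof -
    have "xs i \<noteq> []" using len[OF i] by auto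
    then have "cycle_graph (C i)" unfolding cycle_graph_def C_def
      using xs[OF i] len[OF i] cycle_edges_nth[of "xs i"] by (intro exI[of _ "xs i"]) simp
    moreover have "spanning_subgraph (C i) G"
      using G xs[OF i] unfolding spanning_subgraph_def simple_graph_def C_def by auto
    ultimately show ?thesis by (simp add: hamilton_cycle_def)
  qed
  have ne: "cycle_edges (xs i) \<noteq> {}" for i by (simp add: cycle_edges_def)
  have dis: "cycle_edges (xs i) \<inter> cycle_edges (xs j) = {}" if "i \<in> I" "j \<in> I" "i \<noteq> j" for i j
    using dj that by (auto simp: disjoint_family_on_def)
  have inj: "inj_on C I"
  proof (rule inj_onI, rule ccontr)
    fix i j assume ij: "i \<in> I" "j \<in> I" "C i = C j" "i \<noteq> j"
    then show False using dis[OF ij(1,2,4)] ne by (simp add: C_def)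
  qed
  have "pairwise edge_disjoint (C ` I)"
  proof (rule pairwiseI)
    fix c c' assume "c \<in> C ` I" "c' \<in> C ` I" "c \<noteq> c'"
    then obtain i j where ij: "i \<in> I" "j \<in> I" "i \<noteq> j" "c = C i" "c' = C j" by blast
    then show "edge_disjoint c c'" using dis[OF ij(1-3)] by (simp add: edge_disjoint_def C_def)
  qed
  then show ?thesis using assms(2) ham inj
    by (intro exI[of _ "C ` I"]) (auto simp: card_image)
qed

text \<open>Each removed Hamilton cycle lowers all degrees by two, and Dirac's condition survives as
  long as the surplus lasts.\<close>

lemma greedy_hamilton_cycles:
  assumes "finite V" "3 \<le> card V"
    and "\<And>v. v \<in> V \<Longrightarrow> card V + 4 * k \<le> 2 * card (nbrs E V v)"
  shows "\<exists>xs. (\<forall>i<k. distinct (xs i) \<and> set (xs i) = V \<and> cycle_edges (xs i) \<subseteq> E) \<and>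
    disjoint_family_on (\<lambda>i. cycle_edges (xs i)) {..<k}"
  using assms(3)
proof (induction k)
  case 0
  then show ?case by (simp add: disjoint_family_on_def)
next
  case (Suc k)
  have deg: "card V + 4 * k \<le> 2 * card (nbrs E V v)" if "v \<in> V" for v
    using Suc.prems[OF that] by simp
  obtain xs where xs: "\<And>i. i < k \<Longrightarrow> distinct (xs i) \<and> set (xs i) = V \<and> cycle_edges (xs i) \<subseteq> E"
    and dxs: "disjoint_family_on (\<lambda>i. cycle_edges (xs i)) {..<k}"
    using Suc.IH[OF deg] by blast
  define U where "U = (\<Union>j<k. cycle_edges (xs j))"
  have xne: "xs j \<noteq> []" if "j < k" for j using xs[OF that] assms(2) by auto
  have "card V \<le> 2 * card (nbrs (E - U) V v)" if v: "v \<in> V" for v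
  proof -
    have "card (nbrs E V v) \<le> card (nbrs (E - U) V v) + 2 * card {..<k}"
      using assms(1) xs xne by (intro card_nbrs_remove_cycles[where xs = xs]) (auto simp: nbrs_def U_def)
    then show ?thesis using Suc.prems[OF v] by simp
  qed
  then obtain zs where zs: "distinct zs" "set zs = V" "cycle_edges zs \<subseteq> E - U"
    using dirac[OF assms(1,2), of "E - U"] by blast
  have new: "cycle_edges zs \<inter> cycle_edges (xs j) = {}" if "j < k" for j using zs(3) that by (auto simp: U_def)
  let ?xs = "xs(k := zs)"
  have "\<forall>i<Suc k. distinct (?xs i) \<and> set (?xs i) = V \<and> cycle_edges (?xs i) \<subseteq> E"
    using xs zs by (auto simp: less_Suc_eq)
  moreover have "disjoint_family_on (\<lambda>i. cycle_edges (?xs i)) {..<Suc k}"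
    using new dxs by (intro disjoint_family_on_lessThan_Suc) (auto simp: disjoint_family_on_def)
  ultimately show ?case by blast
qed

lemma card_by_key:
  assumes "finite S" "finite J"
  shows "card {u \<in> S. key u \<in> J} = (\<Sum>k\<in>J. card {u \<in> S. key u = k})"
proof -
  have "{u \<in> S. key u \<in> J} = (\<Union>k\<in>J. {u \<in> S. key u = k})" by auto
  also have "card \<dots> = (\<Sum>k\<in>J. card {u \<in> S. key u = k})"
    using assms by (intro card_UN_disjoint) auto
  finally show ?thesis .
qed

text \<open>\<open>f\<close> sends a vertex to its cell (a point of the affine plane) and its cluster, and \<open>col\<close> sends
  an edge to a line together with an index below \<open>P\<close>; index \<open>0\<close> is reserved for linking paths to
  the vertices on the line.\<close>

locale coloured_graph =
  fixes V :: "'a set" and EG EH :: "'a set set"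
    and f :: "'a \<Rightarrow> (nat \<times> nat) \<times> nat" and col :: "'a set \<Rightarrow> (nat \<times> nat) \<times> nat"
    and s D q P :: nat and \<epsilon> \<eta> r n :: real
  assumes fV: "finite V" and n: "n = card V" and HG: "EH \<subseteq> EG"
    and s: "prime s" and q: "prime q" and D: "0 < D" "D \<le> s" and P: "0 < P" and \<eta>: "0 \<le> \<eta>" and r: "0 \<le> r"
    and f: "\<And>v. v \<in> V \<Longrightarrow> f v \<in> plane s \<times> {..<q}"
    and size: "\<And>c. c \<in> plane s \<times> {..<q} \<Longrightarrow> card {v \<in> V. f v = c} \<le> n / (s * s * q) + \<eta> * n"
    and deg_cell: "\<And>v c. v \<in> V \<Longrightarrow> c \<in> plane s \<times> {..<q} \<Longrightarrow>
      card {u \<in> nbrs EG V v. f u = c} \<ge> (1 / 2 + \<epsilon>) * n / (s * s * q) - \<eta> * n"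
    and deg_H: "\<And>v c k. v \<in> V \<Longrightarrow> c \<in> plane s \<times> {..<q} \<Longrightarrow> k \<in> ({..<D} \<times> {..<s}) \<times> {..<P} \<Longrightarrow>
      \<bar>card {u \<in> nbrs EH V v. f u = c \<and> col {v, u} = k} - r / (s * s * q * (D * s * P))\<bar> \<le> 2 * \<eta> * n"
    and deg_G: "\<And>v c k. v \<in> V \<Longrightarrow> c \<in> plane s \<times> {..<q} \<Longrightarrow> k \<in> ({..<D} \<times> {..<s}) \<times> {..<P} \<Longrightarrow>
      card {u \<in> nbrs EG V v. f u = c \<and> col {v, u} = k} \<ge> (1 / 2 + \<epsilon>) * n / (s * s * q * (D * s * P)) - 2 * \<eta> * n"
begin

section \<open>The edges available to one line\<close>

definition cell :: "'a \<Rightarrow> nat \<times> nat" where "cell v = fst (f v)"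

text \<open>Edges failing this condition are withheld from the random distribution: their ends lie
  in cells of a common line, and the edge may be needed by that line whatever its colour.\<close>

definition sep :: "'a set \<Rightarrow> bool" where
  "sep e \<longleftrightarrow> (\<forall>u\<in>e. \<forall>v\<in>e. u \<noteq> v \<longrightarrow> \<not> collinear s D (cell u) (cell v))"

definition on_line :: "nat \<times> nat \<Rightarrow> 'a set" where
  "on_line L = {v \<in> V. cell v \<in> line s (fst L) (snd L)}"

definition main_edges :: "nat \<times> nat \<Rightarrow> 'a set set" where
  "main_edges L = {e \<in> EH. fst (col e) = L \<and> snd (col e) \<in> {1..<P} \<and> sep e}"

definition link_edges :: "nat \<times> nat \<Rightarrow> 'a set set" where
  "link_edges L = {e \<in> EG. col e = (L, 0) \<and> sep e}"

text \<open>Lines of different slopes can share a cell, so the edges inside a cell are granted to no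
  line.\<close>

definition cross_edges :: "'a set set" where
  "cross_edges = {e \<in> EG. \<forall>u\<in>e. \<forall>v\<in>e. u \<noteq> v \<longrightarrow> cell u \<noteq> cell v}"

definition class_edges :: "nat \<times> nat \<Rightarrow> 'a set set" where
  "class_edges L = joins (main_edges L) (V - on_line L) (V - on_line L) \<union>
     joins (link_edges L) (V - on_line L) (on_line L) \<union> joins cross_edges (on_line L) (on_line L)"

lemma collinear_sym: "collinear s D z z' \<longleftrightarrow> collinear s D z' z"
  by (auto simp: collinear_def)

lemma sep_doubleton: "u \<noteq> v \<Longrightarrow> sep {u, v} \<longleftrightarrow> \<not> collinear s D (cell u) (cell v)"
  using collinear_sym by (auto simp: sep_def)

lemma class_edges_sub: "class_edges L \<subseteq> EG"
  using HG by (auto simp: class_edges_def joins_def main_edges_def link_edges_def cross_edges_def)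

lemma class_edges_cases:
  assumes "e \<in> class_edges L"
  shows "fst (col e) = L \<and> sep e \<or>
    (\<exists>u v. e = {u, v} \<and> u \<noteq> v \<and> cell u \<noteq> cell v \<and> cell u \<in> line s (fst L) (snd L) \<and> cell v \<in> line s (fst L) (snd L))"
proof -
  consider "e \<in> main_edges L" | "e \<in> link_edges L" | "e \<in> joins cross_edges (on_line L) (on_line L)"
    using assms by (auto simp: class_edges_def joins_def)
  then show ?thesis
    by cases (auto simp: main_edges_def link_edges_def joins_def cross_edges_def on_line_def)
qed

text \<open>A separated edge belongs to at most the class given by its colour. Any other edge of a
  class joins two different cells of the line, and two cells lie on at most one line. The two kinds
  exclude each other, since cells of one line are collinear.\<close>

lemma class_edges_disjoint: "disjoint_family_on class_edges ({..<D} \<times> {..<s})"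
  unfolding disjoint_family_on_def
proof (intro ballI impI, rule ccontr)
  fix L L' assume L: "L \<in> {..<D} \<times> {..<s}" "L' \<in> {..<D} \<times> {..<s}" "L \<noteq> L'"
    and "class_edges L \<inter> class_edges L' \<noteq> {}"
  then obtain e where e: "e \<in> class_edges L" "e \<in> class_edges L'" by blast
  obtain d b d' b' where db: "L = (d, b)" "L' = (d', b')" by (metis surj_pair)
  have col: "collinear s D z z'" if "z \<in> line s (fst M) (snd M)" "z' \<in> line s (fst M) (snd M)" "M \<in> {..<D} \<times> {..<s}" for z z' M
    using that unfolding collinear_def by (metis SigmaE fst_conv lessThan_iff snd_conv)
  have no: False if se: "sep e" and M: "M \<in> {..<D} \<times> {..<s}" and uv: "e = {u, v}" "u \<noteq> v"
    "cell u \<in> line s (fst M) (snd M)" "cell v \<in> line s (fst M) (snd M)" for u v M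
    using se col[OF uv(3,4) M] sep_doubleton[OF uv(2)] uv(1) by simp
  show False
  proof (cases "sep e")
    case True
    then show False using class_edges_cases[OF e(1)] class_edges_cases[OF e(2)] no L by metis
  next
    case False
    then obtain u v where uv: "e = {u, v}" "cell u \<noteq> cell v" "cell u \<in> line s d b" "cell v \<in> line s d b"
      using class_edges_cases[OF e(1)] db by auto
    obtain u' v' where uv': "e = {u', v'}" "cell u' \<in> line s d' b'" "cell v' \<in> line s d' b'"
      using False class_edges_cases[OF e(2)] db by auto
    have m: "cell u \<in> line s d' b'" "cell v \<in> line s d' b'" using uv uv' by (auto simp: doubleton_eq_iff)
    show False
    proof (cases "d = d'")
      case True
      then have "b = b'" using parallel_lines[OF uv(3), of b'] m L db by auto
      then show False using True L db by simp
    next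
      case False
      then show False using lines_meet_once[OF s _ _ False uv(3) m(1) uv(4) m(2)] uv(2) L D db by simp
    qed
  qed
qed

lemma cluster_less: "v \<in> V \<Longrightarrow> snd (f v) < q" and cell_in_plane: "v \<in> V \<Longrightarrow> cell v \<in> plane s"
  using f by (auto simp: cell_def mem_Times_iff)

lemma card_on_line: "card (on_line L) \<le> s * q * (n / (s * s * q) + \<eta> * n)"
proof -
  let ?J = "line s (fst L) (snd L) \<times> {..<q}"
  have "on_line L = {u \<in> V. f u \<in> ?J}"
    using cluster_less by (auto simp: on_line_def mem_Times_iff cell_def)
  then have "card (on_line L) = (\<Sum>c\<in>?J. card {u \<in> V. f u = c})"
    using fV card_by_key[of V ?J f] by simp
  then have "real (card (on_line L)) = (\<Sum>c\<in>?J. real (card {u \<in> V. f u = c}))" by simp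
  also have "\<dots> \<le> (\<Sum>c\<in>?J. n / (s * s * q) + \<eta> * n)"
    using line_sub[of s "fst L" "snd L"] by (intro sum_mono size) auto
  also have "\<dots> = s * q * (n / (s * s * q) + \<eta> * n)" by (simp add: card_cartesian_product)
  finally show ?thesis .
qed

text \<open>These hypotheses keep the combinatorics apart from the numerical estimates. \<kappa> is
  the number of cells off a line that are not collinear with a given cell off it. Every degree into
  a cluster is within \<open>x / 2\<close> of one common value, so with \<Delta> the rounded upper
  end it lies between \<Delta> - \<open>x\<close> and \<Delta>. The bound \<open>y\<close> is for
  the size of a cluster, \<open>h\<close> counts the shifts, \<open>t\<close> the paths allowed in a
  system and \<open>N\<close> the cycles made for one line.\<close>

context
  fixes N t \<Delta> \<kappa> h :: nat and x y :: real
  assumes h_def: "h = (q - 1) div 2" and x_def: "x = 2 * (s * s * P * (2 * \<eta> * n))" and y_def: "y = s * s * (n / (s * s * q) + \<eta> * n)"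
    and size_line: "s * q * (n / (s * s * q) + \<eta> * n) < n"
    and \<kappa>: "\<kappa> + s + D * s + 2 = s * s + 2 * D"
    and \<Delta>: "\<Delta> = nat \<lfloor>\<kappa> * (P - 1) * (r / (s * s * q * (D * s * P))) + x / 2\<rfloor>"
    and t: "0 < t" and N: "N \<le> h * \<Delta> - h * (n * x + \<Delta> * y) / t"
    and I2: "3 * t + 2 + 2 * (h * (2 * (x + \<Delta> / q + 1))) \<le>
      (s + 1 - D) * q * ((1 / 2 + \<epsilon>) * n / (s * s * q * (D * s * P)) - 2 * \<eta> * n)"
    and I3: "s * q * (n / (s * s * q) + \<eta> * n) + 6 * t + 10 + 4 * N \<le>
      2 * ((s - 1) * q * ((1 / 2 + \<epsilon>) * n / (s * s * q) - \<eta> * n))"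
begin

text \<open>All degrees are sums of the counts controlled by the locale, one for every combination
  of cell, cluster and colour. The number of summands comes from \<open>card_not_collinear\<close>
  and is the same for every vertex off the line; hence the main edges are nearly regular
  there.\<close>

lemma hamilton_cycles_in_class:
  assumes L: "L \<in> {..<D} \<times> {..<s}"
  shows "\<exists>xs. (\<forall>i<N. distinct (xs i) \<and> set (xs i) = V \<and> cycle_edges (xs i) \<subseteq> class_edges L) \<and>
    disjoint_family_on (\<lambda>i. cycle_edges (xs i)) {..<N}"
proof -
  define A where "A = on_line L"
  define B where "B = V - A"
  obtain d b where db: "L = (d, b)" "d < D" "b < s" using L by auto
  have AV: "A \<subseteq> V" by (auto simp: A_def on_line_def)
  have fA: "finite A" and fB: "finite B" using AV fV finite_subset by (auto simp: B_def)
  have BV: "B \<subseteq> V" by (auto simp: B_def)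
  have n0: "0 \<le> n" using n by simp
  let ?\<mu> = "r / (s * s * q * (D * s * P))"
  define ok where "ok v = {z \<in> plane s. z \<notin> line s d b \<and> \<not> collinear s D (cell v) z}" for v
  define ok1 where "ok1 v = {z \<in> line s d b. \<not> collinear s D (cell v) z}" for v
  have B_iff: "v \<in> B \<longleftrightarrow> v \<in> V \<and> cell v \<notin> line s d b" for v by (auto simp: B_def A_def on_line_def db)
  have A_iff: "v \<in> A \<longleftrightarrow> v \<in> V \<and> cell v \<in> line s d b" for v by (auto simp: A_def on_line_def db)
  have cok: "card (ok v) = \<kappa>" and cok1: "card (ok1 v) = s + 1 - D" if v: "v \<in> B" for v
    using card_not_collinear[OF s D(2) refl db(2,3), of "cell v"] v cell_in_plane[of v] \<kappa> B_iff
    unfolding ok_def ok1_def by auto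
  have dev: "\<bar>card {u \<in> nbrs (main_edges L) B v. snd (f u) = i} - \<kappa> * (P - 1) * ?\<mu>\<bar> \<le> x / 2"
    if v: "v \<in> B" and i: "i < q" for v i
  proof -
    have vV: "v \<in> V" using v BV by auto
    \<comment> \<open>The main neighbours of \<open>v\<close> in cluster \<open>i\<close> are
      recognised by their cell, one of the \<kappa> admissible ones, and by the index of the edge,
      which ranges over \<open>{1..<P}\<close>.\<close>
    define J where "J = (ok v \<times> {i}) \<times> ({L} \<times> {1..<P})"
    define key where "key u = (f u, col {v, u})" for u
    have fJ: "finite J" by (simp add: J_def ok_def)
    have cJ: "card J = \<kappa> * (P - 1)" using cok[OF v] by (simp add: J_def card_cartesian_product)
    have "{u \<in> nbrs (main_edges L) B v. snd (f u) = i} = {u \<in> nbrs EH V v. key u \<in> J}"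
    proof (rule subset_antisym; rule subsetI)
      fix u assume u: "u \<in> {u \<in> nbrs (main_edges L) B v. snd (f u) = i}"
      then have u': "u \<in> B" "u \<noteq> v" "{v, u} \<in> main_edges L" "snd (f u) = i" by (auto simp: nbrs_def)
      have uV: "u \<in> V" using u' BV by auto
      have c: "fst (col {v, u}) = L" "snd (col {v, u}) \<in> {1..<P}" "{v, u} \<in> EH" "sep {v, u}"
        using u'(3) by (auto simp: main_edges_def)
      have "cell u \<in> ok v" using c(4) u' sep_doubleton[of v u] cell_in_plane[OF uV] B_iff by (auto simp: ok_def)
      then have "f u \<in> ok v \<times> {i}" using u'(4) by (auto simp: cell_def mem_Times_iff)
      then show "u \<in> {u \<in> nbrs EH V v. key u \<in> J}"
        using c uV u' by (auto simp: key_def J_def mem_Times_iff nbrs_def)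
    next
      fix u assume "u \<in> {u \<in> nbrs EH V v. key u \<in> J}"
      then have u: "u \<in> V" "u \<noteq> v" "{v, u} \<in> EH" "fst (f u) \<in> ok v" "snd (f u) = i"
        "fst (col {v, u}) = L" "snd (col {v, u}) \<in> {1..<P}"
        by (auto simp: key_def J_def mem_Times_iff nbrs_def)
      have "sep {v, u}" using u sep_doubleton[of v u] by (auto simp: ok_def cell_def)
      moreover have "u \<in> B" using u B_iff by (auto simp: ok_def cell_def)
      ultimately show "u \<in> {u \<in> nbrs (main_edges L) B v. snd (f u) = i}"
        using u by (auto simp: nbrs_def main_edges_def)
    qed
    also have "card {u \<in> nbrs EH V v. key u \<in> J} = (\<Sum>k\<in>J. card {u \<in> nbrs EH V v. key u = k})"
      using fV fJ by (intro card_by_key) auto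
    finally have "card {u \<in> nbrs (main_edges L) B v. snd (f u) = i} - \<kappa> * (P - 1) * ?\<mu> =
      (\<Sum>k\<in>J. card {u \<in> nbrs EH V v. key u = k} - ?\<mu>)"
      using cJ by (simp add: sum_subtractf)
    also have "\<bar>\<dots>\<bar> \<le> (\<Sum>k\<in>J. \<bar>card {u \<in> nbrs EH V v. key u = k} - ?\<mu>\<bar>)" by (rule sum_abs)
    also have "\<dots> \<le> (\<Sum>k\<in>J. 2 * \<eta> * n)"
    proof (rule sum_mono)
      fix k assume k: "k \<in> J"
      have "fst k \<in> plane s \<times> {..<q}" "snd k \<in> ({..<D} \<times> {..<s}) \<times> {..<P}"
        using k i L by (auto simp: J_def ok_def)
      then show "\<bar>card {u \<in> nbrs EH V v. key u = k} - ?\<mu>\<bar> \<le> 2 * \<eta> * n"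
        using deg_H[OF vV, of "fst k" "snd k"] by (simp add: key_def prod_eq_iff)
    qed
    also have "\<dots> = card J * (2 * \<eta> * n)" by simp
    also have "\<dots> \<le> (s * s * P) * (2 * \<eta> * n)"
    proof (rule mult_right_mono)
      have "\<kappa> \<le> s * s" using cok[OF v] card_mono[of "plane s" "ok v"] by (auto simp: ok_def card_cartesian_product)
      then have "card J \<le> s * s * P" unfolding cJ by (intro mult_le_mono) auto
      then show "real (card J) \<le> s * s * P" by (metis of_nat_le_iff)
    qed (use \<eta> n0 in simp)
    also have "real (s * s * P) * (2 * \<eta> * n) = x / 2" by (simp add: x_def)
    finally show ?thesis .
  qed
  have x0: "0 \<le> x" using \<eta> n0 by (simp add: x_def)
  have \<mu>0: "0 \<le> \<kappa> * (P - 1) * ?\<mu>" using r by simp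
  have \<Delta>1: "real \<Delta> \<le> \<kappa> * (P - 1) * ?\<mu> + x / 2" unfolding \<Delta> using \<mu>0 x0 by (intro of_nat_floor) auto
  have "\<exists>xs. (\<forall>i<N. distinct (xs i) \<and> set (xs i) = A \<union> B \<and>
      cycle_edges (xs i) \<subseteq> joins (main_edges L) B B \<union> joins (link_edges L) B A \<union> joins cross_edges A A) \<and>
    disjoint_family_on (\<lambda>i. cycle_edges (xs i)) {..<N}"
  proof (rule hamilton_family_in_class[where g = "\<lambda>v. snd (f v)" and q = q and d = \<Delta> and x = x and y = y and t = t])
    show "finite A" "finite B" "A \<inter> B = {}" "prime q" "0 < t" using fA fB q t by (auto simp: B_def)
    show "B \<noteq> {}"
    proof
      assume "B = {}"
      then have "A = V" using AV by (auto simp: B_def)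
      then show False using card_on_line[of L] size_line n by (simp add: A_def)
    qed
    show "snd (f v) < q" if "v \<in> B" for v using that BV cluster_less by auto
    show "card {u \<in> nbrs (main_edges L) B v. snd (f u) = i} \<le> \<Delta>" if "v \<in> B" "i < q" for v i
    proof -
      have "real (card {u \<in> nbrs (main_edges L) B v. snd (f u) = i}) \<le> \<kappa> * (P - 1) * ?\<mu> + x / 2"
        using dev[OF that] by linarith
      then show ?thesis unfolding \<Delta> by (simp add: le_nat_floor)
    qed
    show "real \<Delta> \<le> card {u \<in> nbrs (main_edges L) B v. snd (f u) = i} + x" if "v \<in> B" "i < q" for v i
      using dev[OF that] \<Delta>1 by linarith
    show "card {u \<in> B. snd (f u) = i} \<le> y" if i: "i < q" for i
    proof -
      have "card {u \<in> B. snd (f u) = i} \<le> card {u \<in> V. f u \<in> plane s \<times> {i}}"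
        using fV BV f by (intro card_mono) (auto simp: mem_Times_iff)
      also have "\<dots> = (\<Sum>c\<in>plane s \<times> {i}. card {u \<in> V. f u = c})" using fV by (intro card_by_key) auto
      finally have "real (card {u \<in> B. snd (f u) = i}) \<le> (\<Sum>c\<in>plane s \<times> {i}. real (card {u \<in> V. f u = c}))"
        by (simp flip: of_nat_sum)
      also have "\<dots> \<le> (\<Sum>c\<in>plane s \<times> {i}. n / (s * s * q) + \<eta> * n)"
        using i by (intro sum_mono size) auto
      also have "\<dots> = y" by (simp add: y_def card_cartesian_product)
      finally show ?thesis .
    qed
    have "card B \<le> n" unfolding n using fV BV by (simp add: card_mono)
    then have "real ((q - 1) div 2) * (card B * x + \<Delta> * y) / t \<le> h * (n * x + \<Delta> * y) / t"
      unfolding h_def using x0 by (intro divide_right_mono mult_left_mono add_right_mono mult_right_mono) auto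
    then show "real N \<le> real ((q - 1) div 2 * \<Delta>) - real ((q - 1) div 2) * (card B * x + \<Delta> * y) / t"
      using N by (simp add: h_def)
    show "real (3 * t + 2) + 2 * (real ((q - 1) div 2) * (2 * (x + real \<Delta> / real q + 1)))
         \<le> real (card (nbrs (link_edges L) A v))" if v: "v \<in> B" for v
    proof -
      have vV: "v \<in> V" using v BV by auto
      \<comment> \<open>Link edges must be separated as well: of the \<open>s\<close> cells on the
        line the \<open>D - 1\<close> that are collinear with the cell of \<open>v\<close> are
        excluded.\<close>
      define J where "J = (ok1 v \<times> {..<q}) \<times> {(L, 0 :: nat)}"
      define key where "key u = (f u, col {v, u})" for u
      have fJ: "finite J" by (simp add: J_def ok1_def)
      have "{u \<in> nbrs EG V v. key u \<in> J} \<subseteq> nbrs (link_edges L) A v"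
      proof
        fix u assume "u \<in> {u \<in> nbrs EG V v. key u \<in> J}"
        then have u: "u \<in> V" "u \<noteq> v" "{v, u} \<in> EG" "fst (f u) \<in> ok1 v" "col {v, u} = (L, 0)"
          by (auto simp: key_def J_def mem_Times_iff nbrs_def)
        have "sep {v, u}" using u sep_doubleton[of v u] by (auto simp: ok1_def cell_def)
        moreover have "u \<in> A" using u A_iff by (auto simp: ok1_def cell_def)
        ultimately show "u \<in> nbrs (link_edges L) A v" using u by (auto simp: nbrs_def link_edges_def)
      qed
      then have "card {u \<in> nbrs EG V v. key u \<in> J} \<le> card (nbrs (link_edges L) A v)"
        using fA by (intro card_mono) auto
      moreover have "card {u \<in> nbrs EG V v. key u \<in> J} = (\<Sum>k\<in>J. card {u \<in> nbrs EG V v. key u = k})"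
        using fV fJ by (intro card_by_key) auto
      ultimately have "(\<Sum>k\<in>J. real (card {u \<in> nbrs EG V v. key u = k})) \<le> card (nbrs (link_edges L) A v)"
        by (simp flip: of_nat_sum)
      moreover have "(\<Sum>k\<in>J. (1 / 2 + \<epsilon>) * n / (s * s * q * (D * s * P)) - 2 * \<eta> * n) \<le>
        (\<Sum>k\<in>J. real (card {u \<in> nbrs EG V v. key u = k}))"
      proof (rule sum_mono)
        fix k assume k: "k \<in> J"
        have "fst k \<in> plane s \<times> {..<q}" "snd k \<in> ({..<D} \<times> {..<s}) \<times> {..<P}"
          using k L P line_sub[of s d b] by (auto simp: J_def ok1_def)
        then show "(1 / 2 + \<epsilon>) * n / (s * s * q * (D * s * P)) - 2 * \<eta> * n \<le> real (card {u \<in> nbrs EG V v. key u = k})"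
          using deg_G[OF vV, of "fst k" "snd k"] by (simp add: key_def prod_eq_iff)
      qed
      moreover have "card J = (s + 1 - D) * q" using cok1[OF v] by (simp add: J_def card_cartesian_product)
      ultimately show ?thesis using I2 by (simp add: h_def)
    qed
    show "card A + 6 * t + 10 + 4 * N \<le> 2 * card (nbrs cross_edges A a)" if a: "a \<in> A" for a
    proof -
      have aV: "a \<in> V" using a AV by auto
      \<comment> \<open>Edges inside the cell of \<open>a\<close> are not cross edges, so
        \<open>s - 1\<close> of the \<open>s\<close> cells on the line remain.\<close>
      define J where "J = (line s d b - {cell a}) \<times> {..<q}"
      have cl: "cell a \<in> line s d b" using a A_iff by simp
      have fJ: "finite J" by (simp add: J_def)
      have Jc: "J \<subseteq> plane s \<times> {..<q}" using line_sub by (auto simp: J_def)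
      have "{u \<in> nbrs EG V a. f u \<in> J} \<subseteq> nbrs cross_edges A a"
        using A_iff by (auto simp: J_def mem_Times_iff nbrs_def cross_edges_def cell_def)
      then have "card {u \<in> nbrs EG V a. f u \<in> J} \<le> card (nbrs cross_edges A a)"
        using fA by (intro card_mono) auto
      moreover have "card {u \<in> nbrs EG V a. f u \<in> J} = (\<Sum>k\<in>J. card {u \<in> nbrs EG V a. f u = k})"
        using fV fJ by (intro card_by_key) auto
      ultimately have "(\<Sum>k\<in>J. real (card {u \<in> nbrs EG V a. f u = k})) \<le> card (nbrs cross_edges A a)"
        by (simp flip: of_nat_sum)
      moreover have "(\<Sum>k\<in>J. (1 / 2 + \<epsilon>) * n / (s * s * q) - \<eta> * n) \<le>
        (\<Sum>k\<in>J. real (card {u \<in> nbrs EG V a. f u = k}))"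
        using Jc deg_cell[OF aV] by (intro sum_mono) auto
      moreover have "card J = (s - 1) * q" using cl by (simp add: J_def card_cartesian_product)
      ultimately have 1: "real ((s - 1) * q) * ((1 / 2 + \<epsilon>) * n / (s * s * q) - \<eta> * n) \<le> card (nbrs cross_edges A a)"
        by simp
      have "real (card A) \<le> s * q * (n / (s * s * q) + \<eta> * n)" unfolding A_def by (rule card_on_line)
      then have "real (card A + 6 * t + 10 + 4 * N) \<le> s * q * (n / (s * s * q) + \<eta> * n) + 6 * t + 10 + 4 * N"
        by simp
      also note I3
      also have "2 * ((s - 1) * q * ((1 / 2 + \<epsilon>) * n / (s * s * q) - \<eta> * n)) \<le> real (2 * card (nbrs cross_edges A a))"
        using mult_left_mono[OF 1, of 2] by (simp only: of_nat_mult of_nat_numeral)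
      finally have "real (card A + 6 * t + 10 + 4 * N) \<le> real (2 * card (nbrs cross_edges A a))" .
      then show ?thesis by (simp only: of_nat_le_iff)
    qed
  qed
  moreover have "A \<union> B = V" using AV by (auto simp: B_def)
  moreover have "class_edges L = joins (main_edges L) B B \<union> joins (link_edges L) B A \<union> joins cross_edges A A"
    by (simp add: class_edges_def A_def B_def)
  ultimately show ?thesis by simp
qed

lemma hamilton_cycles_in_all_classes:
  "\<exists>xs. (\<forall>i\<in>({..<D} \<times> {..<s}) \<times> {..<N}. distinct (xs i) \<and> set (xs i) = V \<and> cycle_edges (xs i) \<subseteq> EG) \<and>
    disjoint_family_on (\<lambda>i. cycle_edges (xs i)) (({..<D} \<times> {..<s}) \<times> {..<N})"
proof -
  have "\<forall>L\<in>{..<D} \<times> {..<s}. \<exists>xs. (\<forall>i<N. distinct (xs i) \<and> set (xs i) = V \<and> cycle_edges (xs i) \<subseteq> class_edges L) \<and>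
    disjoint_family_on (\<lambda>i. cycle_edges (xs i)) {..<N}"
    using hamilton_cycles_in_class by blast
  then obtain xs where xs: "\<And>L i. L \<in> {..<D} \<times> {..<s} \<Longrightarrow> i < N \<Longrightarrow>
      distinct (xs L i) \<and> set (xs L i) = V \<and> cycle_edges (xs L i) \<subseteq> class_edges L"
    and dj: "\<And>L. L \<in> {..<D} \<times> {..<s} \<Longrightarrow> disjoint_family_on (\<lambda>i. cycle_edges (xs L i)) {..<N}" by metis
  have "disjoint_family_on (\<lambda>i. cycle_edges (xs (fst i) (snd i))) (({..<D} \<times> {..<s}) \<times> {..<N})"
    unfolding disjoint_family_on_def
  proof (intro ballI impI)
    fix k l assume kl: "k \<in> ({..<D} \<times> {..<s}) \<times> {..<N}" "l \<in> ({..<D} \<times> {..<s}) \<times> {..<N}" "k \<noteq> l"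
    obtain L i L' j where e: "k = (L, i)" "l = (L', j)" by (metis surj_pair)
    have m: "L \<in> {..<D} \<times> {..<s}" "i < N" "L' \<in> {..<D} \<times> {..<s}" "j < N" using kl e by auto
    have "cycle_edges (xs L i) \<inter> cycle_edges (xs L' j) = {}"
    proof (cases "L = L'")
      case True
      then show ?thesis using dj[OF m(1)] m kl e unfolding disjoint_family_on_def by auto
    next
      case False
      then have "class_edges L \<inter> class_edges L' = {}"
        using class_edges_disjoint m unfolding disjoint_family_on_def by blast
      then show ?thesis using xs[OF m(1,2)] xs[OF m(3,4)] by blast
    qed
    then show "cycle_edges (xs (fst k) (snd k)) \<inter> cycle_edges (xs (fst l) (snd l)) = {}" by (simp add: e)
  qed
  moreover have "distinct (xs (fst k) (snd k)) \<and> set (xs (fst k) (snd k)) = V \<and> cycle_edges (xs (fst k) (snd k)) \<subseteq> EG"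
    if "k \<in> ({..<D} \<times> {..<s}) \<times> {..<N}" for k
  proof -
    have "fst k \<in> {..<D} \<times> {..<s}" "snd k < N" using that by auto
    then show ?thesis using xs[of "fst k" "snd k"] class_edges_sub[of "fst k"] by (meson order.trans)
  qed
  ultimately show ?thesis by (intro exI[of _ "\<lambda>k. xs (fst k) (snd k)"]) blast
qed

end

end

section \<open>Choice of constants\<close>

text \<open>The exponential exceeds half the square of \<open>n * a\<close>. The constant 12 arises
  because \<open>(4 * n + 2) * C\<close> is at most \<open>6 * n * C\<close>, and this is at most
  half of that square once \<open>12 * C\<close> is at most \<open>n * a\<^sup>2\<close>.\<close>

lemma linear_times_exp_small:
  fixes a C :: real
  assumes "0 < a" "0 < C" "1 \<le> n" "12 * C / a\<^sup>2 < n"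
  shows "(4 * n + 2) * C * exp (- (n * a)) < 1"
proof -
  have "0 \<le> n * a" using assms by simp
  then have "(n * a)\<^sup>2 / 2 < exp (n * a)" using exp_lower_Taylor_quadratic[of "n * a"] by linarith
  moreover have "(4 * n + 2) * C \<le> (n * a)\<^sup>2 / 2"
  proof -
    have "12 * C \<le> n * a\<^sup>2" using assms by (simp add: field_simps)
    then have "n * (12 * C) \<le> n * (n * a\<^sup>2)" using assms by (intro mult_left_mono) auto
    moreover have "2 * C \<le> 2 * C * n" using assms by simp
    ultimately show ?thesis by (simp add: power2_eq_square algebra_simps)
  qed
  ultimately have "(4 * n + 2) * C < exp (n * a)" by linarith
  then show ?thesis by (simp add: exp_minus field_simps)
qed

text \<open>The hierarchy of constants: \<open>\<epsilon>\<close>, then the number \<open>D\<close> of slopes, the order \<open>s\<close> of the plane, the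
  proportion \<open>\<tau>\<close> of vertices that may be spent on linking, the number \<open>q\<close> of clusters, the
  discrepancy \<open>\<eta>\<close>, and finally \<open>n\<close>.\<close>

lemma counting_inequalities:
  fixes \<epsilon> \<tau> \<eta> r n x y :: real and D s q \<kappa> \<Delta> t N h :: nat
  assumes \<epsilon>: "0 < \<epsilon>" "\<epsilon> \<le> 1 / 4" and D: "8 / \<epsilon> \<le> D" and s: "32 * D / \<epsilon> \<le> s"
    and \<tau>: "\<tau> = 1 / (64 * s * (D * s * D))"
    and q: "64 / (\<tau> * \<epsilon>\<^sup>2) \<le> q" "odd q"
    and \<eta>: "\<eta> = \<epsilon>\<^sup>2 * \<tau> / (256 * (D * s) * q * (s * s * D))"
    and n: "2 + 2 * q \<le> \<tau> * n" "112 * s / \<epsilon> \<le> n" "4 * (D * s) * (1 + q) / \<epsilon>\<^sup>2 \<le> n"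
    and r: "\<epsilon> * n \<le> r" "r \<le> n"
    and \<kappa>: "\<kappa> + s + D * s + 2 = s * s + 2 * D"
    and h: "h = (q - 1) div 2" and x: "x = 2 * (s * s * D * (2 * \<eta> * n))"
    and y: "y = s * s * (n / (s * s * q) + \<eta> * n)"
    and \<Delta>: "\<Delta> = nat \<lfloor>\<kappa> * (D - 1) * (r / (s * s * q * (D * s * D))) + x / 2\<rfloor>"
    and t: "t = nat \<lfloor>\<tau> * n\<rfloor>" and N: "N = nat \<lceil>(1 - \<epsilon>) * r / (2 * (D * s))\<rceil>"
  shows "0 < t" "N \<le> h * \<Delta> - h * (n * x + \<Delta> * y) / t"
    "3 * t + 2 + 2 * (h * (2 * (x + \<Delta> / q + 1))) \<le>
      (s + 1 - D) * q * ((1 / 2 + \<epsilon>) * n / (s * s * q * (D * s * D)) - 2 * \<eta> * n)"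
    "s * q * (n / (s * s * q) + \<eta> * n) + 6 * t + 10 + 4 * N \<le>
      2 * ((s - 1) * q * ((1 / 2 + \<epsilon>) * n / (s * s * q) - \<eta> * n))"
    "s * q * (n / (s * s * q) + \<eta> * n) < n"
    "(1 - \<epsilon>) * r / 2 \<le> D * s * N"
proof -
  \<comment> \<open>\<open>M\<close> is the number of lines and \<rho> the number of cycles each
    line would provide if nothing were lost. The deviation \<open>x\<close> equals \<xi> times
    \<open>n\<close>.\<close>
  define d S Q M \<xi> \<rho> where "d = real D" and "S = real s" and "Q = real q"
    and "M = d * S" and "\<xi> = 4 * (S * S * d) * \<eta>" and "\<rho> = r / (2 * M)"
  have "32 \<le> 8 / \<epsilon>" using \<epsilon> by (simp add: field_simps)
  then have d: "32 \<le> d" "8 / \<epsilon> \<le> d" using D by (auto simp: d_def)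
  have d8: "8 \<le> \<epsilon> * d" using d(2) \<epsilon> by (simp add: field_simps)
  have S8: "32 * d \<le> \<epsilon> * S" using s \<epsilon> by (simp add: field_simps d_def S_def)
  have "\<epsilon> * S \<le> (1 / 4) * S" using \<epsilon> by (intro mult_right_mono) (auto simp: S_def)
  then have Sd: "128 * d \<le> S" using S8 by linarith
  have S: "4096 \<le> S" using Sd d by linarith
  have "1 * 1 \<le> d * S" using d S by (intro mult_mono) auto
  then have M: "1 \<le> M" "0 < M" by (auto simp: M_def)
  have e2: "\<epsilon>\<^sup>2 \<le> 1 / 16" "0 < \<epsilon>\<^sup>2" using \<epsilon> power_mono[of \<epsilon> "1 / 4" 2] by (auto simp: power2_eq_square)
  have \<tau>': "\<tau> = 1 / (64 * (M * M))" using \<tau> by (simp add: S_def d_def M_def mult_ac)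
  have MM: "1 \<le> M * M" using M mult_mono[of 1 M 1 M] by simp
  have \<tau>0: "0 < \<tau>" "\<tau> \<le> 1 / 64" unfolding \<tau>' using MM by (simp, intro frac_le) auto
  have q0: "0 < Q" using q(2) by (cases q) (auto simp: Q_def)
  have Q: "64 \<le> Q * (\<tau> * \<epsilon>\<^sup>2)" using q(1) \<tau>0 e2 by (simp add: field_simps Q_def)
  have nz: "d \<noteq> 0" "S \<noteq> 0" "Q \<noteq> 0" "M \<noteq> 0" using d S q0 M by auto
  have \<eta>': "\<eta> = \<epsilon>\<^sup>2 * \<tau> / (256 * M * Q * (S * S * d))"
    unfolding \<eta> by (simp add: M_def d_def S_def Q_def mult.assoc)
  have pos: "0 < S * S * d" using d S by simp
  have \<eta>0: "0 < \<eta>" unfolding \<eta>' using e2 \<tau>0 M q0 pos by simp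
  have n1: "2 + 2 * Q \<le> \<tau> * n" using n(1) by (simp add: Q_def)
  have n2: "112 * S \<le> \<epsilon> * n" using n(2) \<epsilon> by (simp add: S_def field_simps)
  have n3: "4 * M * (1 + Q) \<le> \<epsilon>\<^sup>2 * n" using n(3) \<epsilon> by (simp add: S_def d_def Q_def M_def field_simps)
  have "0 < \<tau> * n" using n1 q0 by linarith
  then have n0: "0 < n" using \<tau>0 by (simp add: zero_less_mult_iff)
  have Q\<xi>: "Q * \<xi> = \<epsilon>\<^sup>2 * \<tau> / (64 * M)"
  proof -
    have "Q * \<xi> = (4 * Q * (S * S * d)) * (\<epsilon>\<^sup>2 * \<tau>) / ((4 * Q * (S * S * d)) * (64 * M))"
      by (simp add: \<xi>_def \<eta>' mult_ac)
    also have "\<dots> = \<epsilon>\<^sup>2 * \<tau> / (64 * M)" using q0 pos by (intro nonzero_mult_divide_mult_cancel_left) auto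
    finally show ?thesis .
  qed
  have \<xi>0: "0 < \<xi>" using \<eta>0 pos by (simp add: \<xi>_def)
  have b: "\<epsilon>\<^sup>2 * \<tau> / (64 * M) \<le> \<tau> / 1024"
  proof -
    have "\<epsilon>\<^sup>2 * \<tau> / (64 * M) \<le> (1 / 16) * \<tau> / (64 * 1)"
      using e2 \<tau>0 M by (intro frac_le mult_right_mono mult_left_mono) auto
    then show ?thesis by simp
  qed
  have Q\<xi>1: "Q * \<xi> \<le> \<tau> / 1024" using Q\<xi> b by simp
  have iQ: "1 / Q \<le> \<epsilon>\<^sup>2 * \<tau> / 64" using Q q0 by (simp add: field_simps)
  have iQM: "1 / (Q * M) \<le> \<epsilon>\<^sup>2 * \<tau> / (64 * M)"
    using divide_right_mono[OF iQ, of M] M by simp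
  have iQM1: "1 / (Q * M) \<le> \<tau> / 1024" using iQM b by linarith
  have e2\<tau>: "\<epsilon>\<^sup>2 * \<tau> \<le> \<epsilon>" 
    using mult_mono[of \<epsilon> 1 \<tau> 1] mult_left_mono[of "\<epsilon> * \<tau>" 1 \<epsilon>] \<epsilon> \<tau>0 by (simp add: power2_eq_square mult.assoc)
  have iQe: "1 / Q \<le> \<epsilon> / 64" using iQ e2\<tau> by linarith
  have "1 / Q \<le> 1" using iQe \<epsilon> by linarith
  then have Q1: "1 \<le> Q" using q0 by (simp add: field_simps)
  have \<xi>Q: "\<xi> \<le> Q * \<xi>" using Q1 \<xi>0 by simp
  have SS\<eta>: "S * S * \<eta> \<le> \<xi> / 128"
  proof -
    have "128 * (S * S * \<eta>) \<le> (4 * d) * (S * S * \<eta>)" using d \<eta>0 S by (intro mult_right_mono) auto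
    then show ?thesis by (simp add: \<xi>_def mult_ac)
  qed
  have "1 * (S * \<eta>) \<le> S * (S * \<eta>)" using S \<eta>0 by (intro mult_right_mono) auto
  then have S\<eta>: "S * \<eta> \<le> \<xi> / 128" using SS\<eta> by (simp add: mult.assoc)
  have SQ\<eta>: "S * Q * \<eta> \<le> Q * \<xi> / 128" using mult_left_mono[OF S\<eta>, of Q] q0 by (simp add: mult_ac)
  have SSQ\<eta>: "S * S * Q * \<eta> \<le> Q * \<xi> / 128" using mult_left_mono[OF SS\<eta>, of Q] q0 by (simp add: mult_ac)
  have x': "x = \<xi> * n" unfolding x by (simp add: \<xi>_def S_def d_def)
  define H where "H = real h"
  have "q = 2 * h + 1" using q(2) h by (auto elim!: oddE)
  then have HQ: "Q = 2 * H + 1" by (simp add: Q_def H_def)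
  have H0: "0 \<le> H" by (simp add: H_def)
  have \<kappa>': "real \<kappa> + S + d * S + 2 = S * S + 2 * d"
    using arg_cong[OF \<kappa>, of real] by (simp add: S_def d_def)
  have "S \<le> d * S" using d S by simp
  then have \<kappa>1: "S * S - 2 * (d * S) \<le> \<kappa>" "real \<kappa> \<le> S * S" using \<kappa>' d Sd S by linarith+
  have D1: "real (D - 1) = d - 1" using d by (simp add: d_def of_nat_diff)
  define \<mu> where "\<mu> = r / (S * S * Q * (M * d))"
  have \<Delta>': "\<Delta> = nat \<lfloor>\<kappa> * (d - 1) * \<mu> + x / 2\<rfloor>"
  proof -
    have "real (\<kappa> * (D - 1)) = \<kappa> * (d - 1)" by (simp only: of_nat_mult D1)
    moreover have "r / real (s * s * q * (D * s * D)) = \<mu>" by (simp add: \<mu>_def M_def S_def Q_def d_def)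
    ultimately show ?thesis unfolding \<Delta> by (simp only:)
  qed
  have r0: "0 \<le> r" using r(1) n0 \<epsilon> by (meson less_imp_le mult_nonneg_nonneg order.trans)
  have \<mu>0: "0 \<le> \<mu>" unfolding \<mu>_def using r0 S q0 M d by (intro divide_nonneg_nonneg) auto
  have x0: "0 \<le> x" using x' \<xi>0 n0 by simp
  have arg0: "0 \<le> \<kappa> * (d - 1) * \<mu> + x / 2" using d \<mu>0 x0 by simp
  have \<Delta>up: "\<Delta> \<le> n / (Q * M) + \<xi> * n / 2"
  proof -
    have "\<Delta> \<le> \<kappa> * (d - 1) * \<mu> + x / 2" unfolding \<Delta>' using arg0 by (intro of_nat_floor)
    also have "\<kappa> * (d - 1) * \<mu> \<le> (S * S) * d * \<mu>" using \<kappa>1 d \<mu>0 by (intro mult_right_mono mult_mono) auto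
    also have "\<dots> = r / (Q * M)" using nz by (simp add: \<mu>_def)
    also have "\<dots> \<le> n / (Q * M)" using r q0 M by (intro divide_right_mono) auto
    finally show ?thesis by (simp add: x')
  qed
  have \<Delta>low: "\<kappa> * (d - 1) * \<mu> - 1 \<le> \<Delta>" unfolding \<Delta>' using x0 by linarith
  have tup: "t \<le> \<tau> * n" unfolding t using \<tau>0 n0 by (intro of_nat_floor) simp
  have "\<tau> * n - 1 \<le> t" unfolding t by linarith
  then have tlow: "\<tau> * n / 2 \<le> t" using n1 q0 by linarith
  have t0: "0 < real t" using tlow \<open>0 < \<tau> * n\<close> by linarith
  then show "0 < t" by simp
  have \<rho>0: "0 \<le> \<rho>" using r0 M by (simp add: \<rho>_def)
  have N': "N = nat \<lceil>(1 - \<epsilon>) * \<rho>\<rceil>" unfolding N by (simp add: \<rho>_def M_def d_def S_def)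
  have N0: "0 \<le> (1 - \<epsilon>) * \<rho>" using \<epsilon> \<rho>0 by simp
  have Nup: "N \<le> (1 - \<epsilon>) * \<rho> + 1" unfolding N' using N0 by linarith
  have Nlow: "(1 - \<epsilon>) * \<rho> \<le> N" unfolding N' by linarith
  have \<rho>up: "\<rho> \<le> n / (2 * M)" unfolding \<rho>_def using r M by (intro divide_right_mono) auto
  have \<rho>low: "\<epsilon> * n / (2 * M) \<le> \<rho>" unfolding \<rho>_def using r M by (intro divide_right_mono) auto
  show "(1 - \<epsilon>) * r / 2 \<le> D * s * N"
  proof -
    have "(1 - \<epsilon>) * r / 2 = M * ((1 - \<epsilon>) * \<rho>)" using M by (simp add: \<rho>_def)
    also have "\<dots> \<le> M * N" using Nlow M by (intro mult_left_mono) auto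
    finally show ?thesis by (simp add: M_def d_def S_def)
  qed
  \<comment> \<open>The admissible loss \<epsilon> is spent in three portions. The fraction 5/16 of
    it covers edges inside clusters, cells that are on the line or collinear, and the reserved index
    (bounded by 1/64, 1/16 and 1/8). The fraction 1/8 covers systems with more than \<open>t\<close>
    paths. The remaining 9/16 covers roundings: one for each of the \<open>h\<close> shifts in
    \<Delta>, and one in \<open>N\<close>.\<close>
  show "N \<le> h * \<Delta> - h * (n * x + \<Delta> * y) / t"
  proof -
    have "(1 - 5 * \<epsilon> / 16) * \<rho> \<le> H * (\<kappa> * (d - 1) * \<mu>)"
    proof -
      have a: "1 - \<epsilon> / 64 \<le> (Q - 1) / Q" using iQe q0 by (simp add: diff_divide_distrib)
      have b: "1 - \<epsilon> / 16 \<le> \<kappa> / (S * S)"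
      proof -
        have "(1 - \<epsilon> / 16) * (S * S) = S * S - (\<epsilon> * S) * S / 16" by (simp add: algebra_simps)
        also have "\<dots> \<le> S * S - (32 * d) * S / 16" using S8 S by (intro diff_left_mono divide_right_mono mult_right_mono) auto
        also have "\<dots> \<le> \<kappa>" using \<kappa>1(1) by (simp add: mult.commute)
        finally show ?thesis using S by (simp add: pos_le_divide_eq)
      qed
      have c: "1 - \<epsilon> / 8 \<le> (d - 1) / d" using d8 d by (simp add: field_simps)
      have "1 - 5 * \<epsilon> / 16 \<le> (1 - \<epsilon> / 64) * (1 - \<epsilon> / 16) * (1 - \<epsilon> / 8)"
      proof -
        have "1 - 5 * \<epsilon> / 64 \<le> (1 - \<epsilon> / 64) * (1 - \<epsilon> / 16)" by (simp add: algebra_simps)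
        then have "(1 - 5 * \<epsilon> / 64) * (1 - \<epsilon> / 8) \<le> (1 - \<epsilon> / 64) * (1 - \<epsilon> / 16) * (1 - \<epsilon> / 8)"
          using \<epsilon> by (intro mult_right_mono) auto
        moreover have "1 - 5 * \<epsilon> / 16 \<le> (1 - 5 * \<epsilon> / 64) * (1 - \<epsilon> / 8)" using \<epsilon> by (simp add: algebra_simps)
        ultimately show ?thesis by linarith
      qed
      also have "\<dots> \<le> ((Q - 1) / Q) * (\<kappa> / (S * S)) * ((d - 1) / d)"
        using a b c \<epsilon> Q1 S d by (intro mult_mono) auto
      finally have "(1 - 5 * \<epsilon> / 16) * \<rho> \<le> ((Q - 1) / Q) * (\<kappa> / (S * S)) * ((d - 1) / d) * \<rho>"
        using \<rho>0 by (rule mult_right_mono)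
      also have "\<dots> = H * (\<kappa> * (d - 1) * \<mu>)"
      proof -
        have "(2 * a / Q) * (k / (S * S)) * (e / d) * (r / (2 * M)) = a * (k * e * (r / (S * S * Q * (M * d))))" for a k e
          by (simp add: mult_ac)
        moreover have "Q - 1 = 2 * H" using HQ by simp
        ultimately show ?thesis by (simp only: \<rho>_def \<mu>_def)
      qed
      finally show ?thesis .
    qed
    moreover have "H * (\<kappa> * (d - 1) * \<mu>) - H \<le> H * \<Delta>"
      using mult_left_mono[OF \<Delta>low H0] by (simp add: algebra_simps)
    \<comment> \<open>Here the sizes of \<open>q\<close> and \<eta> originate: they make both
      \<open>Q * \<xi>\<close> and \<open>1 / (Q * M)\<close> at most
      \<open>\<epsilon>\<^sup>2 * \<tau> / (64 * M)\<close>. One factor \<tau> pays for the division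
      by \<open>t\<close>, and one factor \<epsilon> for \<rho> being possibly as small as
      \<open>\<epsilon> * n / (2 * M)\<close>.\<close>
    moreover have "H * (n * x + \<Delta> * y) / t \<le> \<epsilon> / 8 * \<rho>"
    proof -
      have "y = n / Q + S * S * \<eta> * n"
        using nz unfolding y by (simp add: S_def Q_def algebra_simps)
      also have "S * S * \<eta> \<le> 1 / Q"
      proof -
        have "Q * \<xi> \<le> 1" using Q\<xi>1 \<tau>0 by linarith
        then have "\<xi> \<le> 1 / Q" using q0 by (simp add: field_simps)
        then show ?thesis using SS\<eta> \<xi>0 by linarith
      qed
      then have "n / Q + S * S * \<eta> * n \<le> n / Q + 1 / Q * n" using n0 by (intro add_left_mono mult_right_mono) auto
      finally have yup: "y \<le> 2 * n / Q" by simp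
      have y0: "0 \<le> y" unfolding y using n0 \<eta>0 by simp
      have "\<Delta> * y \<le> (n / (Q * M) + \<xi> * n / 2) * (2 * n / Q)"
        using \<Delta>up yup y0 n0 q0 M \<xi>0 by (intro mult_mono) auto
      also have "\<dots> = n * n * (2 / (Q * (Q * M)) + \<xi> / Q)" using nz by (simp add: field_simps)
      also have "\<dots> \<le> n * n * (2 / (Q * (Q * M)) + \<xi>)"
        using n0 Q1 \<xi>0 by (intro mult_left_mono add_left_mono) (auto simp: field_simps)
      finally have "n * x + \<Delta> * y \<le> n * n * (2 * \<xi> + 2 / (Q * (Q * M)))"
        unfolding x' by (simp add: algebra_simps)
      then have "H * (n * x + \<Delta> * y) \<le> (Q / 2) * (n * n * (2 * \<xi> + 2 / (Q * (Q * M))))"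
        using HQ H0 n0 x0 y0 by (intro mult_mono) auto
      also have "\<dots> = n * n * (Q * \<xi> + 1 / (Q * M))" using nz by (simp add: field_simps)
      also have "\<dots> \<le> n * n * (\<epsilon>\<^sup>2 * \<tau> / (64 * M) + \<epsilon>\<^sup>2 * \<tau> / (64 * M))"
        using Q\<xi> iQM n0 by (intro mult_left_mono add_mono) auto
      also have "\<dots> = (\<tau> * n / 2) * (\<epsilon> / 8 * (\<epsilon> * n / (2 * M)))"
        using M by (simp add: field_simps power2_eq_square)
      also have "\<dots> \<le> t * (\<epsilon> / 8 * \<rho>)"
        using tlow \<rho>low \<epsilon> \<tau>0 n0 M by (intro mult_mono mult_left_mono) auto
      finally show ?thesis using t0 by (simp add: divide_le_eq mult.commute)
    qed
    moreover have "1 + H \<le> 9 * \<epsilon> / 16 * \<rho>"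
    proof -
      have "4 * M * (1 + Q) / (2 * M) \<le> \<epsilon> * (\<epsilon> * n / (2 * M))"
        using divide_right_mono[OF n3, of "2 * M"] M by (simp add: power2_eq_square)
      also have "\<dots> \<le> \<epsilon> * \<rho>" using \<rho>low \<epsilon> by (intro mult_left_mono) auto
      finally have "2 * (1 + Q) \<le> \<epsilon> * \<rho>" using M by simp
      then show ?thesis using HQ H0 by (simp add: algebra_simps)
    qed
    moreover have "b - l \<ge> m" if "(1 - 5 * \<epsilon> / 16) * \<rho> \<le> a" "a - H \<le> b" "l \<le> \<epsilon> / 8 * \<rho>"
      "1 + H \<le> 9 * \<epsilon> / 16 * \<rho>" "m \<le> (1 - \<epsilon>) * \<rho> + 1" for a b l m
      using that by (simp add: algebra_simps)
    ultimately have "N \<le> H * \<Delta> - H * (n * x + \<Delta> * y) / t"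
      using Nup by blast
    then show ?thesis by (simp add: H_def)
  qed
  show "3 * t + 2 + 2 * (h * (2 * (x + \<Delta> / q + 1))) \<le>
      (s + 1 - D) * q * ((1 / 2 + \<epsilon>) * n / (s * s * q * (D * s * D)) - 2 * \<eta> * n)"
  proof -
    have "4 * H * (x + \<Delta> / Q + 1) \<le> 2 * Q * (x + \<Delta> / Q + 1)"
      using HQ x0 q0 by (intro mult_right_mono) auto
    also have "\<dots> = 2 * (Q * \<xi>) * n + 2 * \<Delta> + 2 * Q" using nz by (simp add: x' algebra_simps)
    also have "2 * \<Delta> \<le> 2 * (1 / (Q * M)) * n + \<xi> * n" using \<Delta>up by simp
    finally have "4 * H * (x + \<Delta> / Q + 1) \<le> (2 * (Q * \<xi>) + 2 * (1 / (Q * M)) + \<xi>) * n + 2 * Q"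
      by (simp add: algebra_simps)
    also have "\<dots> \<le> \<tau> * n + 2 * Q"
      using Q\<xi>1 iQM1 \<xi>Q \<tau>0 n0 by (intro add_right_mono mult_right_mono) auto
    finally have 1: "3 * t + 2 + 4 * H * (x + \<Delta> / Q + 1) \<le> 5 * (\<tau> * n)" using tup n1 by linarith
    \<comment> \<open>Half of the cells of a line already provide \<open>n / (4 * M * M)\<close>
      link neighbours up to discrepancy. As \<tau> is \<open>1 / (64 * M * M)\<close>, this is
      \<open>16 * \<tau> * n\<close>, while only \<open>5 * \<tau> * n\<close> is required.\<close>
    let ?\<beta> = "n / (2 * (S * S * Q * (M * d))) - 2 * \<eta> * n"
    have "S * Q / 2 * ?\<beta> = n / (4 * (M * M)) - S * Q * \<eta> * n"
      using nz by (simp add: field_simps M_def)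
    also have "n / (4 * (M * M)) = 16 * \<tau> * n" by (simp add: \<tau>')
    also have "16 * \<tau> * n - S * Q * \<eta> * n = (16 * \<tau> - S * Q * \<eta>) * n" by (simp add: algebra_simps)
    finally have eq: "S * Q / 2 * ?\<beta> = (16 * \<tau> - S * Q * \<eta>) * n" .
    have "5 * \<tau> * n \<le> (16 * \<tau> - S * Q * \<eta>) * n"
      using SQ\<eta> Q\<xi>1 \<tau>0 n0 by (intro mult_right_mono) auto
    then have 2: "5 * (\<tau> * n) \<le> S * Q / 2 * ?\<beta>" using eq by simp
    have "0 < S * Q / 2 * ?\<beta>" using 2 \<open>0 < \<tau> * n\<close> by linarith
    moreover have "0 < S * Q / 2" using S q0 by simp
    ultimately have \<beta>0: "0 \<le> ?\<beta>" using zero_less_mult_pos less_imp_le by blast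
    have "S * Q / 2 * ?\<beta> \<le> (S + 1 - d) * Q * ?\<beta>"
      using \<beta>0 Sd d q0 by (intro mult_right_mono) auto
    also have "\<dots> \<le> (S + 1 - d) * Q * ((1 / 2 + \<epsilon>) * n / (S * S * Q * (M * d)) - 2 * \<eta> * n)"
    proof (intro mult_left_mono diff_right_mono)
      have "n / (2 * (S * S * Q * (M * d))) = (1 / 2) * n / (S * S * Q * (M * d))" by simp
      also have "\<dots> \<le> (1 / 2 + \<epsilon>) * n / (S * S * Q * (M * d))"
        using \<epsilon> n0 S q0 M d by (intro divide_right_mono mult_right_mono) auto
      finally show "n / (2 * (S * S * Q * (M * d))) \<le> (1 / 2 + \<epsilon>) * n / (S * S * Q * (M * d))" .
    qed (use Sd d q0 in auto)
    finally have 3: "3 * t + 2 + 4 * H * (x + \<Delta> / Q + 1) \<le>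
      (S + 1 - d) * Q * ((1 / 2 + \<epsilon>) * n / (S * S * Q * (M * d)) - 2 * \<eta> * n)"
      using 1 2 by linarith
    have "real ((s + 1 - D) * q) = (S + 1 - d) * Q"
      using Sd d by (simp add: S_def d_def Q_def of_nat_diff)
    moreover have "real (s * s * q * (D * s * D)) = S * S * Q * (M * d)" by (simp add: S_def d_def Q_def M_def)
    moreover have "real (3 * t + 2) + 2 * (real h * (2 * (x + real \<Delta> / real q + 1))) =
      3 * real t + 2 + 4 * H * (x + \<Delta> / Q + 1)" by (simp add: H_def Q_def)
    ultimately show ?thesis using 3 by (simp only:)
  qed
  have lhs: "real (s * q) * (n / real (s * s * q) + \<eta> * n) = n / S + S * Q * \<eta> * n"
    using nz by (simp add: S_def Q_def field_simps)
  show "s * q * (n / (s * s * q) + \<eta> * n) < n"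
  proof -
    have "1 / S + S * Q * \<eta> < 1"
    proof -
      have "1 / S \<le> 1 / 2" using S by (simp add: field_simps)
      then show ?thesis using SQ\<eta> Q\<xi>1 \<tau>0 by linarith
    qed
    then have "(1 / S + S * Q * \<eta>) * n < 1 * n" using n0 by (intro mult_strict_right_mono)
    then show ?thesis unfolding lhs by (simp add: algebra_simps)
  qed
  show "s * q * (n / (s * s * q) + \<eta> * n) + 6 * t + 10 + 4 * N \<le>
      2 * ((s - 1) * q * ((1 / 2 + \<epsilon>) * n / (s * s * q) - \<eta> * n))"
  proof -
    have "(1 - \<epsilon>) * \<rho> \<le> 1 * \<rho>" using \<epsilon> \<rho>0 by (intro mult_right_mono) auto
    then have "4 * N \<le> 4 * \<rho> + 4" using Nup by simp
    also have "\<dots> \<le> 2 * n / M + 4" using \<rho>up by simp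
    finally have N4: "4 * N \<le> 2 * n / M + 4" .
    have c1: "S * S * Q * \<eta> \<le> \<epsilon> / 128"
    proof -
      have "\<epsilon>\<^sup>2 * \<tau> / (64 * M) \<le> \<epsilon> / 1" using e2\<tau> M \<epsilon> by (intro frac_le) auto
      then show ?thesis using SSQ\<eta> Q\<xi> by simp
    qed
    have c2: "6 * \<tau> * S \<le> \<epsilon> / 64"
    proof -
      have "\<tau> * S = 1 / (64 * (M * d))" using nz by (simp add: \<tau>' M_def)
      also have "\<dots> \<le> 1 / (64 * (1 * d))" using M d by (intro divide_left_mono mult_left_mono mult_right_mono) auto
      also have "\<dots> \<le> \<epsilon> / 512" using d8 d by (simp add: field_simps)
      finally show ?thesis using \<epsilon> by simp
    qed
    have c3: "2 / S \<le> \<epsilon> / 16"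
    proof -
      have "32 * 1 \<le> \<epsilon> * S" using S8 d by linarith
      then show ?thesis using S by (simp add: field_simps)
    qed
    \<comment> \<open>The only use of edges inside a line that grows with the number of cycles.
      Relative to the size of the line it is \<open>2 / d\<close>, and the lower bound on
      \<open>D\<close> makes this at most a quarter of \<epsilon>; the other losses are made small
      by \<open>s\<close>, \<tau>, \<eta> and \<open>n\<close>.\<close>
    have c4: "2 * S / M \<le> \<epsilon> / 4" using d8 d nz by (simp add: M_def field_simps)
    have "S * (n / S + S * Q * \<eta> * n + 6 * (\<tau> * n) + 14 + 2 * n / M)
      = n + (S * S * Q * \<eta>) * n + (6 * \<tau> * S) * n + 14 * S + (2 * S / M) * n"
      using nz by (simp add: field_simps)
    also have "\<dots> \<le> n + \<epsilon> / 128 * n + \<epsilon> / 64 * n + \<epsilon> * n / 8 + \<epsilon> / 4 * n"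
      using c1 c2 c4 n2 n0 by (intro add_mono mult_right_mono) auto
    also have "\<dots> \<le> (1 + 2 * \<epsilon> - 2 / S - 2 * (S * S * Q * \<eta>)) * n"
    proof -
      have "1 + \<epsilon> / 128 + \<epsilon> / 64 + \<epsilon> / 8 + \<epsilon> / 4 \<le> 1 + 2 * \<epsilon> - 2 / S - 2 * (S * S * Q * \<eta>)"
        using c1 c3 \<epsilon> by linarith
      from mult_right_mono[OF this, of n] n0 show ?thesis by (simp add: algebra_simps)
    qed
    also have "\<dots> \<le> ((1 - 1 / S) * (1 + 2 * \<epsilon>) - 2 * (S - 1) * (S * Q * \<eta>)) * n"
    proof (intro mult_right_mono diff_mono)
      have "(1 + 2 * \<epsilon>) / S \<le> 2 / S" using \<epsilon> S by (intro divide_right_mono) auto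
      then show "1 + 2 * \<epsilon> - 2 / S \<le> (1 - 1 / S) * (1 + 2 * \<epsilon>)" by (simp add: algebra_simps add_divide_distrib)
      have "(S - 1) * (S * Q * \<eta>) \<le> S * (S * Q * \<eta>)" using S q0 \<eta>0 by (intro mult_right_mono) auto
      then show "2 * (S - 1) * (S * Q * \<eta>) \<le> 2 * (S * S * Q * \<eta>)" by (simp add: algebra_simps)
    qed (use n0 in simp)
    also have "\<dots> = S * (2 * ((S - 1) * Q * ((1 / 2 + \<epsilon>) * n / (S * S * Q) - \<eta> * n)))"
      using nz by (simp add: field_simps)
    finally have "n / S + S * Q * \<eta> * n + 6 * (\<tau> * n) + 14 + 2 * n / M \<le>
       2 * ((S - 1) * Q * ((1 / 2 + \<epsilon>) * n / (S * S * Q) - \<eta> * n))"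
      using S by (simp add: mult_le_cancel_left_pos)
    then have "n / S + S * Q * \<eta> * n + 6 * t + 10 + 4 * N \<le>
       2 * ((S - 1) * Q * ((1 / 2 + \<epsilon>) * n / (S * S * Q) - \<eta> * n))"
      using N4 tup by linarith
    moreover have "real ((s - 1) * q) = (S - 1) * Q" using S by (simp add: S_def Q_def of_nat_diff)
    moreover have "real (s * s * q) = S * S * Q" by (simp add: S_def Q_def)
    moreover have "real (6 * t) = 6 * real t" "real (4 * N) = 4 * real N" by simp_all
    ultimately show ?thesis unfolding lhs by (simp only:)
  qed
qed

section \<open>The theorem\<close>

text \<open>Two colourings are chosen in succession. The vertex colouring is balanced on
  \<open>V\<close> and on all neighbourhoods in the two graphs. Given it, the edge colouring is
  balanced on the edges from each vertex into each colour class. Each step costs \<eta>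
  \<open>n\<close>, whence the factor 2 in the locale.\<close>

lemma exists_coloured_graph:
  fixes \<epsilon> \<eta> :: real and s D q P r :: nat
  assumes fV: "finite V" and HG: "EH \<subseteq> EG" and EG: "\<And>e. e \<in> EG \<Longrightarrow> e \<subseteq> V"
    and degG: "\<And>v. v \<in> V \<Longrightarrow> (1 / 2 + \<epsilon>) * card V \<le> card (nbrs EG V v)"
    and degH: "\<And>v. v \<in> V \<Longrightarrow> card (nbrs EH V v) = r"
    and s: "prime s" and q: "prime q" and D: "0 < D" "D \<le> s" and P: "0 < P" and \<eta>: "0 < \<eta>" "\<eta> \<le> 1"
    and small: "(4 * card V + 2) * (s * s * q * (D * s * P)) * exp (- (card V * (\<eta>\<^sup>2 / 4))) < 1"
  shows "\<exists>f col. coloured_graph V EG EH f col s D q P \<epsilon> \<eta> r (card V)"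
proof -
  let ?n = "card V"
  define C1 where "C1 = plane s \<times> {..<q}"
  define C2 where "C2 = ({..<D} \<times> {..<s}) \<times> {..<P}"
  have s0: "0 < s" "0 < q" using s q prime_gt_0_nat by auto
  have "((0, 0), 0) \<in> C1" "((0, 0), 0) \<in> C2" using s0 D P by (auto simp: C1_def C2_def)
  then have C1: "finite C1" "card C1 = s * s * q" "C1 \<noteq> {}"
    and C2: "finite C2" "card C2 = D * s * P" "C2 \<noteq> {}"
    by (auto simp: C1_def C2_def card_cartesian_product)
  have c2: "1 \<le> D * s * P" using s0 D P by (simp add: Suc_le_eq)
  have fEG: "finite EG" using EG fV by (intro finite_subset[of EG "Pow V"]) auto
  let ?X = "exp (- (?n * (\<eta>\<^sup>2 / 4)))"
  define \<F>1 where "\<F>1 = insert V (nbrs EG V ` V \<union> nbrs EH V ` V)"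
  have cF1: "card \<F>1 \<le> 2 * ?n + 1"
  proof -
    have "card \<F>1 \<le> Suc (card (nbrs EG V ` V \<union> nbrs EH V ` V))" unfolding \<F>1_def by (rule card_insert_le_m1) simp_all
    also have "card (nbrs EG V ` V \<union> nbrs EH V ` V) \<le> card (nbrs EG V ` V) + card (nbrs EH V ` V)" by (rule card_Un_le)
    also have "\<dots> \<le> ?n + ?n" using fV by (intro add_mono card_image_le)
    finally show ?thesis by simp
  qed
  have small': "real ((4 * ?n + 2) * (s * s * q * (D * s * P))) * ?X < 1" using small by simp
  have F1: "finite \<F>1" using fV by (simp add: \<F>1_def)
  have F1V: "S \<subseteq> V" if "S \<in> \<F>1" for S using that nbrs_sub by (fastforce simp: \<F>1_def)
  have F1n: "card S \<le> ?n" if "S \<in> \<F>1" for S using F1V[OF that] fV by (simp add: card_mono)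
  have F1small: "real (2 * card \<F>1 * card C1) * exp (- (?n * \<eta>\<^sup>2 / 4)) < 1"
  proof -
    have "2 * card \<F>1 * (s * s * q) \<le> (4 * ?n + 2) * (s * s * q * (D * s * P))"
    proof (rule mult_le_mono)
      show "s * s * q \<le> s * s * q * (D * s * P)" using mult_le_mono2[OF c2, of "s * s * q"] by simp
    qed (use cF1 in simp)
    then have "real (2 * card \<F>1 * card C1) \<le> real ((4 * ?n + 2) * (s * s * q * (D * s * P)))"
      unfolding C1(2) by (simp only: of_nat_le_iff)
    then have "real (2 * card \<F>1 * card C1) * ?X \<le> real ((4 * ?n + 2) * (s * s * q * (D * s * P))) * ?X"
      by (intro mult_right_mono) auto
    then have "real (2 * card \<F>1 * card C1) * ?X < 1" using small' by linarith
    then show ?thesis by (simp only: times_divide_eq_right)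
  qed
  have "\<exists>f. (\<forall>v\<in>V. f v \<in> C1) \<and>
    (\<forall>S\<in>\<F>1. \<forall>c\<in>C1. \<bar>card {x \<in> S. f x = c} - card S / card C1\<bar> \<le> \<eta> * ?n)"
    by (rule balanced_colouring[OF fV C1(1,3) F1 _ _ \<eta> F1small]) (erule F1V F1n)+
  then obtain f where f0: "\<forall>v\<in>V. f v \<in> C1"
    "\<forall>S\<in>\<F>1. \<forall>c\<in>C1. \<bar>card {x \<in> S. f x = c} - card S / card C1\<bar> \<le> \<eta> * ?n"
    by (elim exE conjE)
  have fC: "f v \<in> C1" if "v \<in> V" for v
    using f0(1) that by blast
  have f: "\<bar>card {x \<in> S. f x = c} - card S / card C1\<bar> \<le> \<eta> * ?n" if "S \<in> \<F>1" "c \<in> C1" for S c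
    using f0(2) that by blast
  \<comment> \<open>The second colouring acts on edges, so the neighbours of \<open>v\<close> with
    colour \<open>c\<close> are encoded as edges at \<open>v\<close>. This map is injective, so
    cardinalities are kept.\<close>
  define star where "star E = (\<lambda>(v, c). (\<lambda>u. {v, u}) ` {u \<in> nbrs E V v. f u = c})" for E
  define \<F>2 where "\<F>2 = star EG ` (V \<times> C1) \<union> star EH ` (V \<times> C1)"
  have inj: "inj_on (\<lambda>u. {v, u}) (nbrs E V v)" for E v by (auto simp: inj_on_def nbrs_def doubleton_eq_iff)
  have cS: "card (star E (v, c)) = card {u \<in> nbrs E V v. f u = c}" for E v c
    unfolding star_def using inj[of v E] by (simp add: card_image inj_on_def)
  have cF2: "card \<F>2 \<le> 2 * ?n * (s * s * q)"
  proof -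
    have "card \<F>2 \<le> card (star EG ` (V \<times> C1)) + card (star EH ` (V \<times> C1))" unfolding \<F>2_def by (rule card_Un_le)
    also have "\<dots> \<le> card (V \<times> C1) + card (V \<times> C1)" using fV C1 by (intro add_mono card_image_le) auto
    finally show ?thesis by (simp add: card_cartesian_product C1(2))
  qed
  have F2: "finite \<F>2" using fV C1 by (simp add: \<F>2_def)
  have F2E: "S \<subseteq> EG" if "S \<in> \<F>2" for S
    using that HG by (auto simp: \<F>2_def star_def nbrs_def)
  have F2n: "card S \<le> ?n" if S2: "S \<in> \<F>2" for S
  proof -
    obtain E p where "S = star E p" using S2 unfolding \<F>2_def by blast
    moreover obtain v c where "p = (v, c)" by (cases p)
    ultimately have S: "S = star E (v, c)" by simp
    have "card {u \<in> nbrs E V v. f u = c} \<le> card V" using fV by (intro card_mono) (auto simp: nbrs_def)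
    then show ?thesis using cS S by simp
  qed
  have F2small: "real (2 * card \<F>2 * card C2) * exp (- (?n * \<eta>\<^sup>2 / 4)) < 1"
  proof -
    have "2 * card \<F>2 \<le> (4 * ?n + 2) * (s * s * q)" using cF2 by (simp add: algebra_simps)
    then have "2 * card \<F>2 * card C2 \<le> (4 * ?n + 2) * (s * s * q) * (D * s * P)"
      unfolding C2(2) by (rule mult_le_mono1)
    then have "real (2 * card \<F>2 * card C2) \<le> real ((4 * ?n + 2) * (s * s * q * (D * s * P)))"
      by (simp only: of_nat_le_iff mult.assoc)
    then have "real (2 * card \<F>2 * card C2) * ?X \<le> real ((4 * ?n + 2) * (s * s * q * (D * s * P))) * ?X"
      by (intro mult_right_mono) auto
    then have "real (2 * card \<F>2 * card C2) * ?X < 1" using small' by linarith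
    then show ?thesis by (simp only: times_divide_eq_right)
  qed
  have "\<exists>col. (\<forall>e\<in>EG. col e \<in> C2) \<and>
    (\<forall>S\<in>\<F>2. \<forall>c\<in>C2. \<bar>card {x \<in> S. col x = c} - card S / card C2\<bar> \<le> \<eta> * ?n)"
    by (rule balanced_colouring[OF fEG C2(1,3) F2 _ _ \<eta> F2small]) (erule F2E F2n)+
  then obtain col where col0: "\<forall>S\<in>\<F>2. \<forall>c\<in>C2. \<bar>card {x \<in> S. col x = c} - card S / card C2\<bar> \<le> \<eta> * ?n"
    by (elim exE conjE)
  have col: "\<bar>card {x \<in> S. col x = c} - card S / card C2\<bar> \<le> \<eta> * ?n" if "S \<in> \<F>2" "c \<in> C2" for S c
    using col0 that by blast
  have col': "\<bar>card {u \<in> nbrs E V v. f u = c \<and> col {v, u} = k} - card {u \<in> nbrs E V v. f u = c} / card C2\<bar> \<le> \<eta> * ?n"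
    if "E = EG \<or> E = EH" "v \<in> V" "c \<in> C1" "k \<in> C2" for E v c k
  proof -
    have "star E (v, c) \<in> \<F>2" using that by (auto simp: \<F>2_def)
    moreover have "{x \<in> star E (v, c). col x = k} = (\<lambda>u. {v, u}) ` {u \<in> nbrs E V v. f u = c \<and> col {v, u} = k}"
      by (auto simp: star_def)
    moreover have "card \<dots> = card {u \<in> nbrs E V v. f u = c \<and> col {v, u} = k}"
      using inj[of v E] by (intro card_image) (auto simp: inj_on_def)
    ultimately show ?thesis using col[of "star E (v, c)" k] that(4) cS by simp
  qed
  have "1 \<le> card C2" using c2 unfolding C2(2) .
  then have K1: "1 \<le> real (card C2)" by linarith
  have \<eta>n: "0 \<le> \<eta> * ?n" using \<eta> by simp
  have \<eta>nK: "\<eta> * ?n / card C2 \<le> \<eta> * ?n" using K1 \<eta>n by (simp add: divide_le_eq mult_le_cancel_left1)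
  have "coloured_graph V EG EH f col s D q P \<epsilon> \<eta> r (card V)"
  proof
    show "f v \<in> plane s \<times> {..<q}" if "v \<in> V" for v using fC[OF that] by (simp add: C1_def)
    show "card {v \<in> V. f v = c} \<le> real ?n / (s * s * q) + \<eta> * ?n" if "c \<in> plane s \<times> {..<q}" for c
      using f[of V c] that by (simp add: \<F>1_def C1(2) flip: C1_def)
    fix v c assume v: "v \<in> V" and c: "c \<in> plane s \<times> {..<q}"
    have cC: "c \<in> C1" using c by (simp add: C1_def)
    have G1: "(1 / 2 + \<epsilon>) * real ?n / card C1 - \<eta> * ?n \<le> card {u \<in> nbrs EG V v. f u = c}"
    proof -
      have "(1 / 2 + \<epsilon>) * real ?n / card C1 \<le> card (nbrs EG V v) / card C1"
        using degG[OF v] by (intro divide_right_mono) auto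
      then show ?thesis using f[of "nbrs EG V v" c] cC v by (auto simp: \<F>1_def abs_le_iff)
    qed
    then show "(1 / 2 + \<epsilon>) * real ?n / (s * s * q) - \<eta> * ?n \<le> card {u \<in> nbrs EG V v. f u = c}"
      by (simp only: C1(2))
    fix k assume k: "k \<in> ({..<D} \<times> {..<s}) \<times> {..<P}"
    have kC: "k \<in> C2" using k by (simp add: C2_def)
    have CC: "real (s * s * q * (D * s * P)) = card C1 * card C2" by (simp add: C1(2) C2(2))
    show "\<bar>card {u \<in> nbrs EH V v. f u = c \<and> col {v, u} = k} - real r / (s * s * q * (D * s * P))\<bar> \<le> 2 * \<eta> * ?n"
    proof -
      have "\<bar>card {u \<in> nbrs EH V v. f u = c} - real r / card C1\<bar> \<le> \<eta> * ?n"
        using f[of "nbrs EH V v" c] cC v degH[OF v] by (simp add: \<F>1_def)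
      then have div: "\<bar>card {u \<in> nbrs EH V v. f u = c} - real r / card C1\<bar> / card C2 \<le> \<eta> * ?n / card C2"
        by (intro divide_right_mono) auto
      have "\<bar>card {u \<in> nbrs EH V v. f u = c} / card C2 - real r / (card C1 * card C2)\<bar> \<le> \<eta> * ?n"
      proof -
        have "card {u \<in> nbrs EH V v. f u = c} / card C2 - real r / (card C1 * card C2) =
          (card {u \<in> nbrs EH V v. f u = c} - real r / card C1) / card C2"
          by (simp add: diff_divide_distrib)
        then show ?thesis using order.trans[OF div \<eta>nK] by (simp only: abs_divide abs_of_nat)
      qed
      then show ?thesis using col'[of EH v c k] v cC kC unfolding CC by (simp add: abs_le_iff)
    qed
    show "(1 / 2 + \<epsilon>) * real ?n / (s * s * q * (D * s * P)) - 2 * \<eta> * ?n \<le> card {u \<in> nbrs EG V v. f u = c \<and> col {v, u} = k}"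
    proof -
      have "((1 / 2 + \<epsilon>) * real ?n / card C1 - \<eta> * ?n) / card C2 \<le> card {u \<in> nbrs EG V v. f u = c} / card C2"
        using G1 by (intro divide_right_mono) auto
      then have "(1 / 2 + \<epsilon>) * real ?n / (card C1 * card C2) - \<eta> * ?n \<le> card {u \<in> nbrs EG V v. f u = c} / card C2"
        using \<eta>nK by (simp add: diff_divide_distrib)
      then show ?thesis using col'[of EG v c k] v cC kC unfolding CC by (simp add: abs_le_iff)
    qed
  qed (use fV HG s q D P \<eta> in auto)
  then show ?thesis by blast
qed

text \<open>The losses are measured against \<open>n\<close> but must be small against
  \<open>r\<close>; hence the lower bound on \<open>r\<close>. All constants are chosen from
  \<epsilon> alone, so \<open>n0\<close> serves every \<open>G\<close>, \<open>H\<close> and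
  \<open>r\<close>.\<close>

lemma hamilton_cycles_dense:
  fixes \<epsilon> :: real
  assumes \<epsilon>: "0 < \<epsilon>" "\<epsilon> \<le> 1 / 4"
  shows "\<exists>n0::nat. \<forall>G :: 'a graph. \<forall>H r. simple_graph G \<and> n0 \<le> card (verts G) \<and>
    (\<forall>v\<in>verts G. (1 / 2 + \<epsilon>) * card (verts G) \<le> degree G v) \<and> factor r H G \<and> \<epsilon> * card (verts G) \<le> r \<longrightarrow>
    (\<exists>\<C>. finite \<C> \<and> (\<forall>C\<in>\<C>. hamilton_cycle C G) \<and> pairwise edge_disjoint \<C> \<and>
      (1 - \<epsilon>) * r / 2 \<le> card \<C>)"
proof -
  define D where "D = nat \<lceil>8 / \<epsilon>\<rceil>"
  have D: "8 / \<epsilon> \<le> real D" unfolding D_def by (rule real_nat_ceiling_ge)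
  have "0 < 8 / \<epsilon>" using \<epsilon> by simp
  then have D0: "0 < D" using D by linarith
  obtain s where s: "prime s" "nat \<lceil>32 * D / \<epsilon>\<rceil> < s" using bigger_prime by blast
  have sD: "32 * D / \<epsilon> \<le> real s" using s(2) by linarith
  have s0: "0 < s" using s prime_gt_0_nat by blast
  define \<tau> where "\<tau> = 1 / real (64 * s * (D * s * D))"
  \<comment> \<open>The summand 2 makes the prime odd, so that its nonzero shifts pair up.\<close>
  obtain q where q: "prime q" "nat \<lceil>64 / (\<tau> * \<epsilon>\<^sup>2)\<rceil> + 2 < q" using bigger_prime by blast
  have q1: "64 / (\<tau> * \<epsilon>\<^sup>2) \<le> real q" using q(2) by linarith
  have q2: "odd q" using q prime_odd_nat by simp
  define \<eta> where "\<eta> = \<epsilon>\<^sup>2 * \<tau> / (256 * (D * s) * q * (s * s * D))"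
  have \<tau>: "0 < \<tau>" "\<tau> \<le> 1" using D0 s0 by (auto simp: \<tau>_def field_simps Suc_le_eq simp flip: of_nat_mult)
  have q0: "0 < q" using q by simp
  have \<eta>: "0 < \<eta>" unfolding \<eta>_def using \<epsilon> \<tau> D0 s0 q0 by simp
  have \<eta>1: "\<eta> \<le> 1"
  proof -
    have "\<epsilon>\<^sup>2 * \<tau> \<le> 1 * 1" using \<epsilon> \<tau> by (intro mult_mono) (auto simp: power_le_one)
    moreover have "1 \<le> real (256 * (D * s) * q * (s * s * D))"
      using D0 s0 q0 by (simp add: Suc_le_eq flip: of_nat_mult)
    ultimately show ?thesis unfolding \<eta>_def by (subst divide_le_eq_1_pos) linarith+
  qed
  define c where "c = real (s * s * q * (D * s * D))"
  have c: "0 < c" using D0 s0 q0 by (simp add: c_def)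
  \<comment> \<open>The sum of all lower bounds imposed on the number of vertices: three from
    \<open>counting_inequalities\<close>, one from \<open>linear_times_exp_small\<close>, and 3 for
    the existence of a cycle.\<close>
  define b where "b = (2 + 2 * real q) / \<tau> + 112 * s / \<epsilon> + 4 * (D * s) * (1 + q) / \<epsilon>\<^sup>2 + 12 * c / (\<eta>\<^sup>2 / 4)\<^sup>2 + 3"
  define n0 where "n0 = nat \<lceil>b\<rceil> + 1"
  show ?thesis
  proof (intro exI[of _ n0] allI impI, elim conjE)
    fix G :: "'a graph" and H r
    assume G: "simple_graph G" and nG: "n0 \<le> card (verts G)"
      and deg: "\<forall>v\<in>verts G. (1 / 2 + \<epsilon>) * card (verts G) \<le> degree G v"
      and H: "factor r H G" and r: "\<epsilon> * card (verts G) \<le> r"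
    let ?V = "verts G" and ?n = "card (verts G)"
    have "b < ?n" using nG unfolding n0_def by linarith
    then have bn: "(2 + 2 * real q) / \<tau> + 112 * s / \<epsilon> + 4 * (D * s) * (1 + q) / \<epsilon>\<^sup>2 + 12 * c / (\<eta>\<^sup>2 / 4)\<^sup>2 + 3 < ?n"
      by (simp only: b_def)
    have b0: "0 \<le> (2 + 2 * real q) / \<tau>" "0 \<le> 112 * s / \<epsilon>" "0 \<le> 4 * (D * s) * (1 + q) / \<epsilon>\<^sup>2" "0 \<le> 12 * c / (\<eta>\<^sup>2 / 4)\<^sup>2"
      using \<tau> \<epsilon> c by auto
    have n: "(2 + 2 * real q) / \<tau> \<le> ?n" "112 * s / \<epsilon> \<le> ?n" "4 * (D * s) * (1 + q) / \<epsilon>\<^sup>2 \<le> ?n"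
      "12 * c / (\<eta>\<^sup>2 / 4)\<^sup>2 < ?n" "3 < real ?n"
      using bn b0 by linarith+
    have n3: "3 \<le> ?n" using n(5) by simp
    have fV: "finite ?V" using G by (simp add: simple_graph_def)
    have HG: "simple_graph H" "verts H = ?V" "edges H \<subseteq> edges G" "\<And>v. v \<in> ?V \<Longrightarrow> degree H v = r"
      using H by (auto simp: factor_def spanning_subgraph_def regular_def)
    have dH: "card (nbrs (edges H) ?V v) = r" if "v \<in> ?V" for v
      using card_degree_nbrs[OF HG(1), of v] HG that by simp
    have dG: "(1 / 2 + \<epsilon>) * ?n \<le> card (nbrs (edges G) ?V v)" if "v \<in> ?V" for v
      using deg that unfolding card_degree_nbrs[OF G that, symmetric] by blast
    have rn: "real r \<le> ?n"
    proof -
      obtain v where v: "v \<in> ?V" using n(5) by fastforce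
      have "card (nbrs (edges H) ?V v) \<le> ?n" using fV nbrs_sub by (intro card_mono)
      then show ?thesis using dH[OF v] by simp
    qed
    have "32 * real D * \<epsilon> \<le> 32 * real D * 1" using \<epsilon> by (intro mult_left_mono) auto
    then have "32 * D \<le> 32 * D / \<epsilon>" using \<epsilon> by (simp add: pos_le_divide_eq)
    then have "32 * real D \<le> s" using sD by simp
    then have Ds: "32 * D \<le> s" by linarith
    have "D + 2 \<le> s" using Ds D0 by linarith
    then have "(D + 2) * s \<le> s * s" by (rule mult_le_mono1)
    then have "s + D * s + 2 \<le> s * s + 2 * D" using D0 by (simp add: algebra_simps)
    then obtain \<kappa> where \<kappa>: "\<kappa> + s + D * s + 2 = s * s + 2 * D" by (metis add.assoc add.commute le_iff_add)
    have n': "real (2 + 2 * q) \<le> \<tau> * ?n" using n(1) \<tau>(1) by (simp add: pos_divide_le_eq mult.commute)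
    note I = counting_inequalities[OF \<epsilon> D sD \<tau>_def q1 q2 \<eta>_def n' n(2,3) r rn \<kappa> refl refl refl refl refl refl]
    have sm: "(4 * real ?n + 2) * c * exp (- (?n * (\<eta>\<^sup>2 / 4))) < 1"
      using \<eta> c n by (intro linear_times_exp_small) auto
    have sm': "real ((4 * ?n + 2) * (s * s * q * (D * s * D))) = (4 * real ?n + 2) * c"
      by (simp only: c_def of_nat_mult of_nat_add of_nat_numeral)
    \<comment> \<open>The parameter \<open>P\<close> is taken to be \<open>D\<close>: the reserved
      index then costs a fraction \<open>1 / D\<close> of the edges, which is at most \<epsilon> /
      8.\<close>
    have "\<exists>f col. coloured_graph ?V (edges G) (edges H) f col s D q D \<epsilon> \<eta> r ?n"
    proof (rule exists_coloured_graph)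
      show "e \<subseteq> ?V" if "e \<in> edges G" for e using G that by (simp add: simple_graph_def)
      show "D \<le> s" using Ds by simp
      show "real ((4 * ?n + 2) * (s * s * q * (D * s * D))) * exp (- (?n * (\<eta>\<^sup>2 / 4))) < 1"
        using sm unfolding sm' .
    qed (use s q D0 \<eta> \<eta>1 fV HG(3) dH dG in blast)+
    then obtain f col where "coloured_graph ?V (edges G) (edges H) f col s D q D \<epsilon> \<eta> r ?n" by blast
    then interpret coloured_graph ?V "edges G" "edges H" f col s D q D \<epsilon> \<eta> r ?n .
    define N where "N = nat \<lceil>(1 - \<epsilon>) * real r / real (2 * (D * s))\<rceil>"
    let ?I = "({..<D} \<times> {..<s}) \<times> {..<N}"
    have "\<exists>xs. (\<forall>i\<in>?I. distinct (xs i) \<and> set (xs i) = ?V \<and> cycle_edges (xs i) \<subseteq> edges G) \<and>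
      disjoint_family_on (\<lambda>i. cycle_edges (xs i)) ?I"
      unfolding N_def by (rule hamilton_cycles_in_all_classes[OF refl refl refl I(5) \<kappa> refl I(1-4)])
    then obtain xs where xs: "\<forall>i\<in>?I. distinct (xs i) \<and> set (xs i) = ?V \<and> cycle_edges (xs i) \<subseteq> edges G"
      "disjoint_family_on (\<lambda>i. cycle_edges (xs i)) ?I" by (elim exE conjE)
    have "\<exists>\<C>. finite \<C> \<and> (\<forall>C\<in>\<C>. hamilton_cycle C G) \<and> pairwise edge_disjoint \<C> \<and> card \<C> = card ?I"
    proof (rule hamilton_cycles_of_lists[OF G _ n3 _ xs(2)])
      show "distinct (xs i) \<and> set (xs i) = ?V \<and> cycle_edges (xs i) \<subseteq> edges G" if "i \<in> ?I" for i using xs(1) that by blast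
    qed simp
    then obtain \<C> where \<C>: "finite \<C>" "\<forall>C\<in>\<C>. hamilton_cycle C G" "pairwise edge_disjoint \<C>"
      "card \<C> = card ?I" by (elim exE conjE)
    moreover have "card ?I = D * s * N" by (simp add: card_cartesian_product)
    ultimately have "(1 - \<epsilon>) * r / 2 \<le> card \<C>" using I(6) unfolding N_def by (simp only:)
    then show "\<exists>\<C>. finite \<C> \<and> (\<forall>C\<in>\<C>. hamilton_cycle C G) \<and> pairwise edge_disjoint \<C> \<and>
      (1 - \<epsilon>) * r / 2 \<le> card \<C>" using \<C>(1-3) by (intro exI[of _ \<C>] conjI)
  qed
qed

theorem theorem1p3:
  fixes \<epsilon> :: real
  assumes "\<epsilon> > 0"
  shows "\<exists>n0::nat. \<forall>n\<ge>n0. \<forall>G :: 'a graph.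
    simple_graph G \<and> card (verts G) = n \<and> real (min_degree G) \<ge> (1/2 + \<epsilon>) * real n \<longrightarrow>
    (\<exists>\<C> :: 'a graph set. finite \<C> \<and> (\<forall>C\<in>\<C>. hamilton_cycle C G) \<and> pairwise edge_disjoint \<C> \<and>
      real (card \<C>) \<ge> (1 - \<epsilon>) * real (reg_even G) / 2)"
proof -
  \<comment> \<open>The constants require a value of at most 1/4. Passing to a smaller one weakens
    the degree condition and strengthens the conclusion, so the result for \<open>e\<close> implies
    the claim.\<close>
  define e where "e = min \<epsilon> (1 / 4)"
  have e: "0 < e" "e \<le> 1 / 4" "e \<le> \<epsilon>" using assms by (auto simp: e_def)
  obtain n0 :: nat where n0: "\<And>(G :: 'a graph) H r. simple_graph G \<Longrightarrow> n0 \<le> card (verts G) \<Longrightarrow>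
    (\<forall>v\<in>verts G. (1 / 2 + e) * card (verts G) \<le> degree G v) \<Longrightarrow> factor r H G \<Longrightarrow> e * card (verts G) \<le> r \<Longrightarrow>
    \<exists>\<C>. finite \<C> \<and> (\<forall>C\<in>\<C>. hamilton_cycle C G) \<and> pairwise edge_disjoint \<C> \<and>
      (1 - e) * r / 2 \<le> card \<C>"
    using hamilton_cycles_dense[OF e(1,2), where 'a = 'a] by metis
  show ?thesis
  proof (intro exI[of _ "max n0 3"] allI impI, elim conjE)
    fix n :: nat and G :: "'a graph"
    assume n: "max n0 3 \<le> n" and G: "simple_graph G" and cG: "card (verts G) = n"
      and md: "(1/2 + \<epsilon>) * real n \<le> real (min_degree G)"
    have fV: "finite (verts G)" using G by (simp add: simple_graph_def)
    have deg: "(1 / 2 + e) * n \<le> degree G v" if "v \<in> verts G" for v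
    proof -
      have "min_degree G \<le> degree G v" unfolding min_degree_def using fV that by (intro Min_le) auto
      moreover have "(1 / 2 + e) * n \<le> (1 / 2 + \<epsilon>) * n" using e by (intro mult_right_mono) auto
      ultimately show ?thesis using md by linarith
    qed
    define r where "r = reg_even G"
    have "verts G \<noteq> {}" using cG n by auto
    then have "r \<in> {r. even r \<and> (\<exists>H. factor r H G)}"
      unfolding r_def reg_even_def using even_factors_finite[OF G] even_factors_nonempty[OF G]
      by (intro Max_in) auto
    then obtain H where r: "even r" "factor r H G" by auto
    have er: "(1 - \<epsilon>) * r / 2 \<le> (1 - e) * r / 2" using e by (intro divide_right_mono mult_right_mono) auto
    show "\<exists>\<C>. finite \<C> \<and> (\<forall>C\<in>\<C>. hamilton_cycle C G) \<and> pairwise edge_disjoint \<C> \<and>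
      (1 - \<epsilon>) * real (reg_even G) / 2 \<le> real (card \<C>)"
    proof (cases "e * n \<le> r")
      case True
      have "\<exists>\<C>. finite \<C> \<and> (\<forall>C\<in>\<C>. hamilton_cycle C G) \<and> pairwise edge_disjoint \<C> \<and>
        (1 - e) * r / 2 \<le> card \<C>"
        using n cG deg True by (intro n0[OF G _ _ r(2)]) auto
      then obtain \<C> where "finite \<C>" "\<forall>C\<in>\<C>. hamilton_cycle C G" "pairwise edge_disjoint \<C>"
        "(1 - e) * r / 2 \<le> card \<C>" by (elim exE conjE)
      then show ?thesis using er unfolding r_def[symmetric] by (intro exI[of _ \<C>]) auto
    next
      case False
      define k where "k = r div 2"
      have k: "real r = 2 * k" using r(1) by (auto simp: k_def elim!: evenE)
      have "card (verts G) + 4 * k \<le> 2 * card (nbrs (edges G) (verts G) v)" if "v \<in> verts G" for v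
      proof -
        \<comment> \<open>The surplus of the doubled degree over \<open>n\<close> is at least
          \<open>2 * e * n\<close>. In this case \<open>r = 2 * k\<close> is below
          \<open>e * n\<close>, so the surplus covers the \<open>4 * k\<close> that \<open>k\<close>
          greedy cycles require.\<close>
        have "real n + 2 * (e * n) \<le> 2 * real (degree G v)" using deg[OF that] by (simp add: algebra_simps)
        then have "real (n + 4 * k) \<le> real (2 * degree G v)" using False k by simp
        then show ?thesis using card_degree_nbrs[OF G that] cG by (simp only: of_nat_le_iff)
      qed
      then obtain xs where xs: "\<And>i. i < k \<Longrightarrow> distinct (xs i) \<and> set (xs i) = verts G \<and> cycle_edges (xs i) \<subseteq> edges G"
        "disjoint_family_on (\<lambda>i. cycle_edges (xs i)) {..<k}"
        using greedy_hamilton_cycles[OF fV, of k "edges G"] n cG by auto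
      then obtain \<C> where \<C>: "finite \<C>" "\<forall>C\<in>\<C>. hamilton_cycle C G" "pairwise edge_disjoint \<C>" "card \<C> = card {..<k}"
        using hamilton_cycles_of_lists[OF G, of "{..<k}" xs] n cG by auto
      moreover have "(1 - \<epsilon>) * r / 2 \<le> card \<C>"
      proof -
        have "(1 - \<epsilon>) * (r / 2) \<le> 1 * (r / 2)" using assms by (intro mult_right_mono) auto
        then show ?thesis using k \<C>(4) by simp
      qed
      ultimately show ?thesis unfolding r_def[symmetric] by blast
    qed
  qed
qed

end
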